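(* Let $(V,G)$ be an orthogonal representation of a compact Lie group $G$ with nontrivial copolarity, let $\Sigma\subseteq V$ be a fat section of $(V,G)$ with fat Weyl group $W$, and let $\sigma:V\to\Sigma$ be the orthogonal projection. Let $x\in\Sigma$, $E:=\operatorname{conv}(G\cdot x)$ and $P:=\operatorname{conv}(W\cdot x)$. Then up to conjugacy the face structure of $E$ is completely determined by that of $P$, i.e. the map $\mathscr{F}(P)\to\mathscr{F}(E)$, $Q\mapsto F_Q:=\sigma^{-1}(Q)\cap E$, induces a bijection between $\mathscr{F}(P)/W$ and $\mathscr{F}(E)/G$. Moreover, a face of $E$ is exposed if and only if the corresponding face of $P$ is exposed; that is, for every face $Q$ of $P$ and every $g\in G$, the face $g\cdot F_Q$ of $E$ is exposed (in $V$) if and only if $Q$ is an exposed face of $P$ (in $\Sigma$).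
   Context: An orthogonal representation $(V,G)$ of a compact Lie group $G$ is a continuous homomorphism $G\to O(V)$, where $V$ is a finite-dimensional real vector space with scalar product $\langle\cdot,\cdot\rangle$. A point $p\in V$ is $G$-regular if it lies on a principal orbit. $T_p(G\cdot p)$ denotes the tangent space of the orbit at $p$, and $\nu_p(G\cdot p)$ its orthogonal complement in $V$ (the normal space). A fat section of $(V,G)$ is a subset $\Sigma\subseteq V$ such that: (A) $\Sigma$ is a linear subspace of $V$ that intersects all $G$-orbits; (B) for some fixed integer $k\ge 0$, for all $G$-regular $p\in\Sigma$ we have $\nu_p(G\cdot p)\subseteq T_p\Sigma=\Sigma$ with codimension $k$; (C) for all $G$-regular $p\in\Sigma$ and all $g\in G$ such that $g\cdot p\in\Sigma$, we have $g\cdot\Sigma=\Sigma$. The whole space $V$ is always a fat section; $(V,G)$ has nontrivial copolarity if $V$ is not the unique fat section. The fat Weyl group of $\Sigma$ is $W:=N_G(\Sigma)/Z_G(\Sigma)$, where $N_G(\Sigma)=\{g\in G: g\cdot\Sigma=\Sigma\}$ and $Z_G(\Sigma)=\{g\in G: g\cdot x=x\ \text{for all } x\in\Sigma\}$; it acts naturally on $\Sigma$. $\operatorname{conv}$ denotes the convex hull. A face of a compact convex set $C$ is a convex subset $F\subset C$ such that whenever $x,y\in C$ and $\operatorname{relint}[x,y]\cap F\neq\emptyset$, one has $[x,y]\subset F$ (the sets $\emptyset$ and $C$ are faces). $\mathscr{F}(C)$ denotes the set of faces of $C$. $G$ acts on $\mathscr{F}(E)$ and $W$ acts on $\mathscr{F}(P)$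 by moving faces. If $C$ is a compact convex set in a Euclidean space $U$, a face of $C$ is exposed if it is of the form $F_u(C):=\{x\in C\mid\langle x,u\rangle=\max_{y\in C}\langle y,u\rangle\}$ for some nonzero $u\in U$. *)

theory Defs
  imports "HOL-Analysis.Analysis" "HOL-Algebra.Coset" "HOL-Algebra.Group_Action"
begin

subsection \<open>Smooth maps\<close>

primrec Ck_on :: "nat \<Rightarrow> ('a::euclidean_space \<Rightarrow> 'b::euclidean_space) \<Rightarrow> 'a set \<Rightarrow> bool" where
  "Ck_on 0 f U \<longleftrightarrow> continuous_on U f"
| "Ck_on (Suc k) f U \<longleftrightarrow>
     (\<forall>x\<in>U. f differentiable (at x)) \<and>
     (\<forall>v. Ck_on k (\<lambda>x. frechet_derivative f (at x) v) U)"

text \<open>Smoothness on an arbitrary subset means that there are local smooth extensions to open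
  sets of the ambient space.  On a relatively open subset of a linear subspace this is ordinary
  smoothness of a function of the coordinates of that subspace.\<close>

definition smooth_on :: "('a::euclidean_space \<Rightarrow> 'b::euclidean_space) \<Rightarrow> 'a set \<Rightarrow> bool" where
  "smooth_on f S \<longleftrightarrow>
     (\<forall>x\<in>S. \<exists>U h. open U \<and> x \<in> U \<and> (\<forall>k. Ck_on k h U) \<and> (\<forall>y\<in>U \<inter> S. h y = f y))"

subsection \<open>Compact Lie groups\<close>

text \<open>The charts take values in a linear subspace \<open>M\<close> of a Euclidean space rather than in the
  Euclidean space itself: \<open>DIM('e)\<close> is always positive, and finite groups (\<open>M = {0}\<close>) are
  Lie groups too.\<close>

type_synonym ('g, 'e) chart = "'g set \<times> ('g \<Rightarrow> 'e)"

definition smooth_manifold ::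
    "'g topology \<Rightarrow> 'e::euclidean_space set \<Rightarrow> ('g, 'e) chart set \<Rightarrow> bool" where
  "smooth_manifold X M \<A> \<longleftrightarrow>
     Hausdorff_space X \<and> second_countable X \<and> subspace M \<and>
     (\<Union>(U, c)\<in>\<A>. U) = topspace X \<and>
     (\<forall>(U, c)\<in>\<A>.
        openin X U \<and> openin (top_of_set M) (c ` U) \<and>
        homeomorphic_map (subtopology X U) (top_of_set (c ` U)) c) \<and>
     (\<forall>(U, c)\<in>\<A>. \<forall>(U', c')\<in>\<A>. smooth_on (c' \<circ> inv_into U c) (c ` (U \<inter> U')))"

definition compact_lie_group ::
    "('g, 'b) monoid_scheme \<Rightarrow> 'g topology \<Rightarrow> 'e::euclidean_space set \<Rightarrow> ('g, 'e) chart set \<Rightarrow> bool" where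
  "compact_lie_group G X M \<A> \<longleftrightarrow>
     group G \<and> topspace X = carrier G \<and> compact_space X \<and> smooth_manifold X M \<A> \<and>
     continuous_map (prod_topology X X) X (\<lambda>(g, h). g \<otimes>\<^bsub>G\<^esub> h) \<and>
     (\<forall>(U1, c1)\<in>\<A>. \<forall>(U2, c2)\<in>\<A>. \<forall>(U3, c3)\<in>\<A>.
        smooth_on (\<lambda>(a, b). c3 (inv_into U1 c1 a \<otimes>\<^bsub>G\<^esub> inv_into U2 c2 b))
          {(c1 g, c2 h) | g h. g \<in> U1 \<and> h \<in> U2 \<and> g \<otimes>\<^bsub>G\<^esub> h \<in> U3}) \<and>
     continuous_map X X (\<lambda>g. inv\<^bsub>G\<^esub> g) \<and>
     (\<forall>(U1, c1)\<in>\<A>. \<forall>(U2, c2)\<in>\<A>.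
        smooth_on (\<lambda>a. c2 (inv\<^bsub>G\<^esub> (inv_into U1 c1 a)))
          {c1 g | g. g \<in> U1 \<and> inv\<^bsub>G\<^esub> g \<in> U2})"

subsection \<open>Orthogonal representations\<close>

definition orthogonal_group :: "('v::euclidean_space \<Rightarrow> 'v) monoid" where
  "orthogonal_group = \<lparr>carrier = {f. orthogonal_transformation f}, mult = (\<circ>), one = id\<rparr>"

text \<open>The topology on the orthogonal group is the one induced by the operator norm.\<close>

definition orthogonal_representation ::
    "('g, 'b) monoid_scheme \<Rightarrow> 'g topology \<Rightarrow> ('g \<Rightarrow> 'v::euclidean_space \<Rightarrow> 'v) \<Rightarrow> bool" where
  "orthogonal_representation G X \<rho> \<longleftrightarrow>
     \<rho> \<in> hom G orthogonal_group \<and> continuous_map X euclidean (\<lambda>g. Blinfun (\<rho> g))"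

text \<open>Principal orbits are those of maximal orbit type: their isotropy groups are, up to
  conjugacy, contained in every isotropy group.\<close>

definition principal_orbit ::
    "('g, 'b) monoid_scheme \<Rightarrow> ('g \<Rightarrow> 'v::euclidean_space \<Rightarrow> 'v) \<Rightarrow> 'v set \<Rightarrow> bool" where
  "principal_orbit G \<rho> S \<longleftrightarrow>
     (\<exists>p. S = orbit G \<rho> p \<and>
       (\<forall>q. \<exists>g\<in>carrier G.
          stabilizer G \<rho> p \<subseteq> (g <#\<^bsub>G\<^esub> stabilizer G \<rho> q) #>\<^bsub>G\<^esub> inv\<^bsub>G\<^esub> g))"

definition regular_point ::
    "('g, 'b) monoid_scheme \<Rightarrow> ('g \<Rightarrow> 'v::euclidean_space \<Rightarrow> 'v) \<Rightarrow> 'v \<Rightarrow> bool" where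
  "regular_point G \<rho> p \<longleftrightarrow> (\<exists>S. principal_orbit G \<rho> S \<and> p \<in> S)"

text \<open>The tangent space at \<open>p\<close> of an embedded submanifold \<open>S\<close>: the velocities at \<open>p\<close> of the
  smooth curves in \<open>S\<close>.\<close>

definition tangent_space :: "'v::euclidean_space set \<Rightarrow> 'v \<Rightarrow> 'v set" where
  "tangent_space S p =
     {v. \<exists>\<gamma> e. 0 < e \<and> smooth_on \<gamma> {- e<..<e} \<and> \<gamma> ` {- e<..<e} \<subseteq> S \<and> \<gamma> 0 = p \<and>
            (\<gamma> has_vector_derivative v) (at (0::real))}"

definition normal_space :: "'v::euclidean_space set \<Rightarrow> 'v \<Rightarrow> 'v set" where
  "normal_space S p = (tangent_space S p)\<^sup>\<bottom>"

subsection \<open>Fat sections\<close>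

definition fat_section ::
    "('g, 'b) monoid_scheme \<Rightarrow> ('g \<Rightarrow> 'v::euclidean_space \<Rightarrow> 'v) \<Rightarrow> 'v set \<Rightarrow> bool" where
  "fat_section G \<rho> \<Sigma> \<longleftrightarrow>
     subspace \<Sigma> \<and> (\<forall>v. orbit G \<rho> v \<inter> \<Sigma> \<noteq> {}) \<and>
     (\<exists>k. \<forall>p\<in>\<Sigma>. regular_point G \<rho> p \<longrightarrow>
        normal_space (orbit G \<rho> p) p \<subseteq> \<Sigma> \<and>
        dim \<Sigma> = dim (normal_space (orbit G \<rho> p) p) + k) \<and>
     (\<forall>p\<in>\<Sigma>. regular_point G \<rho> p \<longrightarrow>
        (\<forall>g\<in>carrier G. \<rho> g p \<in> \<Sigma> \<longrightarrow> \<rho> g ` \<Sigma> = \<Sigma>))"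

definition nontrivial_copolarity ::
    "('g, 'b) monoid_scheme \<Rightarrow> ('g \<Rightarrow> 'v::euclidean_space \<Rightarrow> 'v) \<Rightarrow> bool" where
  "nontrivial_copolarity G \<rho> \<longleftrightarrow> (\<exists>\<Sigma>. fat_section G \<rho> \<Sigma> \<and> \<Sigma> \<noteq> UNIV)"

definition fat_N ::
    "('g, 'b) monoid_scheme \<Rightarrow> ('g \<Rightarrow> 'v \<Rightarrow> 'v) \<Rightarrow> 'v set \<Rightarrow> 'g set" where
  "fat_N G \<rho> \<Sigma> = {g \<in> carrier G. \<rho> g ` \<Sigma> = \<Sigma>}"

definition fat_Z ::
    "('g, 'b) monoid_scheme \<Rightarrow> ('g \<Rightarrow> 'v \<Rightarrow> 'v) \<Rightarrow> 'v set \<Rightarrow> 'g set" where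
  "fat_Z G \<rho> \<Sigma> = {g \<in> carrier G. \<forall>x\<in>\<Sigma>. \<rho> g x = x}"

definition fat_weyl_group ::
    "('g, 'b) monoid_scheme \<Rightarrow> ('g \<Rightarrow> 'v \<Rightarrow> 'v) \<Rightarrow> 'v set \<Rightarrow> 'g set monoid" where
  "fat_weyl_group G \<rho> \<Sigma> = (G\<lparr>carrier := fat_N G \<rho> \<Sigma>\<rparr>) Mod (fat_Z G \<rho> \<Sigma>)"

text \<open>The action of a coset \<open>w\<close> on a point \<open>y \<in> \<Sigma>\<close> is that of any of its representatives, see
  \<open>fat_weyl_act_eq\<close>.\<close>

definition fat_weyl_act :: "('g \<Rightarrow> 'v \<Rightarrow> 'v) \<Rightarrow> 'g set \<Rightarrow> 'v \<Rightarrow> 'v" where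
  "fat_weyl_act \<rho> w y = the_elem ((\<lambda>g. \<rho> g y) ` w)"

lemma fat_weyl_act_eq:
  fixes \<rho> :: "'g \<Rightarrow> 'v::euclidean_space \<Rightarrow> 'v"
  assumes \<rho>: "\<rho> \<in> hom G orthogonal_group"
    and w: "w \<in> carrier (fat_weyl_group G \<rho> \<Sigma>)" and g: "g \<in> w" and y: "y \<in> \<Sigma>"
  shows "fat_weyl_act \<rho> w y = \<rho> g y"
proof -
  have mult: "\<rho> (a \<otimes>\<^bsub>G\<^esub> b) y = \<rho> a (\<rho> b y)" if "a \<in> carrier G" "b \<in> carrier G" for a b
    using hom_mult[OF \<rho> that] by (simp add: orthogonal_group_def)
  obtain n where n: "n \<in> fat_N G \<rho> \<Sigma>" "w = fat_Z G \<rho> \<Sigma> #>\<^bsub>G\<lparr>carrier := fat_N G \<rho> \<Sigma>\<rparr>\<^esub> n"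
    using w by (auto simp: fat_weyl_group_def FactGroup_def RCOSETS_def)
  have *: "\<rho> h y = \<rho> n y" if "h \<in> w" for h
  proof -
    obtain z where z: "z \<in> fat_Z G \<rho> \<Sigma>" "h = z \<otimes>\<^bsub>G\<^esub> n"
      using \<open>h \<in> w\<close> by (auto simp: n r_coset_def)
    moreover have "\<rho> n y \<in> \<Sigma>" using n y by (auto simp: fat_N_def)
    ultimately show ?thesis using mult n by (simp add: fat_Z_def fat_N_def)
  qed
  then have "(\<lambda>g. \<rho> g y) ` w = {\<rho> g y}" using g by auto
  then show ?thesis by (simp add: fat_weyl_act_def)
qed

definition orthogonal_projection :: "'v::euclidean_space set \<Rightarrow> 'v \<Rightarrow> 'v" where
  "orthogonal_projection S v = (THE y. y \<in> S \<and> v - y \<in> S\<^sup>\<bottom>)"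

subsection \<open>Faces\<close>

definition faces :: "'v::euclidean_space set \<Rightarrow> 'v set set" where
  "faces C = {F. F face_of C}"

text \<open>The library predicate \<^const>\<open>exposed_face_of\<close> also allows the zero functional, which makes
  \<open>C\<close> itself always exposed, and a non-supporting hyperplane, which makes \<open>{}\<close> exposed.  Here
  \<open>L\<close> is the ambient linear subspace from which the nonzero normal vectors are taken.\<close>

definition exposed_in :: "'v::euclidean_space set \<Rightarrow> 'v set \<Rightarrow> 'v set \<Rightarrow> bool" where
  "exposed_in L C F \<longleftrightarrow> (\<exists>u\<in>L. u \<noteq> 0 \<and> F = {x\<in>C. \<forall>y\<in>C. y \<bullet> u \<le> x \<bullet> u})"

end

theory Submission
  imports Defs
begin

text \<open>
  The whole argument takes place in the compact group \<open>K\<close> of linear isometries of \<open>V\<close> through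
  which \<open>G\<close> acts.  For \<open>p \<in> V\<close> let the \<^emph>\<open>cell\<close> of \<open>p\<close> be the cone of all \<open>z\<close> that have the largest
  scalar product with \<open>p\<close> among the points of their orbit; every orbit meets every cell.  A point
  of the cell of \<open>p\<close> is normal at \<open>p\<close> to the orbit of \<open>p\<close>, so for a regular point \<open>p \<in> \<Sigma>\<close> the
  cell lies in \<open>\<Sigma>\<close> by condition (B).  Regular points are dense in \<open>\<Sigma>\<close>, and a limit argument gives
  the key property (\<open>orbit_meets_\<Sigma>_in_cell\<close>): for every \<open>y \<in> \<Sigma>\<close>, every orbit has a point that
  lies both in \<open>\<Sigma>\<close> and in the cell of \<open>y\<close>.  In other words, a functional in \<open>\<Sigma>\<close> attains its
  maximum over an orbit inside \<open>\<Sigma>\<close>.  With (C) the same limit argument shows that an orbit meets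
  \<open>\<Sigma>\<close> in a single orbit of the normalizer of \<open>\<Sigma>\<close> (\<open>transport_within_\<Sigma>\<close>).

  Comparing support functions, one obtains \<open>\<sigma>(E) = E \<inter> \<Sigma> = P\<close> as in Kostant's convexity theorem.
  Since \<open>\<sigma>\<close> is linear, preimages in \<open>E\<close> of faces of \<open>P\<close> are faces of \<open>E\<close>.  Both the surjectivity
  and the injectivity of the map between orbits of faces follow once a relative interior point of a
  face \<open>Q\<close> is known to be a relative interior point of \<open>F\<^sub>Q\<close>, because distinct faces have disjoint
  relative interiors.  For \<open>Q = P\<close> this holds because a functional that exposes a proper face of
  \<open>E\<close> through \<open>y \<in> \<Sigma>\<close> can be rotated into \<open>\<Sigma>\<close> by an element of the stabilizer of \<open>y\<close>
  (\<open>rotate_functional_into_\<Sigma>\<close>).  A proper face \<open>Q\<close> lies in an exposed face of \<open>P\<close>, given by some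
  \<open>u \<in> \<Sigma>\<close>; one replaces \<open>E\<close> by the face exposed by \<open>u\<close>, the group by the stabilizer of \<open>u\<close>, and
  argues by induction on the dimension (\<open>rel_interior_of_face_lift\<close>).  This also covers faces that
  are not exposed.  The induction is possible because the key property passes to the action of the
  stabilizer of \<open>u\<close> on the normal space at \<open>u\<close> (\<open>slice_section_descends\<close>).

  Three facts about orbits are usually taken from the theory of Lie group actions: principal orbits
  exist, regular points are dense in \<open>\<Sigma>\<close>, and the cell of \<open>u\<close> fills a neighbourhood of \<open>u\<close> in a
  linear subspace.  The first follows by choosing a point whose stabilizer has a fixed space of
  maximal dimension.  The other two are consequences of the fact that the values at \<open>p\<close> of the
  equivariant polynomial maps \<open>V \<rightarrow> V\<close> are all the vectors fixed by the stabilizer of \<open>p\<close>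
  (\<open>equivariant_poly_through\<close>), which is the theorem of Stone and Weierstrass together with an
  averaging over \<open>K\<close>.  The invariant mean needed for the averaging is the limit of the averages
  over nets of minimal cardinality; Hall's marriage theorem shows that such averages hardly depend
  on the net.
\<close>

section \<open>Averages over minimal nets\<close>

text \<open>Halmos and Vaughan's induction: if some proper nonempty \<open>J\<close> has exactly as many neighbours as
  elements, then \<open>J\<close> and its complement can be matched separately; otherwise there is one neighbour to
  spare everywhere, and an arbitrary first choice does no harm.\<close>

theorem hall_marriage:
  assumes "finite A" and "\<And>a. a \<in> A \<Longrightarrow> finite (N a)"
    and "\<And>J. J \<subseteq> A \<Longrightarrow> card J \<le> card (\<Union>(N ` J))"
  shows "\<exists>f. inj_on f A \<and> (\<forall>a\<in>A. f a \<in> N a)"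
  using assms
proof (induction "card A" arbitrary: A N rule: less_induct)
  case less
  note fin = less.prems(1) and finN = less.prems(2) and hall = less.prems(3)
  show ?case
  proof (cases "\<exists>J. J \<subset> A \<and> J \<noteq> {} \<and> card (\<Union>(N ` J)) = card J")
    case True
    then obtain J where J: "J \<subset> A" "J \<noteq> {}" "card (\<Union>(N ` J)) = card J" by blast
    have finJ: "finite J" using J fin finite_subset by blast
    have "\<exists>f. inj_on f J \<and> (\<forall>a\<in>J. f a \<in> N a)"
      by (rule less.hyps) (use J fin finJ finN hall psubset_card_mono in auto)
    then obtain f where f: "inj_on f J" "\<forall>a\<in>J. f a \<in> N a" by blast
    define N' where "N' = (\<lambda>a. N a - \<Union>(N ` J))"
    have "\<exists>f. inj_on f (A - J) \<and> (\<forall>a\<in>A - J. f a \<in> N' a)"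
    proof (rule less.hyps)
      show "card (A - J) < card A"
        by (rule psubset_card_mono[OF fin]) (use J in auto)
      show "card L \<le> card (\<Union>(N' ` L))" if L: "L \<subseteq> A - J" for L
      proof -
        have finL: "finite L" using L fin finite_subset by blast
        have "card L + card J = card (L \<union> J)"
          using L finL finJ by (subst card_Un_disjoint) auto
        also have "\<dots> \<le> card (\<Union>(N ` (L \<union> J)))" by (rule hall) (use L J in auto)
        also have "\<Union>(N ` (L \<union> J)) = \<Union>(N' ` L) \<union> \<Union>(N ` J)" unfolding N'_def by auto
        also have "card \<dots> \<le> card (\<Union>(N' ` L)) + card (\<Union>(N ` J))" by (rule card_Un_le)
        finally show ?thesis using J by simp
      qed
    qed (use fin finN in \<open>auto simp: N'_def\<close>)
    then obtain f' where f': "inj_on f' (A - J)" "\<forall>a\<in>A - J. f' a \<in> N' a" by blast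
    define h where "h = (\<lambda>a. if a \<in> J then f a else f' a)"
    have "inj_on h A"
      unfolding inj_on_def h_def
    proof (intro ballI impI)
      fix x y assume xy: "x \<in> A" "y \<in> A" and eq: "(if x \<in> J then f x else f' x) = (if y \<in> J then f y else f' y)"
      have "f' v \<notin> \<Union>(N ` J)" if "v \<in> A" "v \<notin> J" for v using f' that by (auto simp: N'_def)
      moreover have "f v \<in> \<Union>(N ` J)" if "v \<in> J" for v using f that by auto
      ultimately have "x \<in> J \<longleftrightarrow> y \<in> J" using eq xy by metis
      then show "x = y" using eq xy f(1) f'(1) by (auto simp: inj_on_def split: if_splits)
    qed
    moreover have "\<forall>a\<in>A. h a \<in> N a" using f f' by (auto simp: h_def N'_def)
    ultimately show ?thesis by blast
  next
    case False
    show ?thesis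
    proof (cases "A = {}")
      case True
      then show ?thesis by simp
    next
      case False
      then obtain a where a: "a \<in> A" by blast
      then have "card {a} \<le> card (\<Union>(N ` {a}))" using hall by blast
      then have "N a \<noteq> {}" by auto
      then obtain b where b: "b \<in> N a" by blast
      define N' where "N' = (\<lambda>x. N x - {b})"
      have "\<exists>f. inj_on f (A - {a}) \<and> (\<forall>x\<in>A - {a}. f x \<in> N' x)"
      proof (rule less.hyps)
        show "card (A - {a}) < card A" by (rule card_Diff1_less[OF fin a])
        show "card L \<le> card (\<Union>(N' ` L))" if L: "L \<subseteq> A - {a}" for L
        proof (cases "L = {}")
          case nonempty: False
          have sub: "L \<subset> A" using L a by blast
          have "card L < card (\<Union>(N ` L))"
            using \<open>\<nexists>J. J \<subset> A \<and> J \<noteq> {} \<and> card (\<Union>(N ` J)) = card J\<close> nonempty sub hall[of L]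
            by (metis le_neq_implies_less psubset_imp_subset)
          moreover have "card (\<Union>(N ` L)) - 1 \<le> card (\<Union>(N' ` L))"
          proof -
            have "\<Union>(N' ` L) = \<Union>(N ` L) - {b}" unfolding N'_def by auto
            then show ?thesis by (metis card_Diff_singleton_if diff_le_self order_refl)
          qed
          ultimately show ?thesis by linarith
        qed simp
      qed (use fin finN in \<open>auto simp: N'_def\<close>)
      then obtain f where f: "inj_on f (A - {a})" "\<forall>x\<in>A - {a}. f x \<in> N' x" by blast
      have "inj_on (f(a := b)) A"
        using f by (auto simp: inj_on_def N'_def)
      moreover have "\<forall>x\<in>A. (f(a := b)) x \<in> N x" using f b by (auto simp: N'_def)
      ultimately show ?thesis by blast
    qed
  qed
qed

definition net :: "'a::metric_space set \<Rightarrow> real \<Rightarrow> 'a set \<Rightarrow> bool" where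
  "net K e A \<longleftrightarrow> finite A \<and> A \<subseteq> K \<and> K \<subseteq> (\<Union>a\<in>A. ball a e)"

definition min_net :: "'a::metric_space set \<Rightarrow> real \<Rightarrow> 'a set \<Rightarrow> bool" where
  "min_net K e A \<longleftrightarrow> net K e A \<and> (\<forall>B. net K e B \<longrightarrow> card A \<le> card B)"

definition average :: "'a set \<Rightarrow> ('a \<Rightarrow> real) \<Rightarrow> real" where
  "average A f = (\<Sum>a\<in>A. f a) / card A"

lemma min_net_exists:
  assumes "compact K" "0 < e"
  shows "\<exists>A. min_net K e A"
proof -
  have "\<exists>A. net K e A"
    using compactE_image[OF assms(1), of K "\<lambda>a. ball a e"] assms(2)
    unfolding net_def by (smt (verit) UN_I centre_in_ball open_ball subsetI)
  then show ?thesis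
    unfolding min_net_def using ex_has_least_nat[of "net K e" _ card] by blast
qed

text \<open>Join \<open>a\<close> to \<open>b\<close> when their balls meet.  Hall's condition holds by minimality: if a set \<open>J\<close> of
  points of \<open>A\<close> had fewer neighbours in \<open>B\<close>, exchanging \<open>J\<close> for these neighbours would give a
  smaller net.\<close>

lemma min_net_bij:
  assumes A: "min_net K e A" and B: "min_net K e B"
  shows "\<exists>f. bij_betw f A B \<and> (\<forall>a\<in>A. dist a (f a) < 2 * e)"
proof -
  have nA: "net K e A" and nB: "net K e B" using A B by (auto simp: min_net_def)
  then have finA: "finite A" and finB: "finite B" by (auto simp: net_def)
  have card: "card A = card B" using A B nA nB by (meson antisym min_net_def)
  define N where "N = (\<lambda>a. {b \<in> B. ball a e \<inter> ball b e \<noteq> {}})"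
  have "\<exists>f. inj_on f A \<and> (\<forall>a\<in>A. f a \<in> N a)"
  proof (rule hall_marriage[OF finA])
    show "card J \<le> card (\<Union>(N ` J))" if J: "J \<subseteq> A" for J
    proof -
      \<comment> \<open>A point near \<open>a \<in> J\<close> is also near some point of \<open>B\<close>, which is then joined to \<open>a\<close>.\<close>
      have "net K e ((A - J) \<union> \<Union>(N ` J))"
        unfolding net_def
      proof (intro conjI subsetI)
        fix x assume x: "x \<in> K"
        then obtain a b where ab: "a \<in> A" "x \<in> ball a e" "b \<in> B" "x \<in> ball b e"
          using nA nB unfolding net_def by blast
        then have "b \<in> N a" by (auto simp: N_def)
        then show "x \<in> (\<Union>a\<in>(A - J) \<union> \<Union>(N ` J). ball a e)" using ab by blast
      next
        show "finite ((A - J) \<union> \<Union>(N ` J))"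
          using finA finB finite_subset[of "\<Union>(N ` J)" B] by (auto simp: N_def)
      qed (use nA nB in \<open>auto simp: net_def N_def\<close>)
      then have "card A \<le> card ((A - J) \<union> \<Union>(N ` J))" using A by (auto simp: min_net_def)
      also have "\<dots> \<le> card (A - J) + card (\<Union>(N ` J))" by (rule card_Un_le)
      finally show ?thesis
        using card_Diff_subset[of J A] J finA card_mono[OF finA J] finite_subset[OF J finA] by linarith
    qed
  qed (use finB in \<open>auto simp: N_def\<close>)
  then obtain f where f: "inj_on f A" "\<forall>a\<in>A. f a \<in> N a" by blast
  have "f ` A = B"
    by (rule card_subset_eq[OF finB]) (use f card card_image[OF f(1)] in \<open>auto simp: N_def\<close>)
  moreover have "dist a (f a) < 2 * e" if "a \<in> A" for a
  proof -
    have "f a \<in> N a" using f(2) that by blast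
    then obtain x where x: "dist a x < e" "dist (f a) x < e" by (auto simp: N_def)
    then show ?thesis using dist_triangle3[of a "f a" x] by (simp add: dist_commute)
  qed
  ultimately show ?thesis using f(1) by (auto simp: bij_betw_def)
qed

lemma average_bound:
  assumes "finite A" "A \<noteq> {}" "\<And>a. a \<in> A \<Longrightarrow> \<bar>f a - c\<bar> \<le> d"
  shows "\<bar>average A f - c\<bar> \<le> d"
proof -
  have pos: "0 < real (card A)" using assms by (simp add: card_gt_0_iff)
  have "\<bar>(\<Sum>a\<in>A. f a) - card A * c\<bar> = \<bar>\<Sum>a\<in>A. f a - c\<bar>"
    by (simp add: sum_subtractf)
  also have "\<dots> \<le> (\<Sum>a\<in>A. \<bar>f a - c\<bar>)" by (rule sum_abs)
  also have "\<dots> \<le> card A * d" using sum_bounded_above[of A "\<lambda>a. \<bar>f a - c\<bar>" d] assms by simp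
  finally have *: "\<bar>(\<Sum>a\<in>A. f a) - card A * c\<bar> \<le> card A * d" .
  have "average A f - c = ((\<Sum>a\<in>A. f a) - card A * c) / card A"
    using pos by (simp add: average_def field_simps)
  then have "\<bar>average A f - c\<bar> = \<bar>(\<Sum>a\<in>A. f a) - card A * c\<bar> / card A" by simp
  also have "\<dots> \<le> d" using * pos by (simp add: field_simps)
  finally show ?thesis .
qed

lemma average_diff_bound:
  assumes "finite A" "A \<noteq> {}" "\<And>a. a \<in> A \<Longrightarrow> \<bar>f a - g a\<bar> \<le> d"
  shows "\<bar>average A f - average A g\<bar> \<le> d"
  using average_bound[of A "\<lambda>a. f a - g a" 0 d] assms
  by (simp add: average_def sum_subtractf diff_divide_distrib)

lemma min_net_average:
  assumes A: "min_net K e A" and B: "min_net K e B" and ne: "K \<noteq> {}"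
    and f: "\<And>a b. \<lbrakk>a \<in> K; b \<in> K; dist a b < 2 * e\<rbrakk> \<Longrightarrow> \<bar>f a - f b\<bar> \<le> d"
  shows "\<bar>average A f - average B f\<bar> \<le> d"
proof -
  obtain h where h: "bij_betw h A B" "\<forall>a\<in>A. dist a (h a) < 2 * e"
    using min_net_bij[OF A B] by blast
  have "average B f = average A (f \<circ> h)"
    using h(1) sum.reindex_bij_betw[OF h(1), of f] bij_betw_same_card[OF h(1)]
    by (simp add: average_def)
  moreover have "\<bar>average A f - average A (f \<circ> h)\<bar> \<le> d"
  proof (rule average_diff_bound)
    show "finite A" "A \<noteq> {}" using A ne by (auto simp: min_net_def net_def)
    show "\<bar>f a - (f \<circ> h) a\<bar> \<le> d" if "a \<in> A" for a
    proof -
      have "h a \<in> B" using h(1) that by (auto simp: bij_betw_def)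
      then show ?thesis using f[of a "h a"] that h(2) A B by (auto simp: min_net_def net_def)
    qed
  qed
  ultimately show ?thesis by simp
qed

lemma min_net_isometry:
  assumes A: "min_net K e A" and t: "t ` K = K" and d: "\<And>g h. dist (t g) (t h) = dist g h"
  shows "min_net K e (t ` A)" and "average (t ` A) f = average A (f \<circ> t)"
proof -
  have inj: "inj t"
  proof (rule injI)
    fix g h assume "t g = t h"
    then show "g = h" using d[of g h] by simp
  qed
  have *: "K \<subseteq> (\<Union>a\<in>t ` A. ball a e)"
  proof
    fix x assume "x \<in> K"
    then obtain y where y: "y \<in> K" "x = t y" using t by blast
    then have "y \<in> (\<Union>a\<in>A. ball a e)" using A unfolding min_net_def net_def by blast
    then obtain a where "a \<in> A" "dist a y < e" by (meson UN_E mem_ball)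
    then have "t a \<in> t ` A" "dist (t a) (t y) < e" using d by auto
    then show "x \<in> (\<Union>a\<in>t ` A. ball a e)" unfolding y(2) by (meson UN_I mem_ball)
  qed
  have "net K e (t ` A)" using A t * by (auto simp: min_net_def net_def)
  moreover have "card (t ` A) = card A" using inj by (simp add: card_image inj_on_subset)
  ultimately show "min_net K e (t ` A)" using A by (auto simp: min_net_def)
  show "average (t ` A) f = average A (f \<circ> t)"
    using inj inj_on_subset[OF inj, of A] by (simp add: average_def card_image sum.reindex)
qed

section \<open>An invariant mean on a compact group of isometries\<close>

lemma linear_blinfun [simp]: "linear (blinfun_apply k)"
  by (simp add: blinfun.bounded_linear_right bounded_linear.linear)

text \<open>The group is a set of bounded operators, so that it carries the metric of the operator norm.  This
  metric is invariant under translations from both sides, hence translations permute the nets of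
  minimal cardinality.\<close>

locale compact_isometry_group =
  fixes K :: "('v::euclidean_space \<Rightarrow>\<^sub>L 'v) set"
  assumes compact_K: "compact K"
    and norm_K: "k \<in> K \<Longrightarrow> norm (k v) = norm v"
    and id_K: "id_blinfun \<in> K"
    and comp_K: "\<lbrakk>g \<in> K; h \<in> K\<rbrakk> \<Longrightarrow> g o\<^sub>L h \<in> K"
    and ex_inv_K: "k \<in> K \<Longrightarrow> \<exists>k'\<in>K. \<forall>v. k' (k v) = v"
begin

lemma inner_K:
  assumes "k \<in> K"
  shows "k v \<bullet> k w = v \<bullet> w"
  using norm_K[OF assms] orthogonal_transformation[of "blinfun_apply k"]
  by (simp add: orthogonal_transformation_def blinfun.bounded_linear_right bounded_linear.linear)

lemma inverse_K:
  assumes "k \<in> K"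
  obtains k' where "k' \<in> K" "\<And>v. k' (k v) = v" "\<And>v. k (k' v) = v"
proof -
  obtain k' where k': "k' \<in> K" "\<And>v. k' (k v) = v" using ex_inv_K[OF assms] by blast
  obtain k'' where k'': "k'' \<in> K" "\<And>v. k'' (k' v) = v" using ex_inv_K[OF k'(1)] by blast
  have "k (k' v) = v" for v by (metis k'(2) k''(2))
  then show ?thesis using that k' by blast
qed

lemma norm_comp_K_right:
  assumes "k \<in> K"
  shows "norm (g o\<^sub>L k) = norm g"
proof (rule antisym)
  obtain k' where k': "k' \<in> K" "\<And>v. k (k' v) = v" using inverse_K[OF assms] by metis
  show "norm (g o\<^sub>L k) \<le> norm g"
    using norm_blinfun[of g] norm_K[OF assms]
    by (intro norm_blinfun_bound) (auto, metis)
  show "norm g \<le> norm (g o\<^sub>L k)"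
  proof (rule norm_blinfun_bound)
    fix v
    show "norm (g v) \<le> norm (g o\<^sub>L k) * norm v"
      using norm_blinfun[of "g o\<^sub>L k" "k' v"] k' norm_K by simp
  qed simp
qed

lemma dist_comp_K_right: "k \<in> K \<Longrightarrow> dist (g o\<^sub>L k) (h o\<^sub>L k) = dist g h"
proof -
  assume "k \<in> K"
  moreover have "(g o\<^sub>L k) - (h o\<^sub>L k) = (g - h) o\<^sub>L k"
    by (rule blinfun_eqI) (simp add: blinfun.diff_left)
  ultimately show ?thesis by (simp add: dist_norm norm_comp_K_right)
qed

lemma dist_comp_K_left: "k \<in> K \<Longrightarrow> dist (k o\<^sub>L g) (k o\<^sub>L h) = dist g h"
proof -
  assume k: "k \<in> K"
  have "norm (k o\<^sub>L f) = norm f" for f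
    using norm_blinfun[of f] norm_blinfun[of "k o\<^sub>L f"] norm_K[OF k]
    by (intro antisym norm_blinfun_bound) (auto simp: norm_blinfun)
  moreover have "(k o\<^sub>L g) - (k o\<^sub>L h) = k o\<^sub>L (g - h)"
    by (rule blinfun_eqI) (simp add: blinfun.diff_left blinfun.diff_right)
  ultimately show ?thesis by (simp add: dist_norm)
qed

lemma right_translation_K:
  assumes "k \<in> K" shows "(\<lambda>g. g o\<^sub>L k) ` K = K"
proof
  show "(\<lambda>g. g o\<^sub>L k) ` K \<subseteq> K" using assms comp_K by auto
  obtain k' where k': "k' \<in> K" "\<And>v. k' (k v) = v" using inverse_K[OF assms] by metis
  have "g = (g o\<^sub>L k') o\<^sub>L k" for g by (rule blinfun_eqI) (simp add: k')
  then show "K \<subseteq> (\<lambda>g. g o\<^sub>L k) ` K" using k' comp_K by blast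
qed

lemma left_translation_K:
  assumes "k \<in> K" shows "(\<lambda>g. k o\<^sub>L g) ` K = K"
proof
  show "(\<lambda>g. k o\<^sub>L g) ` K \<subseteq> K" using assms comp_K by auto
  obtain k' where k': "k' \<in> K" "\<And>v. k (k' v) = v" using inverse_K[OF assms] by metis
  have "g = k o\<^sub>L (k' o\<^sub>L g)" for g by (rule blinfun_eqI) (simp add: k')
  then show "K \<subseteq> (\<lambda>g. k o\<^sub>L g) ` K" using k' comp_K by blast
qed

lemma K_nonempty: "K \<noteq> {}" using id_K by auto

lemma average_swap:
  "average A (\<lambda>a. average B (f a)) = average B (\<lambda>b. average A (\<lambda>a. f a b))"
  by (simp add: average_def sum_divide_distrib flip: sum.swap[of _ B A])
    (simp add: field_simps)

text \<open>Two nets of different fineness are compared through the double average of \<open>f\<close> over all products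
  \<open>a b\<close>.  For fixed \<open>a\<close> the products run through a translate of \<open>B\<close>, for fixed \<open>b\<close> through a
  translate of \<open>A\<close>, and both translates are again minimal.\<close>

lemma min_net_averages_close:
  assumes A: "min_net K e A" and B: "min_net K e' B"
    and f: "\<And>g h. \<lbrakk>g \<in> K; h \<in> K; dist g h < 2 * e\<rbrakk> \<Longrightarrow> \<bar>f g - f h\<bar> \<le> d"
    and f': "\<And>g h. \<lbrakk>g \<in> K; h \<in> K; dist g h < 2 * e'\<rbrakk> \<Longrightarrow> \<bar>f g - f h\<bar> \<le> d"
  shows "\<bar>average A f - average B f\<bar> \<le> 2 * d"
proof -
  have AK: "finite A" "A \<subseteq> K" "A \<noteq> {}" and BK: "finite B" "B \<subseteq> K" "B \<noteq> {}"
    using A B K_nonempty by (auto simp: min_net_def net_def)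
  define D where "D = average A (\<lambda>a. average B (\<lambda>b. f (a o\<^sub>L b)))"
  have "\<bar>average B (\<lambda>b. f (a o\<^sub>L b)) - average B f\<bar> \<le> d" if a: "a \<in> A" for a
  proof -
    have aK: "a \<in> K" using a AK by auto
    note t = min_net_isometry[OF B left_translation_K[OF aK] dist_comp_K_left[OF aK]]
    show ?thesis
      using min_net_average[where f = f, OF t(1) B K_nonempty f'] t(2)[of f] by (simp add: o_def)
  qed
  then have 1: "\<bar>D - average B f\<bar> \<le> d"
    unfolding D_def by (intro average_bound[OF AK(1) AK(3)])
  have "\<bar>average A (\<lambda>a. f (a o\<^sub>L b)) - average A f\<bar> \<le> d" if b: "b \<in> B" for b
  proof -
    have bK: "b \<in> K" using b BK by auto
    note t = min_net_isometry[OF A right_translation_K[OF bK] dist_comp_K_right[OF bK]]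
    show ?thesis
      using min_net_average[where f = f, OF t(1) A K_nonempty f] t(2)[of f] by (simp add: o_def)
  qed
  then have 2: "\<bar>D - average A f\<bar> \<le> d"
    unfolding D_def average_swap[of A B] by (intro average_bound[OF BK(1) BK(3)])
  show ?thesis using 1 2 by linarith
qed

definition fine_net :: "nat \<Rightarrow> ('v \<Rightarrow>\<^sub>L 'v) set" where
  "fine_net n = (SOME A. min_net K (1 / Suc n) A)"

lemma fine_net: "min_net K (1 / Suc n) (fine_net n)"
  unfolding fine_net_def by (rule someI_ex, rule min_net_exists[OF compact_K]) simp

lemma fine_net_finite: "finite (fine_net n)" "fine_net n \<noteq> {}" "fine_net n \<subseteq> K"
  using fine_net[of n] K_nonempty by (auto simp: min_net_def net_def)

text \<open>For continuous functions this is integration with respect to normalized Haar measure.\<close>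

definition mean :: "(('v \<Rightarrow>\<^sub>L 'v) \<Rightarrow> real) \<Rightarrow> real" where
  "mean f = lim (\<lambda>n. average (fine_net n) f)"

lemma equicontinuous_at_scale:
  assumes "continuous_on K f" "0 < d"
  obtains m where "\<And>n g h. \<lbrakk>m \<le> n; g \<in> K; h \<in> K; dist g h < 2 * (1 / Suc n)\<rbrakk> \<Longrightarrow> \<bar>f g - f h\<bar> \<le> (d::real)"
proof -
  obtain e where e: "0 < e" "\<And>g h. \<lbrakk>g \<in> K; h \<in> K; dist h g < e\<rbrakk> \<Longrightarrow> dist (f h) (f g) < d"
    using compact_uniformly_continuous[OF assms(1) compact_K] assms(2)
    unfolding uniformly_continuous_on_def by metis
  obtain m where m: "inverse (Suc m) < e / 2" using reals_Archimedean[of "e/2"] e by auto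
  have "\<bar>f g - f h\<bar> \<le> d" if "m \<le> n" "g \<in> K" "h \<in> K" "dist g h < 2 * (1 / Suc n)" for n g h
  proof -
    have "1 / real (Suc n) \<le> 1 / Suc m" using that(1) by (intro divide_left_mono) auto
    then have "dist g h < e" using that(4) m by (simp add: inverse_eq_divide)
    then show ?thesis using e(2)[of h g] that by (simp add: dist_real_def)
  qed
  then show ?thesis using that by blast
qed

lemma mean_LIMSEQ:
  assumes f: "continuous_on K f"
  shows "(\<lambda>n. average (fine_net n) f) \<longlonglongrightarrow> mean f"
proof -
  have "Cauchy (\<lambda>n. average (fine_net n) f)"
  proof (rule metric_CauchyI)
    fix d :: real assume d: "0 < d"
    then obtain m where m: "\<And>n g h. \<lbrakk>m \<le> n; g \<in> K; h \<in> K; dist g h < 2 * (1 / Suc n)\<rbrakk> \<Longrightarrow> \<bar>f g - f h\<bar> \<le> d / 3"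
      using equicontinuous_at_scale[OF f, of "d/3"] by auto
    have "dist (average (fine_net n) f) (average (fine_net n') f) < d" if n: "m \<le> n" "m \<le> n'" for n n'
      using min_net_averages_close[where f = f, OF fine_net fine_net m[OF n(1)] m[OF n(2)]] d
      by (force simp: dist_real_def)
    then show "\<exists>m. \<forall>n\<ge>m. \<forall>n'\<ge>m. dist (average (fine_net n) f) (average (fine_net n') f) < d"
      by blast
  qed
  then show ?thesis
    unfolding mean_def using Cauchy_convergent convergent_LIMSEQ_iff by blast
qed

lemma mean_add:
  assumes "continuous_on K f" "continuous_on K g"
  shows "mean (\<lambda>k. f k + g k) = mean f + mean g"
proof -
  have "average A (\<lambda>k. f k + g k) = average A f + average A g" for A
    by (simp add: average_def sum.distrib add_divide_distrib)
  then show ?thesis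
    using tendsto_add[OF assms[THEN mean_LIMSEQ]] by (simp add: mean_def limI)
qed

lemma mean_cmult:
  assumes "continuous_on K f"
  shows "mean (\<lambda>k. c * f k) = c * mean f"
proof -
  have "average A (\<lambda>k. c * f k) = c * average A f" for A
    by (simp add: average_def sum_distrib_left)
  then show ?thesis
    using tendsto_mult_left[OF mean_LIMSEQ[OF assms], of c] by (simp add: mean_def limI)
qed

lemma mean_bound:
  assumes "continuous_on K f" "\<And>k. k \<in> K \<Longrightarrow> \<bar>f k - c\<bar> \<le> d"
  shows "\<bar>mean f - c\<bar> \<le> d"
proof (rule LIMSEQ_le_const2)
  show "(\<lambda>n. \<bar>average (fine_net n) f - c\<bar>) \<longlonglongrightarrow> \<bar>mean f - c\<bar>"
    by (intro tendsto_intros mean_LIMSEQ assms)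
  show "\<exists>N. \<forall>n\<ge>N. \<bar>average (fine_net n) f - c\<bar> \<le> d"
    using average_bound fine_net_finite assms(2) by (metis subsetD)
qed

lemma mean_right_translation:
  assumes f: "continuous_on K f" and k: "k \<in> K"
  shows "mean (\<lambda>g. f (g o\<^sub>L k)) = mean f"
proof -
  have "(\<lambda>n. average (fine_net n) (\<lambda>g. f (g o\<^sub>L k)) - average (fine_net n) f) \<longlonglongrightarrow> 0"
  proof (rule LIMSEQ_I)
    fix d :: real assume d: "0 < d"
    then obtain m where m: "\<And>n g h. \<lbrakk>m \<le> n; g \<in> K; h \<in> K; dist g h < 2 * (1 / Suc n)\<rbrakk> \<Longrightarrow> \<bar>f g - f h\<bar> \<le> d / 2"
      using equicontinuous_at_scale[OF f, of "d/2"] by auto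
    have "norm (average (fine_net n) (\<lambda>g. f (g o\<^sub>L k)) - average (fine_net n) f - 0) < d" if n: "m \<le> n" for n
    proof -
      note t = min_net_isometry[OF fine_net[of n] right_translation_K[OF k] dist_comp_K_right[OF k]]
      show ?thesis
        using min_net_average[where f = f, OF t(1) fine_net[of n] K_nonempty m[OF n]] t(2)[of f] d
        by (simp add: o_def)
    qed
    then show "\<exists>m. \<forall>n\<ge>m. norm (average (fine_net n) (\<lambda>g. f (g o\<^sub>L k)) - average (fine_net n) f - 0) < d"
      by blast
  qed
  from tendsto_add[OF this mean_LIMSEQ[OF f]]
  show ?thesis by (simp add: mean_def limI)
qed

end

section \<open>Equivariant polynomial maps\<close>

text \<open>Finite sums of products of a continuous function of the operator and a polynomial in the vector.
  On such sums the mean over the operator acts on coefficients only, so that the result is still a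
  polynomial in the vector.\<close>

inductive separated :: "(('v::euclidean_space \<Rightarrow>\<^sub>L 'v) \<Rightarrow> 'v \<Rightarrow> real) \<Rightarrow> bool" where
  product: "\<lbrakk>continuous_on UNIV a; real_polynomial_function m\<rbrakk> \<Longrightarrow> separated (\<lambda>h y. a h * m y)"
| add: "\<lbrakk>separated f; separated g\<rbrakk> \<Longrightarrow> separated (\<lambda>h y. f h y + g h y)"

lemma separated_left_mult:
  assumes "separated g" "continuous_on UNIV a" "real_polynomial_function m"
  shows "separated (\<lambda>h y. (a h * m y) * g h y)"
  using assms(1)
proof induction
  case (product a' m')
  have "separated (\<lambda>h y. (a h * a' h) * (m y * m' y))"
    using assms(2,3) product by (intro separated.product continuous_intros real_polynomial_function.intros(4))
  then show ?case by (simp add: mult_ac)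
next
  case (add f g)
  show ?case using separated.add[OF add.IH] by (simp add: algebra_simps)
qed

lemma separated_mult:
  assumes "separated f" "separated g"
  shows "separated (\<lambda>h y. f h y * g h y)"
  using assms(1)
proof induction
  case (product a m)
  then show ?case using separated_left_mult[OF assms(2)] by simp
next
  case (add f1 f2)
  show ?case using separated.add[OF add.IH] by (simp add: algebra_simps)
qed

lemma separated_coeff: "continuous_on UNIV a \<Longrightarrow> separated (\<lambda>h y. a h)"
  using separated.product[of a "\<lambda>y. 1"] by (simp add: real_polynomial_function.intros(2))

lemma separated_sum:
  assumes "finite J" "\<And>j. j \<in> J \<Longrightarrow> separated (f j)"
  shows "separated (\<lambda>h y. \<Sum>j\<in>J. f j h y)"
  using assms
proof induction
  case empty
  then show ?case using separated_coeff[of "\<lambda>h. 0"] by simp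
next
  case (insert j J)
  then show ?case using separated.add[of "f j" "\<lambda>h y. \<Sum>j\<in>J. f j h y"] by simp
qed

lemma separated_polynomial:
  assumes "real_polynomial_function q"
  shows "separated (\<lambda>h y. q (blinfun_apply h y))"
  using assms
proof induction
  case (linear q)
  interpret q: bounded_linear q by fact
  have "(\<lambda>(h :: 'a \<Rightarrow>\<^sub>L 'a) y. \<Sum>b\<in>Basis. q (blinfun_apply h b) * (y \<bullet> b)) = (\<lambda>h y. q (h y))"
  proof (intro ext)
    fix h :: "'a \<Rightarrow>\<^sub>L 'a" and y :: 'a
    have "q (blinfun_apply h (\<Sum>b\<in>Basis. (y \<bullet> b) *\<^sub>R b)) = (\<Sum>b\<in>Basis. q (h b) * (y \<bullet> b))"
      unfolding blinfun.sum_right blinfun.scaleR_right q.sum q.scaleR by (simp add: mult.commute)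
    then show "(\<Sum>b\<in>Basis. q (blinfun_apply h b) * (y \<bullet> b)) = q (h y)"
      by (simp add: euclidean_representation)
  qed
  moreover have "separated (\<lambda>(h :: 'a \<Rightarrow>\<^sub>L 'a) y. \<Sum>b\<in>Basis. q (blinfun_apply h b) * (y \<bullet> b))"
  proof (intro separated_sum separated.product finite_Basis)
    show "continuous_on UNIV (\<lambda>h. q (blinfun_apply h b))" for b :: 'a
      by (rule q.continuous_on) (intro continuous_intros)
    show "real_polynomial_function (\<lambda>y. y \<bullet> b)" for b :: 'a
      by (intro real_polynomial_function.intros(1) bounded_linear_inner_left)
  qed
  ultimately show ?case by simp
next
  case (const c)
  then show ?case by (rule separated_coeff) simp
next
  case (add f g)
  then show ?case by (intro separated.add)
next
  case (mult f g)
  then show ?case by (intro separated_mult)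
qed

context compact_isometry_group
begin

lemma separated_continuous: "separated f \<Longrightarrow> continuous_on K (\<lambda>h. f h y)"
proof (induction rule: separated.induct)
  case (product a m)
  then show ?case by (intro continuous_on_mult_right continuous_on_subset[OF product(1)] subset_UNIV)
next
  case (add f g)
  then show ?case by (intro continuous_on_add)
qed

lemma mean_separated: "separated f \<Longrightarrow> real_polynomial_function (\<lambda>y. mean (\<lambda>h. f h y))"
proof (induction rule: separated.induct)
  case (product a m)
  have "mean (\<lambda>h. a h * m y) = m y * mean a" for y
    using mean_cmult[of a "m y"] continuous_on_subset[OF product(1)] by (simp add: mult.commute)
  then show ?case
    using product by (simp add: real_polynomial_function.intros(4) real_polynomial_function.intros(2))
next
  case (add f g)
  then show ?case
    by (simp add: mean_add separated_continuous real_polynomial_function.intros(3))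
qed

definition equivariant_poly :: "('v \<Rightarrow> 'v) \<Rightarrow> bool" where
  "equivariant_poly f \<longleftrightarrow> polynomial_function f \<and> (\<forall>k\<in>K. \<forall>y. f (k y) = k (f y))"

text \<open>The mean over \<open>h\<close> of \<open>h\<^sup>-\<^sup>1 (f (h y))\<close>, written in coordinates so that only the mean of real
  functions occurs; the inverse of an isometry is its adjoint.\<close>

definition symmetrize :: "('v \<Rightarrow> 'v) \<Rightarrow> 'v \<Rightarrow> 'v" where
  "symmetrize f y = (\<Sum>b\<in>Basis. mean (\<lambda>h. f (h y) \<bullet> h b) *\<^sub>R b)"

lemma separated_coefficient:
  fixes f :: "'v \<Rightarrow> 'v"
  assumes "polynomial_function f"
  shows "separated (\<lambda>h y. f (blinfun_apply h y) \<bullet> h w)"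
proof -
  have "separated (\<lambda>h y. \<Sum>b\<in>Basis. (f (blinfun_apply h y) \<bullet> b) * (h w \<bullet> b))"
  proof (rule separated_sum[OF finite_Basis])
    fix b :: 'v assume "b \<in> Basis"
    then have "real_polynomial_function (\<lambda>y. f y \<bullet> b)"
      using assms by (simp add: polynomial_function_iff_Basis_inner)
    then have "separated (\<lambda>h y. f (blinfun_apply h y) \<bullet> b)"
      by (rule separated_polynomial)
    moreover have "separated (\<lambda>h y. blinfun_apply h w \<bullet> b)"
      by (rule separated_coeff) (intro continuous_intros)
    ultimately show "separated (\<lambda>h y. (f (blinfun_apply h y) \<bullet> b) * (h w \<bullet> b))"
      by (rule separated_mult)
  qed
  moreover have "(\<lambda>h y. f (blinfun_apply h y) \<bullet> h w) = (\<lambda>h y. \<Sum>b\<in>Basis. (f (blinfun_apply h y) \<bullet> b) * (h w \<bullet> b))"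
    by (intro ext, rule euclidean_inner)
  ultimately show ?thesis by simp
qed

lemma inner_symmetrize:
  assumes "polynomial_function f"
  shows "symmetrize f y \<bullet> w = mean (\<lambda>h. f (h y) \<bullet> h w)"
proof -
  note cont = separated_continuous[OF separated_coefficient[OF assms]]
  have "mean (\<lambda>h. \<Sum>b\<in>B. (w \<bullet> b) * (f (h y) \<bullet> h b)) = (\<Sum>b\<in>B. (w \<bullet> b) * mean (\<lambda>h. f (h y) \<bullet> h b))"
    if "finite B" for B
    using that
  proof induction
    case empty
    show ?case using mean_cmult[of "\<lambda>h. 0" 0] by simp
  next
    case (insert b B)
    have "mean (\<lambda>h. (w \<bullet> b) * (f (h y) \<bullet> h b) + (\<Sum>b\<in>B. (w \<bullet> b) * (f (h y) \<bullet> h b))) =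
        mean (\<lambda>h. (w \<bullet> b) * (f (h y) \<bullet> h b)) + mean (\<lambda>h. \<Sum>b\<in>B. (w \<bullet> b) * (f (h y) \<bullet> h b))"
      by (intro mean_add continuous_on_sum continuous_on_mult_left cont)
    then show ?case
      using insert mean_cmult[OF cont, of "w \<bullet> b"] by simp
  qed
  from this[OF finite_Basis]
  have "mean (\<lambda>h. \<Sum>b\<in>Basis. (w \<bullet> b) * (f (h y) \<bullet> h b)) = symmetrize f y \<bullet> w"
    by (simp add: symmetrize_def inner_sum_left inner_commute[of w] mult.commute)
  moreover have "(\<lambda>h. \<Sum>b\<in>Basis. (w \<bullet> b) * (f (blinfun_apply h y) \<bullet> h b)) = (\<lambda>h. f (h y) \<bullet> h w)"
  proof
    fix h :: "'v \<Rightarrow>\<^sub>L 'v"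
    have "(\<Sum>b\<in>Basis. (w \<bullet> b) * (f (h y) \<bullet> h b)) = f (h y) \<bullet> blinfun_apply h (\<Sum>b\<in>Basis. (w \<bullet> b) *\<^sub>R b)"
      unfolding blinfun.sum_right blinfun.scaleR_right inner_sum_right by simp
    then show "(\<Sum>b\<in>Basis. (w \<bullet> b) * (f (blinfun_apply h y) \<bullet> h b)) = f (h y) \<bullet> h w"
      by (simp add: euclidean_representation)
  qed
  ultimately show ?thesis by simp
qed

lemma equivariant_symmetrize:
  assumes f: "polynomial_function f"
  shows "equivariant_poly (symmetrize f)"
  unfolding equivariant_poly_def
proof (intro conjI ballI allI)
  have "real_polynomial_function (\<lambda>y. symmetrize f y \<bullet> b)" for b
    unfolding inner_symmetrize[OF f] by (rule mean_separated[OF separated_coefficient[OF f]])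
  then show "polynomial_function (symmetrize f)" by (simp add: polynomial_function_iff_Basis_inner)
next
  fix k y assume k: "k \<in> K"
  obtain k' where k': "k' \<in> K" "\<And>v. k' (k v) = v" "\<And>v. k (k' v) = v" using inverse_K[OF k] by metis
  have "symmetrize f (k y) \<bullet> w = k (symmetrize f y) \<bullet> w" for w
  proof -
    have "k (symmetrize f y) \<bullet> w = symmetrize f y \<bullet> k' w"
      using inner_K[OF k, of "symmetrize f y" "k' w"] k' by simp
    also have "\<dots> = mean (\<lambda>h. f ((h o\<^sub>L k) y) \<bullet> (h o\<^sub>L k) (k' w))"
      unfolding inner_symmetrize[OF f]
      by (rule mean_right_translation[symmetric, OF separated_continuous[OF separated_coefficient[OF f]] k])
    also have "\<dots> = symmetrize f (k y) \<bullet> w" by (simp add: inner_symmetrize[OF f] k')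
    finally show ?thesis by simp
  qed
  then show "symmetrize f (k y) = k (symmetrize f y)" using vector_eq_rdot by blast
qed

definition Fix :: "'v \<Rightarrow> 'v set" where
  "Fix p = {v. \<forall>k\<in>K. k p = p \<longrightarrow> k v = v}"

lemma subspace_Fix: "subspace (Fix p)"
  by (auto simp: Fix_def subspace_def blinfun.add_right blinfun.scaleR_right)

text \<open>Because \<open>v\<close> is fixed by the stabilizer of \<open>p\<close>, sending \<open>k p\<close> to \<open>k v\<close> is a continuous map on the
  orbit.  A polynomial approximation of this map stays equally close to it under averaging, the map
  being equivariant itself.\<close>

lemma equivariant_polys_approximate:
  assumes v: "v \<in> Fix p" and e: "0 < e"
  shows "\<exists>f. equivariant_poly f \<and> norm (f p - v) \<le> e"
proof -
  define S where "S = (\<lambda>k. blinfun_apply k p) ` K"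
  define T where "T = (\<lambda>k. blinfun_apply k v) ` K"
  define g where "g = (\<lambda>x. (SOME k. k \<in> K \<and> k p = x) v)"
  have g: "g (k p) = k v" if k: "k \<in> K" for k
  proof -
    define h where "h = (SOME h. h \<in> K \<and> h p = k p)"
    have h: "h \<in> K" "h p = k p" using someI[of "\<lambda>h. h \<in> K \<and> h p = k p" k] k by (auto simp: h_def)
    obtain k' where k': "k' \<in> K" "\<And>v. k' (k v) = v" "\<And>v. k (k' v) = v" using inverse_K[OF k] by metis
    have "(k' o\<^sub>L h) p = p" by (simp add: h k')
    then have "(k' o\<^sub>L h) v = v" using v comp_K[OF k'(1) h(1)] unfolding Fix_def by blast
    then have "h v = k v" using k' by (metis blinfun_apply_blinfun_compose)
    then show ?thesis by (simp add: g_def h_def)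
  qed
  have cont: "continuous_on K (\<lambda>k. (blinfun_apply k p, blinfun_apply k v))"
    by (intro continuous_intros)
  have "continuous_on S g"
  proof (rule continuous_from_closed_graph)
    show "compact T" unfolding T_def
      by (intro compact_continuous_image continuous_intros compact_K)
    show "g \<in> S \<rightarrow> T" using g by (auto simp: S_def T_def)
    have "(\<lambda>x. (x, g x)) ` S = (\<lambda>k. (blinfun_apply k p, blinfun_apply k v)) ` K"
      using g by (force simp: S_def)
    then show "closed ((\<lambda>x. (x, g x)) ` S)"
      using compact_continuous_image[OF cont compact_K] compact_imp_closed by metis
  qed
  moreover have "compact S" unfolding S_def
    by (intro compact_continuous_image continuous_intros compact_K)
  ultimately obtain f where f: "polynomial_function f" "\<And>x. x \<in> S \<Longrightarrow> norm (g x - f x) < e"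
    using Stone_Weierstrass_polynomial_function e by metis
  have "\<bar>symmetrize f p \<bullet> w - v \<bullet> w\<bar> \<le> e * norm w" for w
    unfolding inner_symmetrize[OF f(1)]
  proof (rule mean_bound[OF separated_continuous[OF separated_coefficient[OF f(1)]]])
    fix k assume k: "k \<in> K"
    have "\<bar>f (k p) \<bullet> k w - v \<bullet> w\<bar> = \<bar>(f (k p) - k v) \<bullet> k w\<bar>"
      by (simp add: inner_diff_left inner_K[OF k])
    also have "\<dots> \<le> norm (f (k p) - k v) * norm w"
      using Cauchy_Schwarz_ineq2 norm_K[OF k] by metis
    also have "\<dots> \<le> e * norm w"
      using f(2)[of "k p"] k g[OF k] by (intro mult_right_mono) (auto simp: S_def norm_minus_commute)
    finally show "\<bar>f (k p) \<bullet> k w - v \<bullet> w\<bar> \<le> e * norm w" .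
  qed
  from this[of "symmetrize f p - v"]
  have "norm (symmetrize f p - v) * norm (symmetrize f p - v) \<le> e * norm (symmetrize f p - v)"
    by (simp add: power2_norm_eq_inner flip: inner_diff_left power2_eq_square)
  then have "norm (symmetrize f p - v) \<le> e"
    using e by (cases "symmetrize f p = v") auto
  then show ?thesis using equivariant_symmetrize[OF f(1)] by blast
qed

text \<open>The attained values form a linear subspace, and in finite dimension a dense subspace of \<open>Fix p\<close>
  is all of it.\<close>

theorem equivariant_poly_through:
  assumes "v \<in> Fix p"
  obtains f where "equivariant_poly f" "f p = v"
proof -
  define S where "S = {f p | f. equivariant_poly f}"
  have "subspace S"
    unfolding subspace_def
  proof (intro conjI ballI allI)
    show "0 \<in> S" unfolding S_def equivariant_poly_def
      by (auto intro!: exI[of _ "\<lambda>_. 0"] simp: blinfun.zero_right)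
    show "x + y \<in> S" if xy: "x \<in> S" "y \<in> S" for x y
    proof -
      obtain f g where "equivariant_poly f" "x = f p" "equivariant_poly g" "y = g p"
        using xy unfolding S_def by blast
      then show ?thesis unfolding S_def equivariant_poly_def
        by (auto intro!: exI[of _ "\<lambda>u. f u + g u"] simp: blinfun.add_right)
    qed
    show "c *\<^sub>R x \<in> S" if x: "x \<in> S" for c x
    proof -
      obtain f where "equivariant_poly f" "x = f p"
        using x unfolding S_def by blast
      then show ?thesis unfolding S_def equivariant_poly_def
        by (auto intro!: exI[of _ "\<lambda>u. c *\<^sub>R f u"] simp: blinfun.scaleR_right)
    qed
  qed
  then have "closed S" by (rule closed_subspace)
  moreover have "v \<in> closure S"
    unfolding closure_approachable
  proof (intro allI impI)
    fix e :: real assume "0 < e"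
    then obtain f where "equivariant_poly f" "norm (f p - v) \<le> e / 2"
      using equivariant_polys_approximate[OF assms, of "e/2"] by auto
    then show "\<exists>y\<in>S. dist y v < e" using \<open>0 < e\<close> by (auto simp: S_def dist_norm intro!: bexI[of _ "f p"])
  qed
  ultimately have "v \<in> S" by simp
  then show ?thesis using that by (auto simp: S_def)
qed

end

section \<open>Cells and normal cones of orbits\<close>

lemma real_polynomial_lipschitz:
  fixes q :: "'a::real_normed_vector \<Rightarrow> real"
  assumes "real_polynomial_function q"
  shows "\<exists>B C. 0 \<le> B \<and> 0 \<le> C \<and> (\<forall>y\<in>cball 0 R. \<bar>q y\<bar> \<le> B) \<and>
    (\<forall>y\<in>cball 0 R. \<forall>z\<in>cball 0 R. \<bar>q y - q z\<bar> \<le> C * norm (y - z))"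
  using assms
proof induction
  case (linear q)
  then obtain C where C: "0 \<le> C" "\<And>y. norm (q y) \<le> norm y * C"
    using bounded_linear.nonneg_bounded by blast
  show ?case
  proof (rule exI[of _ "C * \<bar>R\<bar>"], rule exI[of _ C], intro conjI ballI)
    fix y :: 'a assume "y \<in> cball 0 R"
    then have "norm y * C \<le> \<bar>R\<bar> * C" using C(1) by (intro mult_right_mono) auto
    then show "\<bar>q y\<bar> \<le> C * \<bar>R\<bar>" using C(2)[of y] by (simp add: mult.commute)
  next
    fix y z :: 'a assume "y \<in> cball 0 R" "z \<in> cball 0 R"
    show "\<bar>q y - q z\<bar> \<le> C * norm (y - z)"
      using C(2)[of "y - z"] linear by (simp add: bounded_linear.linear linear_diff mult.commute)
  qed (use C in auto)
next
  case (const c)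
  show ?case by (intro exI[of _ "\<bar>c\<bar>"] exI[of _ 0]) auto
next
  case (add f g)
  then obtain B C B' C' where f: "0 \<le> B" "0 \<le> C" "\<forall>y\<in>cball 0 R. \<bar>f y\<bar> \<le> B"
      "\<forall>y\<in>cball 0 R. \<forall>z\<in>cball 0 R. \<bar>f y - f z\<bar> \<le> C * norm (y - z)"
    and g: "0 \<le> B'" "0 \<le> C'" "\<forall>y\<in>cball 0 R. \<bar>g y\<bar> \<le> B'"
      "\<forall>y\<in>cball 0 R. \<forall>z\<in>cball 0 R. \<bar>g y - g z\<bar> \<le> C' * norm (y - z)"
    by metis
  show ?case
  proof (rule exI[of _ "B + B'"], rule exI[of _ "C + C'"], intro conjI ballI)
    fix y z :: 'a assume yz: "y \<in> cball 0 R" "z \<in> cball 0 R"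
    have "\<bar>f y - f z\<bar> \<le> C * norm (y - z)" "\<bar>g y - g z\<bar> \<le> C' * norm (y - z)" using f g yz by blast+
    then show "\<bar>f y + g y - (f z + g z)\<bar> \<le> (C + C') * norm (y - z)"
      unfolding distrib_right by linarith
  next
    fix y :: 'a assume y: "y \<in> cball 0 R"
    have "\<bar>f y\<bar> \<le> B" "\<bar>g y\<bar> \<le> B'" using f g y by blast+
    then show "\<bar>f y + g y\<bar> \<le> B + B'" by linarith
  qed (use f g in auto)
next
  case (mult f g)
  then obtain B C B' C' where f: "0 \<le> B" "0 \<le> C" "\<forall>y\<in>cball 0 R. \<bar>f y\<bar> \<le> B"
      "\<forall>y\<in>cball 0 R. \<forall>z\<in>cball 0 R. \<bar>f y - f z\<bar> \<le> C * norm (y - z)"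
    and g: "0 \<le> B'" "0 \<le> C'" "\<forall>y\<in>cball 0 R. \<bar>g y\<bar> \<le> B'"
      "\<forall>y\<in>cball 0 R. \<forall>z\<in>cball 0 R. \<bar>g y - g z\<bar> \<le> C' * norm (y - z)"
    by metis
  show ?case
  proof (rule exI[of _ "B * B'"], rule exI[of _ "B * C' + B' * C"], intro conjI ballI)
    fix y z :: 'a assume yz: "y \<in> cball 0 R" "z \<in> cball 0 R"
    have "f y * g y - f z * g z = f y * (g y - g z) + g z * (f y - f z)" by (simp add: algebra_simps)
    then have "\<bar>f y * g y - f z * g z\<bar> \<le> \<bar>f y\<bar> * \<bar>g y - g z\<bar> + \<bar>g z\<bar> * \<bar>f y - f z\<bar>"
      by (metis abs_mult abs_triangle_ineq)
    also have "\<dots> \<le> B * (C' * norm (y - z)) + B' * (C * norm (y - z))"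
      using f g yz by (intro add_mono mult_mono) auto
    finally show "\<bar>f y * g y - f z * g z\<bar> \<le> (B * C' + B' * C) * norm (y - z)"
      by (simp add: algebra_simps)
  next
    fix y :: 'a assume y: "y \<in> cball 0 R"
    then show "\<bar>f y * g y\<bar> \<le> B * B'"
      using f g unfolding abs_mult by (intro mult_mono) auto
  qed (use f g in auto)
qed

lemma polynomial_lipschitz:
  fixes f :: "'a::real_normed_vector \<Rightarrow> 'b::euclidean_space"
  assumes "polynomial_function f"
  obtains C where "0 \<le> C" "\<And>y z. \<lbrakk>norm y \<le> R; norm z \<le> R\<rbrakk> \<Longrightarrow> norm (f y - f z) \<le> C * norm (y - z)"
proof -
  have "\<exists>C. 0 \<le> C \<and> (\<forall>y\<in>cball 0 R. \<forall>z\<in>cball 0 R. \<bar>f y \<bullet> b - f z \<bullet> b\<bar> \<le> C * norm (y - z))"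
    if "b \<in> Basis" for b
    using real_polynomial_lipschitz[of "\<lambda>y. f y \<bullet> b" R] assms that
    by (auto simp: polynomial_function_iff_Basis_inner)
  then have "\<forall>b\<in>Basis. \<exists>C. 0 \<le> C \<and> (\<forall>y\<in>cball 0 R. \<forall>z\<in>cball 0 R. \<bar>f y \<bullet> b - f z \<bullet> b\<bar> \<le> C * norm (y - z))"
    by blast
  from bchoice[OF this] obtain C where
    *: "\<forall>b\<in>Basis. 0 \<le> C b \<and> (\<forall>y\<in>cball 0 R. \<forall>z\<in>cball 0 R. \<bar>f y \<bullet> b - f z \<bullet> b\<bar> \<le> C b * norm (y - z))"
    by blast
  then have C: "\<And>b. b \<in> Basis \<Longrightarrow> 0 \<le> C b"
    "\<And>b y z. \<lbrakk>b \<in> Basis; norm y \<le> R; norm z \<le> R\<rbrakk> \<Longrightarrow> \<bar>f y \<bullet> b - f z \<bullet> b\<bar> \<le> C b * norm (y - z)"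
    by simp_all
  have "norm (f y - f z) \<le> (\<Sum>b\<in>Basis. C b) * norm (y - z)" if "norm y \<le> R" "norm z \<le> R" for y z
  proof -
    have "norm (f y - f z) \<le> (\<Sum>b\<in>Basis. \<bar>(f y - f z) \<bullet> b\<bar>)" by (rule norm_le_l1)
    also have "\<dots> \<le> (\<Sum>b\<in>Basis. C b * norm (y - z))"
      using C(2) that by (intro sum_mono) (simp add: inner_diff_left)
    finally show ?thesis by (simp add: sum_distrib_right)
  qed
  then show ?thesis using that[of "\<Sum>b\<in>Basis. C b"] C(1) by (simp add: sum_nonneg)
qed

context compact_isometry_group
begin

text \<open>An equivariant polynomial map with \<open>f u = w\<close> sends \<open>k u\<close> to \<open>k w\<close>, and it is Lipschitz on bounded
  sets.\<close>

lemma fixed_vector_lipschitz: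
  assumes "w \<in> Fix u"
  obtains C where "0 \<le> C" "\<And>k. k \<in> K \<Longrightarrow> norm (k w - w) \<le> C * norm (k u - u)"
proof -
  obtain f where f: "equivariant_poly f" "f u = w" using equivariant_poly_through[OF assms] by blast
  then obtain C where C: "0 \<le> C" "\<And>y z. \<lbrakk>norm y \<le> norm u; norm z \<le> norm u\<rbrakk> \<Longrightarrow> norm (f y - f z) \<le> C * norm (y - z)"
    using polynomial_lipschitz[of f "norm u"] unfolding equivariant_poly_def by metis
  have "norm (k w - w) \<le> C * norm (k u - u)" if k: "k \<in> K" for k
  proof -
    have "f (k u) = k w" using f k by (simp add: equivariant_poly_def)
    then show ?thesis using C(2)[of "k u" u] norm_K[OF k, of u] f(2) by simp
  qed
  then show ?thesis using that C(1) by blast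
qed

text \<open>Equivalently, the points \<open>z\<close> to which no point of the orbit of \<open>p\<close> is nearer than \<open>p\<close>.  For a finite
  group this is the Dirichlet domain of \<open>p\<close>; for a polar representation and a regular point \<open>p\<close>, a
  closed Weyl chamber when \<open>K\<close> is connected.\<close>

definition cell :: "'v \<Rightarrow> 'v set" where
  "cell p = {z. \<forall>k\<in>K. k z \<bullet> p \<le> z \<bullet> p}"

lemma cell_sym: "z \<in> cell p \<longleftrightarrow> p \<in> cell z"
proof -
  have "p \<in> cell z" if "z \<in> cell p" for z p
    unfolding cell_def
  proof (intro CollectI ballI)
    fix k assume k: "k \<in> K"
    obtain k' where k': "k' \<in> K" "\<And>v. k' (k v) = v" "\<And>v. k (k' v) = v" using inverse_K[OF k] by metis
    have "k p \<bullet> z = k' z \<bullet> p" using inner_K[OF k, of p "k' z"] k' by (simp add: inner_commute)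
    then show "k p \<bullet> z \<le> p \<bullet> z" using that k' by (simp add: cell_def inner_commute)
  qed
  then show ?thesis by blast
qed

lemma orbit_meets_cell: "\<exists>k\<in>K. k v \<in> cell p"
proof -
  have "continuous_on K (\<lambda>k. blinfun_apply k v \<bullet> p)" by (intro continuous_intros)
  then obtain k where k: "k \<in> K" "\<And>h. h \<in> K \<Longrightarrow> h v \<bullet> p \<le> k v \<bullet> p"
    using continuous_attains_sup[OF compact_K K_nonempty] by blast
  have "h (k v) \<bullet> p \<le> k v \<bullet> p" if "h \<in> K" for h
    using k(2)[OF comp_K[OF that k(1)]] by simp
  then show ?thesis using k(1) by (auto simp: cell_def)
qed

text \<open>The four scalar products in \<open>k (z + p) \<bullet> (z + p)\<close> are each at most their value for the identity,
  and their sum is equal to it; so each of them is equal.\<close>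

lemma stabilizer_of_sum:
  assumes z: "z \<in> cell p" and k: "k \<in> K" and eq: "k (z + p) = z + p"
  shows "k z = z" "k p = p"
proof -
  have p: "p \<in> cell z" using z cell_sym by blast
  have "k z \<bullet> p \<le> z \<bullet> p" "k p \<bullet> z \<le> p \<bullet> z" using z p k by (auto simp: cell_def)
  moreover have le: "k v \<bullet> v \<le> v \<bullet> v" for v
    using norm_cauchy_schwarz[of "k v" v] norm_K[OF k, of v] by (simp add: dot_square_norm power2_eq_square)
  moreover have "k z \<bullet> z + k z \<bullet> p + k p \<bullet> z + k p \<bullet> p = z \<bullet> z + z \<bullet> p + p \<bullet> z + p \<bullet> p"
    using arg_cong[OF eq, of "\<lambda>v. v \<bullet> (z + p)"] by (simp add: blinfun.add_right inner_add_left inner_add_right)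
  ultimately have eqs: "k z \<bullet> z = z \<bullet> z" "k p \<bullet> p = p \<bullet> p" using le[of z] le[of p] by linarith+
  have "k v = v" if "k v \<bullet> v = v \<bullet> v" for v
  proof -
    have "(k v - v) \<bullet> (k v - v) = 0"
      using that inner_K[OF k, of v v] by (simp add: inner_diff_left inner_diff_right inner_commute)
    then show ?thesis by simp
  qed
  then show "k z = z" "k p = p" using eqs by blast+
qed

lemma stabilizer_group: "compact_isometry_group {k \<in> K. k p = p}"
proof
  have "closed {k. blinfun_apply k p = p}" by (intro closed_Collect_eq continuous_intros)
  moreover have "{k \<in> K. k p = p} = K \<inter> {k. blinfun_apply k p = p}" by auto
  ultimately show "compact {k \<in> K. k p = p}" using compact_K by (simp add: compact_Int_closed)
next
  fix k assume "k \<in> {k \<in> K. k p = p}"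
  then have k: "k \<in> K" "k p = p" by auto
  then obtain k' where k': "k' \<in> K" "\<And>v. k' (k v) = v" using inverse_K by metis
  moreover have "k' p = p" using k k' by metis
  ultimately show "\<exists>k'\<in>{k \<in> K. k p = p}. \<forall>v. k' (k v) = v" by blast
qed (auto simp: norm_K id_K comp_K)

lemma invariant_convex_fixed_point:
  assumes "compact S" "convex S" "S \<noteq> {}" and inv: "\<And>k v. \<lbrakk>k \<in> K; v \<in> S\<rbrakk> \<Longrightarrow> k v \<in> S"
  shows "\<exists>w\<in>S. \<forall>k\<in>K. k w = w"
proof (intro bexI ballI)
  have cl: "closed S" using assms compact_imp_closed by blast
  define w where "w = closest_point S 0"
  show wS: "closest_point S 0 \<in> S" using closest_point_in_set cl assms by blast
  fix k assume k: "k \<in> K"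
  have *: "\<forall>z\<in>S. dist 0 w \<le> dist 0 z" unfolding w_def using closest_point_le[OF cl] by blast
  have "norm (k w) = norm w" using norm_K k by simp
  then have "\<forall>z\<in>S. dist 0 (k w) \<le> dist 0 z" using * by simp
  then show "k (closest_point S 0) = closest_point S 0"
    using any_closest_point_unique[OF assms(2) cl, of "k w" w 0] inv[OF k] wS * by (simp add: w_def)
qed

text \<open>The proximal normal vectors of the orbit of \<open>u\<close> at \<open>u\<close>: those \<open>w\<close> for which \<open>w + m u\<close> belongs to
  the cell of \<open>u\<close> for large \<open>m\<close>.\<close>

definition normal_cone :: "'v \<Rightarrow> 'v set" where
  "normal_cone u = {w. \<exists>C. \<forall>k\<in>K. (k u - u) \<bullet> w \<le> C * (norm (k u - u))\<^sup>2}"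

lemma cell_subset_normal_cone: "cell u \<subseteq> normal_cone u"
proof
  fix z assume "z \<in> cell u"
  then have "u \<in> cell z" using cell_sym by blast
  then show "z \<in> normal_cone u"
    unfolding normal_cone_def cell_def by (auto intro!: exI[of _ 0] simp: inner_diff_left)
qed

lemma normal_cone_cell:
  assumes "w \<in> normal_cone u"
  obtains l where "\<And>m. l \<le> m \<Longrightarrow> w + m *\<^sub>R u \<in> cell u"
proof -
  obtain C where C: "\<And>k. k \<in> K \<Longrightarrow> (k u - u) \<bullet> w \<le> C * (norm (k u - u))\<^sup>2"
    using assms by (auto simp: normal_cone_def)
  have "w + m *\<^sub>R u \<in> cell u" if m: "2 * C \<le> m" for m
  proof -
    have "k u \<bullet> (w + m *\<^sub>R u) \<le> u \<bullet> (w + m *\<^sub>R u)" if k: "k \<in> K" for k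
    proof -
      have "(norm (k u - u))\<^sup>2 = 2 * (u \<bullet> u - k u \<bullet> u)"
        using inner_K[OF k, of u u] by (simp add: power2_norm_eq_inner inner_diff_left inner_diff_right inner_commute)
      moreover have "(k u - u) \<bullet> w \<le> (m / 2) * (norm (k u - u))\<^sup>2"
        using C[OF k] mult_right_mono[of C "m/2" "(norm (k u - u))\<^sup>2"] m by simp
      ultimately have "(k u - u) \<bullet> w \<le> (m / 2) * (2 * (u \<bullet> u - k u \<bullet> u))" by simp
      then have "(k u - u) \<bullet> w \<le> m * (u \<bullet> u - k u \<bullet> u)" by (simp add: algebra_simps)
      then show ?thesis by (simp add: inner_diff_left inner_add_right algebra_simps)
    qed
    then have "u \<in> cell (w + m *\<^sub>R u)" by (auto simp: cell_def)
    then show ?thesis using cell_sym by blast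
  qed
  then show ?thesis using that by blast
qed

lemma normal_cone_add:
  assumes "v \<in> normal_cone u" "w \<in> normal_cone u" shows "v + w \<in> normal_cone u"
proof -
  obtain C D where C: "\<And>k. k \<in> K \<Longrightarrow> (k u - u) \<bullet> v \<le> C * (norm (k u - u))\<^sup>2"
    and D: "\<And>k. k \<in> K \<Longrightarrow> (k u - u) \<bullet> w \<le> D * (norm (k u - u))\<^sup>2"
    using assms by (auto simp: normal_cone_def)
  show ?thesis unfolding normal_cone_def
  proof (intro CollectI exI ballI)
    fix k assume "k \<in> K"
    then show "(k u - u) \<bullet> (v + w) \<le> (C + D) * (norm (k u - u))\<^sup>2"
      unfolding inner_add_right distrib_right using C D by (intro add_mono)
  qed
qed

lemma normal_cone_scale:
  assumes "v \<in> normal_cone u" "0 \<le> c" shows "c *\<^sub>R v \<in> normal_cone u"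
proof -
  obtain C where C: "\<And>k. k \<in> K \<Longrightarrow> (k u - u) \<bullet> v \<le> C * (norm (k u - u))\<^sup>2"
    using assms by (auto simp: normal_cone_def)
  show ?thesis unfolding normal_cone_def
  proof (intro CollectI exI ballI)
    fix k assume "k \<in> K"
    then show "(k u - u) \<bullet> (c *\<^sub>R v) \<le> (c * C) * (norm (k u - u))\<^sup>2"
      unfolding inner_scaleR_right mult.assoc using C assms(2) by (intro mult_left_mono)
  qed
qed

lemma normal_cone_invariant:
  assumes w: "w \<in> normal_cone u" and h: "h \<in> K" "h u = u"
  shows "h w \<in> normal_cone u"
proof -
  obtain C where C: "\<And>k. k \<in> K \<Longrightarrow> (k u - u) \<bullet> w \<le> C * (norm (k u - u))\<^sup>2"
    using w by (auto simp: normal_cone_def)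
  obtain h' where h': "h' \<in> K" "\<And>v. h' (h v) = v" "\<And>v. h (h' v) = v" using inverse_K[OF h(1)] by metis
  have h'u: "h' u = u" using h h' by metis
  show ?thesis unfolding normal_cone_def
  proof (intro CollectI exI ballI)
    fix k assume k: "k \<in> K"
    have eq: "h ((h' o\<^sub>L k) u - u) = k u - u" by (simp add: blinfun.diff_right h' h)
    have "(k u - u) \<bullet> h w = ((h' o\<^sub>L k) u - u) \<bullet> w"
      using inner_K[OF h(1)] eq by metis
    also have "\<dots> \<le> C * (norm ((h' o\<^sub>L k) u - u))\<^sup>2" by (rule C[OF comp_K[OF h'(1) k]])
    also have "norm ((h' o\<^sub>L k) u - u) = norm (k u - u)" using norm_K[OF h(1)] eq by metis
    finally show "(k u - u) \<bullet> h w \<le> C * (norm (k u - u))\<^sup>2" .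
  qed
qed

text \<open>The bound for \<open>- w\<close> at \<open>k\<close> is the bound for \<open>w\<close> at the inverse of \<open>k\<close>, up to the error
  \<open>(k u - u) \<bullet> (k w - w)\<close>, which is quadratic because \<open>k w\<close> depends on \<open>k u\<close> in a Lipschitz way.\<close>

lemma normal_cone_uminus_fixed:
  assumes w: "w \<in> normal_cone u" and wf: "w \<in> Fix u"
  shows "- w \<in> normal_cone u"
proof -
  obtain C where C: "\<And>k. k \<in> K \<Longrightarrow> (k u - u) \<bullet> w \<le> C * (norm (k u - u))\<^sup>2"
    using w by (auto simp: normal_cone_def)
  obtain D where D: "0 \<le> D" "\<And>k. k \<in> K \<Longrightarrow> norm (k w - w) \<le> D * norm (k u - u)"
    using fixed_vector_lipschitz[OF wf] by blast
  show ?thesis unfolding normal_cone_def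
  proof (intro CollectI exI ballI)
    fix k assume k: "k \<in> K"
    obtain k' where k': "k' \<in> K" "\<And>v. k' (k v) = v" "\<And>v. k (k' v) = v" using inverse_K[OF k] by metis
    have adj: "k' u \<bullet> w = u \<bullet> k w" using inner_K[OF k, of "k' u" w] k' by simp
    have "(k u - u) \<bullet> - w = (k' u - u) \<bullet> w + (k u - u) \<bullet> (k w - w)"
      using inner_K[OF k, of u w] adj by (simp add: inner_diff_left inner_diff_right)
    moreover have "(k' u - u) \<bullet> w \<le> C * (norm (k u - u))\<^sup>2"
    proof -
      have "norm (k' u - u) = norm (k (k' u - u))" using norm_K[OF k] by simp
      also have "k (k' u - u) = u - k u" by (simp add: blinfun.diff_right k')
      finally show ?thesis using C[OF k'(1)] by (simp add: norm_minus_commute)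
    qed
    moreover have "(k u - u) \<bullet> (k w - w) \<le> D * (norm (k u - u))\<^sup>2"
    proof -
      have "(k u - u) \<bullet> (k w - w) \<le> norm (k u - u) * norm (k w - w)" by (rule norm_cauchy_schwarz)
      also have "\<dots> \<le> norm (k u - u) * (D * norm (k u - u))" using D(2)[OF k] by (intro mult_left_mono) auto
      finally show ?thesis by (simp add: power2_eq_square mult_ac)
    qed
    ultimately show "(k u - u) \<bullet> - w \<le> (C + D) * (norm (k u - u))\<^sup>2" unfolding distrib_right by linarith
  qed
qed

text \<open>A convex cone that contains a relative interior point together with its negative is a subspace.
  The stabilizer of \<open>u\<close> preserves the cone, so the convex hull of the orbit of a relative interior
  point under this stabilizer contains a relative interior point that is fixed; the negative of a
  fixed vector of the cone belongs to the cone by \<open>normal_cone_uminus_fixed\<close>.\<close>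

theorem subspace_normal_cone: "subspace (normal_cone u)"
proof -
  define T where "T = normal_cone u"
  have zero: "0 \<in> T" by (auto simp: T_def normal_cone_def intro!: exI[of _ 0])
  have conv: "convex T"
    unfolding convex_def T_def by (auto intro!: normal_cone_add normal_cone_scale)
  define H where "H = {k \<in> K. k u = u}"
  interpret H: compact_isometry_group H unfolding H_def by (rule stabilizer_group)
  obtain w0 where w0: "w0 \<in> rel_interior T"
    using rel_interior_eq_empty[OF conv] zero by blast
  define Z where "Z = (\<lambda>k. blinfun_apply k w0) ` H"
  have HT: "k v \<in> rel_interior T" if k: "k \<in> H" and v: "v \<in> rel_interior T" for k v
  proof -
    have "(\<lambda>v. blinfun_apply k v) ` T = T"
    proof
      show "blinfun_apply k ` T \<subseteq> T" using normal_cone_invariant k by (auto simp: T_def H_def)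
      obtain k' where k': "k' \<in> H" "\<And>v. k (k' v) = v" using H.inverse_K[OF k] by metis
      then have "k' v \<in> T" if "v \<in> T" for v using normal_cone_invariant that by (auto simp: T_def H_def)
      then show "T \<subseteq> blinfun_apply k ` T" using k'(2) by (metis image_eqI subsetI)
    qed
    moreover have "inj (blinfun_apply k)"
      using H.inverse_K[OF k] by (metis injI)
    then have "rel_interior (blinfun_apply k ` T) = blinfun_apply k ` rel_interior T"
      by (rule rel_interior_injective_linear_image[OF blinfun.bounded_linear_right])
    ultimately show ?thesis using v by (metis imageI)
  qed
  have "compact Z" unfolding Z_def
    by (intro compact_continuous_image continuous_intros H.compact_K)
  moreover have "Z \<noteq> {}" using H.K_nonempty by (simp add: Z_def)
  moreover have "k v \<in> convex hull Z" if "k \<in> H" "v \<in> convex hull Z" for k v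
  proof -
    have "blinfun_apply k ` Z \<subseteq> Z"
      using H.comp_K[OF that(1)] unfolding Z_def by (auto simp: image_iff) (metis blinfun_apply_blinfun_compose)
    then have "convex hull (blinfun_apply k ` Z) \<subseteq> convex hull Z" by (rule hull_mono)
    then show ?thesis
      using that(2) convex_hull_linear_image[of "blinfun_apply k" Z]
      by (auto simp: blinfun.bounded_linear_right bounded_linear.linear)
  qed
  ultimately obtain w where w: "w \<in> convex hull Z" "\<And>k. k \<in> H \<Longrightarrow> k w = w"
    using H.invariant_convex_fixed_point[of "convex hull Z"] compact_convex_hull convex_convex_hull
    by (metis convex_hull_eq_empty)
  have "Z \<subseteq> rel_interior T" using HT w0 by (auto simp: Z_def)
  then have wT: "w \<in> rel_interior T"
    using w(1) hull_minimal[of Z "rel_interior T" convex] convex_rel_interior[OF conv] by blast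
  have "w \<in> Fix u" using w(2) by (auto simp: Fix_def H_def)
  then have neg_w: "- w \<in> T"
    using normal_cone_uminus_fixed wT rel_interior_subset unfolding T_def by blast
  have neg: "- v \<in> T" if v: "v \<in> T" for v
  proof -
    obtain m where m: "1 < m" "(1 - m) *\<^sub>R v + m *\<^sub>R w \<in> T"
      using convex_rel_interior_if[OF conv wT] v hull_subset[of T affine]
      by (metis (no_types, opaque_lifting) add_0 diff_add_cancel order_refl zero less_add_same_cancel1 subsetD zero_less_one add.commute)
    then have "((1 - m) *\<^sub>R v + m *\<^sub>R w) + m *\<^sub>R (- w) \<in> T"
      using normal_cone_add[OF m(2)[unfolded T_def] normal_cone_scale[OF neg_w[unfolded T_def], of m]] m(1)
      unfolding T_def by simp
    then have "(1 - m) *\<^sub>R v \<in> T" by simp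
    then have "(1 / (m - 1)) *\<^sub>R ((1 - m) *\<^sub>R v) \<in> T"
      using normal_cone_scale[of "(1 - m) *\<^sub>R v" u "1 / (m - 1)"] m(1) by (simp add: T_def)
    moreover have "(1 / (m - 1)) *\<^sub>R ((1 - m) *\<^sub>R v) = - v"
    proof -
      have "(1 / (m - 1)) * (1 - m) = -1" using m(1) by (simp add: field_simps)
      then show ?thesis by (metis scaleR_minus1_left scaleR_scaleR)
    qed
    ultimately show ?thesis by simp
  qed
  have "c *\<^sub>R v \<in> T" if "v \<in> T" for c v
    using normal_cone_scale[of v u c] normal_cone_scale[of "- v" u "- c"] neg[OF that] that
    by (cases "0 \<le> c") (auto simp: T_def)
  then show ?thesis
    using zero normal_cone_add unfolding subspace_def T_def by blast
qed

end

section \<open>Regular points\<close>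

text \<open>Gaussian elimination over the ring of polynomials in one variable: linear independence at one
  parameter persists outside a finite set.\<close>

lemma finite_dependent_parameters:
  fixes c :: "'i \<Rightarrow> real \<Rightarrow> 'a::euclidean_space"
  assumes "finite I" "\<And>i. i \<in> I \<Longrightarrow> polynomial_function (c i)"
    and "\<And>a. (\<Sum>i\<in>I. a i *\<^sub>R c i s) = 0 \<Longrightarrow> \<forall>i\<in>I. a i = 0"
  shows "finite {t. \<exists>a. (\<Sum>i\<in>I. a i *\<^sub>R c i t) = 0 \<and> (\<exists>i\<in>I. a i \<noteq> (0::real))}"
  using assms
proof (induction I arbitrary: c)
  case empty
  then show ?case by simp
next
  case (insert i I)
  define e where "e = c i s"
  have "e \<noteq> 0"
  proof
    assume "e = 0"
    then have "(\<Sum>j\<in>insert i I. (if j = i then 1 else 0) *\<^sub>R c j s) = 0"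
      by (intro sum.neutral) (auto simp: e_def)
    from insert.prems(2)[OF this] show False by simp
  qed
  define \<phi> where "\<phi> = (\<lambda>t. c i t \<bullet> e)"
  have \<phi>s: "\<phi> s \<noteq> 0" using \<open>e \<noteq> 0\<close> by (simp add: \<phi>_def e_def)
  have inner_poly: "real_polynomial_function (\<lambda>t. c j t \<bullet> e)" if "j \<in> insert i I" for j
    using insert.prems(1)[OF that] bounded_linear_inner_left[of e]
    unfolding polynomial_function_def o_def by blast
  obtain a n where an: "\<phi> = (\<lambda>t. \<Sum>k\<le>n. a k * t ^ k)"
    using real_polynomial_function_imp_sum[OF inner_poly[of i]] unfolding \<phi>_def by auto
  have fin\<phi>: "finite {t. \<phi> t = 0}"
  proof -
    have "\<exists>k\<le>n. a k \<noteq> 0" using \<phi>s unfolding an by (metis (mono_tags, lifting) atMost_iff mult_zero_left sum.neutral)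
    then show ?thesis unfolding an using polyfun_finite_roots by blast
  qed
  \<comment> \<open>Use \<open>c i\<close> to eliminate the component along \<open>e\<close>, multiplying by \<open>\<phi>\<close> to avoid denominators.\<close>
  define c' where "c' = (\<lambda>j t. \<phi> t *\<^sub>R c j t - (c j t \<bullet> e) *\<^sub>R c i t)"
  have sum_c': "(\<Sum>j\<in>I. a j *\<^sub>R c' j t) =
      \<phi> t *\<^sub>R (\<Sum>j\<in>I. a j *\<^sub>R c j t) - ((\<Sum>j\<in>I. a j *\<^sub>R c j t) \<bullet> e) *\<^sub>R c i t" for a t
    by (simp add: c'_def scaleR_right_diff_distrib sum_subtractf scaleR_sum_right inner_sum_left
        scaleR_sum_left mult.commute)
  have "finite {t. \<exists>a. (\<Sum>j\<in>I. a j *\<^sub>R c' j t) = 0 \<and> (\<exists>j\<in>I. a j \<noteq> (0::real))}"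
  proof (rule insert.IH)
    fix j assume j: "j \<in> I"
    show "polynomial_function (c' j)"
      unfolding c'_def using insert.prems(1) inner_poly[of i] inner_poly[of j] j
      by (intro polynomial_function_diff polynomial_function_mult)
        (auto simp: \<phi>_def simp flip: real_polynomial_function_eq)
  next
    fix a assume "(\<Sum>j\<in>I. a j *\<^sub>R c' j s) = 0"
    then have 0: "\<phi> s *\<^sub>R (\<Sum>j\<in>I. a j *\<^sub>R c j s) - ((\<Sum>j\<in>I. a j *\<^sub>R c j s) \<bullet> e) *\<^sub>R c i s = 0"
      unfolding sum_c' .
    define a' where "a' = (\<lambda>j. if j = i then - ((\<Sum>j\<in>I. a j *\<^sub>R c j s) \<bullet> e) else \<phi> s * a j)"
    have "(\<Sum>j\<in>I. a' j *\<^sub>R c j s) = (\<Sum>j\<in>I. (\<phi> s * a j) *\<^sub>R c j s)"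
      using insert.hyps by (intro sum.cong) (auto simp: a'_def)
    then have "(\<Sum>j\<in>insert i I. a' j *\<^sub>R c j s) = 0"
      using 0 insert.hyps by (simp add: a'_def scaleR_sum_right algebra_simps)
    then have "\<forall>j\<in>insert i I. a' j = 0" by (rule insert.prems(2))
    then show "\<forall>j\<in>I. a j = 0" using \<phi>s insert.hyps by (auto simp: a'_def split: if_splits)
  qed
  moreover have "{t. \<exists>a. (\<Sum>j\<in>insert i I. a j *\<^sub>R c j t) = 0 \<and> (\<exists>j\<in>insert i I. a j \<noteq> (0::real))} \<subseteq>
      {t. \<phi> t = 0} \<union> {t. \<exists>a. (\<Sum>j\<in>I. a j *\<^sub>R c' j t) = 0 \<and> (\<exists>j\<in>I. a j \<noteq> (0::real))}"
  proof (intro subsetI UnCI)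
    fix t
    assume "t \<in> {t. \<exists>a. (\<Sum>j\<in>insert i I. a j *\<^sub>R c j t) = 0 \<and> (\<exists>j\<in>insert i I. a j \<noteq> (0::real))}"
      and "t \<notin> {t. \<exists>a. (\<Sum>j\<in>I. a j *\<^sub>R c' j t) = 0 \<and> (\<exists>j\<in>I. a j \<noteq> (0::real))}"
    then obtain a k where 0: "(\<Sum>j\<in>insert i I. a j *\<^sub>R c j t) = 0" and k: "k \<in> insert i I" "a k \<noteq> (0::real)"
      and no: "\<not> ((\<Sum>j\<in>I. a j *\<^sub>R c' j t) = 0 \<and> (\<exists>j\<in>I. a j \<noteq> 0))"
      by blast
    have S: "(\<Sum>j\<in>I. a j *\<^sub>R c j t) = - a i *\<^sub>R c i t"
      using 0 insert.hyps by (simp add: eq_neg_iff_add_eq_0 add.commute)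
    have "(\<Sum>j\<in>I. a j *\<^sub>R c' j t) = 0"
      unfolding sum_c' S by (simp add: \<phi>_def mult.commute)
    then have "\<forall>j\<in>I. a j = 0" using no by blast
    then have "a i *\<^sub>R c i t = 0" "a i \<noteq> 0" using S k by auto
    then show "t \<in> {t. \<phi> t = 0}" by (simp add: \<phi>_def)
  qed
  ultimately show ?case using fin\<phi> by (meson finite_UnI finite_subset)
qed

context compact_isometry_group
begin

text \<open>A larger stabilizer fixes fewer vectors, and a stabilizer is the pointwise stabilizer of its
  fixed space.  Measuring stabilizers by the dimension of the fixed space makes the existence of
  minimal ones obvious.\<close>

definition regular :: "'v \<Rightarrow> bool" where
  "regular p \<longleftrightarrow> (\<forall>q. dim (Fix q) \<le> dim (Fix p))"

lemma regular_exists: "\<exists>p. regular p"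
proof -
  have "\<forall>q. dim (Fix q) \<le> DIM('v)" using dim_subset_UNIV by blast
  then show ?thesis
    unfolding regular_def using ex_has_greatest_nat[of "\<lambda>_. True" 0 "\<lambda>q. dim (Fix q)" "Suc DIM('v)"]
    by (metis le_imp_less_Suc)
qed

lemma dim_Fix_orbit: assumes "k \<in> K" shows "dim (Fix q) \<le> dim (Fix (k q))"
proof -
  obtain k' where k': "k' \<in> K" "\<And>v. k' (k v) = v" "\<And>v. k (k' v) = v" using inverse_K[OF assms] by metis
  have "blinfun_apply k ` Fix q \<subseteq> Fix (k q)"
  proof clarify
    fix v assume v: "v \<in> Fix q"
    show "k v \<in> Fix (k q)"
      unfolding Fix_def
    proof (intro CollectI ballI impI)
      fix h assume h: "h \<in> K" "h (k q) = k q"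
      have "k' o\<^sub>L h o\<^sub>L k \<in> K" using h k' assms comp_K by blast
      moreover have "(k' o\<^sub>L h o\<^sub>L k) q = q" using h k' by simp
      ultimately have "(k' o\<^sub>L h o\<^sub>L k) v = v" using v unfolding Fix_def by blast
      then show "h (k v) = k v" using k' by (metis blinfun_apply_blinfun_compose)
    qed
  qed
  moreover have "inj_on (blinfun_apply k) (span (Fix q))" using k' by (metis inj_onI)
  then have "dim (blinfun_apply k ` Fix q) = dim (Fix q)"
    using dim_image_eq blinfun.bounded_linear_right bounded_linear.linear by blast
  ultimately show ?thesis by (metis dim_subset)
qed

text \<open>Move \<open>q\<close> to a point \<open>k q\<close> of the cell of \<open>p\<close>.  The stabilizer of \<open>k q + p\<close> fixes both \<open>k q\<close> and
  \<open>p\<close>; if \<open>p\<close> is regular, it cannot be smaller than the stabilizer of \<open>p\<close>, which therefore fixes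
  \<open>k q\<close>.\<close>

lemma regular_iff_minimal_stabilizer:
  "regular p \<longleftrightarrow> (\<forall>q. \<exists>k\<in>K. \<forall>h\<in>K. h p = p \<longrightarrow> h (k q) = k q)"
proof
  assume reg: "regular p"
  show "\<forall>q. \<exists>k\<in>K. \<forall>h\<in>K. h p = p \<longrightarrow> h (k q) = k q"
  proof
    fix q
    obtain k where k: "k \<in> K" "k q \<in> cell p" using orbit_meets_cell by blast
    have "Fix p \<subseteq> Fix (k q + p)"
      using stabilizer_of_sum(2)[OF k(2)] by (auto simp: Fix_def)
    then have "Fix p = Fix (k q + p)"
      using reg subspace_dim_equal[OF subspace_Fix subspace_Fix] by (auto simp: regular_def)
    moreover have "k q \<in> Fix (k q + p)"
      using stabilizer_of_sum(1)[OF k(2)] by (auto simp: Fix_def)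
    ultimately show "\<exists>k\<in>K. \<forall>h\<in>K. h p = p \<longrightarrow> h (k q) = k q"
      using k(1) by (auto simp: Fix_def)
  qed
next
  assume *: "\<forall>q. \<exists>k\<in>K. \<forall>h\<in>K. h p = p \<longrightarrow> h (k q) = k q"
  show "regular p"
    unfolding regular_def
  proof
    fix q
    obtain k where k: "k \<in> K" "\<forall>h\<in>K. h p = p \<longrightarrow> h (k q) = k q" using * by blast
    then have "Fix (k q) \<subseteq> Fix p" by (auto simp: Fix_def)
    then show "dim (Fix q) \<le> dim (Fix p)" using dim_Fix_orbit[OF k(1), of q] dim_subset le_trans by blast
  qed
qed

lemma regular_orbit: "\<lbrakk>regular p; k \<in> K\<rbrakk> \<Longrightarrow> regular (k p)"
  unfolding regular_def using dim_Fix_orbit le_trans by blast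

text \<open>Equivariant polynomial maps whose values at \<open>p\<close> form a basis of \<open>Fix p\<close> have linearly independent
  values at all but finitely many points of the line, and their values at \<open>y\<close> lie in \<open>Fix y\<close>.\<close>

lemma dense_regular_points_on_lines:
  assumes p: "regular p" and e: "0 < e"
  obtains t where "0 < t" "t < e" "regular (x + t *\<^sub>R (p - x))"
proof -
  obtain B where B: "B \<subseteq> Fix p" "independent B" "Fix p \<subseteq> span B" "card B = dim (Fix p)"
    using basis_exists by metis
  have finB: "finite B" using B(2) independent_imp_finite by blast
  have "\<forall>b\<in>B. \<exists>f. equivariant_poly f \<and> f p = b"
    using B(1) equivariant_poly_through by (metis subsetD)
  from bchoice[OF this] obtain f where f: "\<forall>b\<in>B. equivariant_poly (f b) \<and> f b p = b" by blast
  define l where "l = (\<lambda>t. x + t *\<^sub>R (p - x))"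
  have l: "polynomial_function l" unfolding l_def
    by (intro polynomial_function_add polynomial_function_mult polynomial_function_const)
      (auto simp: polynomial_function_id)
  define bad where "bad = {t. \<exists>a. (\<Sum>b\<in>B. a b *\<^sub>R f b (l t)) = 0 \<and> (\<exists>b\<in>B. a b \<noteq> (0::real))}"
  have "finite bad" unfolding bad_def
  proof (rule finite_dependent_parameters[OF finB, where s = 1])
    show "polynomial_function (\<lambda>t. f b (l t))" if "b \<in> B" for b
      using polynomial_function_compose[OF l, of "f b"] f that by (auto simp: equivariant_poly_def o_def)
    fix a :: "'v \<Rightarrow> real" assume "(\<Sum>b\<in>B. a b *\<^sub>R f b (l 1)) = 0"
    moreover have "(\<Sum>b\<in>B. a b *\<^sub>R f b (l 1)) = (\<Sum>b\<in>B. a b *\<^sub>R b)"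
      using f by (intro sum.cong) (auto simp: l_def)
    ultimately show "\<forall>b\<in>B. a b = 0"
      using B(2) finB independent_explicit by metis
  qed
  moreover have "infinite {0<..<e}" using e by (simp add: infinite_Ioo)
  ultimately obtain t where t: "t \<in> {0<..<e}" "t \<notin> bad"
    by (meson finite_subset subsetI)
  define g where "g = (\<lambda>b. f b (l t))"
  have indep: "\<forall>b\<in>B. a b = 0" if "(\<Sum>b\<in>B. a b *\<^sub>R g b) = 0" for a :: "'v \<Rightarrow> real"
    using t(2) that unfolding bad_def g_def by blast
  have inj: "inj_on g B"
  proof (rule inj_onI, rule ccontr)
    fix b c assume bc: "b \<in> B" "c \<in> B" "g b = g c" "b \<noteq> c"
    define a :: "'v \<Rightarrow> real" where "a = (\<lambda>d. if d = b then 1 else if d = c then -1 else 0)"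
    have "(\<Sum>d\<in>B. a d *\<^sub>R g d) = (\<Sum>d\<in>{b, c}. a d *\<^sub>R g d)"
      using bc finB by (intro sum.mono_neutral_right) (auto simp: a_def)
    also have "\<dots> = 0" using bc by (simp add: a_def)
    finally have "a b = 0" using indep bc(1) by blast
    then show False by (simp add: a_def)
  qed
  have "independent (g ` B)"
  proof (rule independent_if_scalars_zero)
    show "finite (g ` B)" using finB by simp
    fix a v assume "(\<Sum>v\<in>g ` B. a v *\<^sub>R v) = 0" and v: "v \<in> g ` B"
    then have "(\<Sum>b\<in>B. a (g b) *\<^sub>R g b) = 0" using inj by (simp add: sum.reindex)
    from indep[OF this] v show "a v = 0" by blast
  qed
  moreover have "g ` B \<subseteq> Fix (l t)"
  proof clarify
    fix b assume b: "b \<in> B"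
    have "k (f b (l t)) = f b (l t)" if "k \<in> K" "k (l t) = l t" for k
      using f b that unfolding equivariant_poly_def by metis
    then show "g b \<in> Fix (l t)" by (simp add: g_def Fix_def)
  qed
  ultimately have "card (g ` B) \<le> dim (Fix (l t))" using independent_card_le_dim by blast
  then have "dim (Fix p) \<le> dim (Fix (l t))" using card_image[OF inj] B(4) by simp
  then have "regular (l t)" using p unfolding regular_def by (meson le_trans)
  then show ?thesis using that t by (auto simp: l_def)
qed

end

section \<open>Fat sections of groups of isometries\<close>

text \<open>For regular \<open>p\<close> the points of the cell are normal vectors of the orbit at \<open>p\<close>, so that condition (B)
  puts the cell into \<open>\<Sigma>\<close>.\<close>

locale fat_section_of_isometries = compact_isometry_group K
  for K :: "('v::euclidean_space \<Rightarrow>\<^sub>L 'v) set" +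
  fixes \<Sigma> :: "'v set"
  assumes subspace_\<Sigma>: "subspace \<Sigma>"
    and orbit_meets_\<Sigma>: "\<exists>k\<in>K. k v \<in> \<Sigma>"
    and cell_subset_\<Sigma>: "\<lbrakk>p \<in> \<Sigma>; regular p\<rbrakk> \<Longrightarrow> cell p \<subseteq> \<Sigma>"
    and transporter: "\<lbrakk>p \<in> \<Sigma>; regular p; k \<in> K; k p \<in> \<Sigma>\<rbrakk> \<Longrightarrow> blinfun_apply k ` \<Sigma> = \<Sigma>"
begin

lemma regular_in_\<Sigma>: "\<exists>p\<in>\<Sigma>. regular p"
  using regular_exists orbit_meets_\<Sigma> regular_orbit by metis

lemma regular_sequence:
  assumes x: "x \<in> \<Sigma>"
  obtains p where "\<And>n. p n \<in> \<Sigma>" "\<And>n. regular (p n)" "p \<longlonglongrightarrow> x"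
proof -
  obtain q where q: "q \<in> \<Sigma>" "regular q" using regular_in_\<Sigma> by blast
  have "\<forall>n. \<exists>t. 0 < t \<and> t < inverse (Suc n) \<and> regular (x + t *\<^sub>R (q - x))"
    using dense_regular_points_on_lines[OF q(2)] by (metis inverse_positive_iff_positive of_nat_0_less_iff zero_less_Suc)
  then obtain t where t: "\<And>n. 0 < t n" "\<And>n. t n < inverse (Suc n)" "\<And>n. regular (x + t n *\<^sub>R (q - x))"
    by metis
  have "t \<longlonglongrightarrow> 0"
  proof (rule real_tendsto_sandwich[OF _ _ tendsto_const LIMSEQ_inverse_real_of_nat])
    show "\<forall>\<^sub>F n in sequentially. 0 \<le> t n" "\<forall>\<^sub>F n in sequentially. t n \<le> inverse (Suc n)"
      using less_imp_le[OF t(1)] less_imp_le[OF t(2)] by (intro always_eventually allI; blast)+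
  qed
  then have "(\<lambda>n. x + t n *\<^sub>R (q - x)) \<longlonglongrightarrow> x + 0 *\<^sub>R (q - x)" by (intro tendsto_intros)
  moreover have "x + t n *\<^sub>R (q - x) \<in> \<Sigma>" for n
    using subspace_\<Sigma> x q by (intro subspace_add subspace_scale subspace_diff)
  ultimately show ?thesis using that[of "\<lambda>n. x + t n *\<^sub>R (q - x)"] t by simp
qed

lemma closed_\<Sigma>: "closed \<Sigma>" using closed_subspace subspace_\<Sigma> by blast

lemma convergent_subsequence_K:
  fixes k :: "nat \<Rightarrow> ('v \<Rightarrow>\<^sub>L 'v)"
  assumes "\<And>n. k n \<in> K"
  obtains r h where "strict_mono r" "h \<in> K" "(k \<circ> r) \<longlonglongrightarrow> h"
proof -
  obtain h r where "h \<in> K" "strict_mono r" "(k \<circ> r) \<longlonglongrightarrow> h"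
    using seq_compactE[OF compact_imp_seq_compact[OF compact_K], of k] assms by auto
  then show ?thesis using that by blast
qed

text \<open>At a regular point of \<open>\<Sigma>\<close> the whole cell lies in \<open>\<Sigma>\<close>; approximate \<open>y\<close> by such points and pass to
  the limit.\<close>

lemma orbit_meets_\<Sigma>_in_cell:
  assumes y: "y \<in> \<Sigma>"
  shows "\<exists>k\<in>K. k v \<in> \<Sigma> \<inter> cell y"
proof -
  obtain p where p: "\<And>n. p n \<in> \<Sigma>" "\<And>n. regular (p n)" "p \<longlonglongrightarrow> y" using regular_sequence[OF y] by blast
  have "\<forall>n. \<exists>k. k \<in> K \<and> blinfun_apply k v \<in> cell (p n)" using orbit_meets_cell by blast
  from choice[OF this] obtain k where k: "\<And>n. k n \<in> K" "\<And>n. k n v \<in> cell (p n)" by blast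
  obtain r h where r: "strict_mono r" "h \<in> K" "(k \<circ> r) \<longlonglongrightarrow> h" using convergent_subsequence_K[of k] k by metis
  have lim: "(\<lambda>n. blinfun_apply (k (r n)) v) \<longlonglongrightarrow> h v" using r(3) by (intro tendsto_intros) (simp add: o_def)
  have "k (r n) v \<in> \<Sigma>" for n using cell_subset_\<Sigma>[OF p(1,2)] k by blast
  then have "h v \<in> \<Sigma>" using closed_sequentially[OF closed_\<Sigma> _ lim] by simp
  moreover have "g (h v) \<bullet> y \<le> h v \<bullet> y" if g: "g \<in> K" for g
  proof (rule LIMSEQ_le)
    have "(p \<circ> r) \<longlonglongrightarrow> y" using p(3) r(1) by (rule LIMSEQ_subseq_LIMSEQ)
    then have pr: "(\<lambda>n. p (r n)) \<longlonglongrightarrow> y" by (simp add: o_def)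
    show "(\<lambda>n. g (k (r n) v) \<bullet> p (r n)) \<longlonglongrightarrow> g (h v) \<bullet> y" "(\<lambda>n. k (r n) v \<bullet> p (r n)) \<longlonglongrightarrow> h v \<bullet> y"
      by (intro tendsto_intros lim pr)+
    show "\<exists>N. \<forall>n\<ge>N. g (k (r n) v) \<bullet> p (r n) \<le> k (r n) v \<bullet> p (r n)"
      using k(2) g by (auto simp: cell_def)
  qed
  ultimately show ?thesis using r(2) by (auto simp: cell_def)
qed

definition stabilizer_\<Sigma> :: "('v \<Rightarrow>\<^sub>L 'v) set" where
  "stabilizer_\<Sigma> = {k \<in> K. blinfun_apply k ` \<Sigma> = \<Sigma>}"

lemma image_\<Sigma>_eqI:
  assumes k: "k \<in> K" and "\<And>v. v \<in> \<Sigma> \<Longrightarrow> k v \<in> \<Sigma>"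
  shows "blinfun_apply k ` \<Sigma> = \<Sigma>"
proof -
  have "blinfun_apply k ` \<Sigma> \<subseteq> \<Sigma>" using assms(2) by blast
  moreover have "inj_on (blinfun_apply k) (span \<Sigma>)" using inverse_K[OF k] by (metis inj_onI)
  ultimately show ?thesis
    using subspace_dim_equal[OF linear_subspace_image[OF linear_blinfun subspace_\<Sigma>] subspace_\<Sigma>]
      dim_image_eq[OF linear_blinfun] by (metis order_refl)
qed

text \<open>For regular \<open>x\<close> this is condition (C).  In general, approximate \<open>x\<close> by regular \<open>p\<^sub>n \<in> \<Sigma>\<close> and
  \<open>g x\<close> by regular \<open>u\<^sub>n \<in> \<Sigma>\<close>, and move \<open>p\<^sub>n\<close> to the point of its orbit nearest to \<open>u\<^sub>n\<close>.  That
  point is in \<open>\<Sigma>\<close>, so the element used normalizes \<open>\<Sigma>\<close>; a limit of these elements takes \<open>x\<close> to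
  \<open>g x\<close>.\<close>

theorem transport_within_\<Sigma>:
  assumes x: "x \<in> \<Sigma>" and g: "g \<in> K" "g x \<in> \<Sigma>"
  shows "\<exists>n\<in>stabilizer_\<Sigma>. n x = g x"
proof -
  define y where "y = g x"
  obtain p where p: "\<And>n. p n \<in> \<Sigma>" "\<And>n. regular (p n)" "p \<longlonglongrightarrow> x" using regular_sequence[OF x] by blast
  obtain u where u: "\<And>n. u n \<in> \<Sigma>" "\<And>n. regular (u n)" "u \<longlonglongrightarrow> y"
    using regular_sequence[OF g(2)] unfolding y_def by blast
  have "\<forall>n. \<exists>k. k \<in> K \<and> blinfun_apply k (p n) \<in> cell (u n)" using orbit_meets_cell by blast
  from choice[OF this] obtain k where k: "\<And>n. k n \<in> K" "\<And>n. k n (p n) \<in> cell (u n)" by blast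
  obtain r h where r: "strict_mono r" "h \<in> K" "(k \<circ> r) \<longlonglongrightarrow> h" using convergent_subsequence_K[of k] k by metis
  have kl: "(\<lambda>n. k (r n)) \<longlonglongrightarrow> h" using r(3) by (simp add: o_def)
  have pr: "(\<lambda>n. p (r n)) \<longlonglongrightarrow> x" using LIMSEQ_subseq_LIMSEQ[OF p(3) r(1)] by (simp add: o_def)
  have ur: "(\<lambda>n. u (r n)) \<longlonglongrightarrow> y" using LIMSEQ_subseq_LIMSEQ[OF u(3) r(1)] by (simp add: o_def)
  have kS: "blinfun_apply (k n) ` \<Sigma> = \<Sigma>" for n
    using transporter[OF p(1,2) k(1)] cell_subset_\<Sigma>[OF u(1,2)] k(2) by blast
  have "h v \<in> \<Sigma>" if v: "v \<in> \<Sigma>" for v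
  proof -
    have "(\<lambda>n. blinfun_apply (k (r n)) v) \<longlonglongrightarrow> h v" by (intro tendsto_intros kl)
    moreover have "k (r n) v \<in> \<Sigma>" for n using kS[of "r n"] v by (metis imageI)
    ultimately show ?thesis using closed_sequentially[OF closed_\<Sigma>, of "\<lambda>n. k (r n) v"] by simp
  qed
  then have hN: "h \<in> stabilizer_\<Sigma>"
    using image_\<Sigma>_eqI[OF r(2)] r(2) by (simp add: stabilizer_\<Sigma>_def)
  have "g x \<bullet> y \<le> h x \<bullet> y"
  proof (rule LIMSEQ_le)
    show "(\<lambda>n. g (p (r n)) \<bullet> u (r n)) \<longlonglongrightarrow> g x \<bullet> y" "(\<lambda>n. k (r n) (p (r n)) \<bullet> u (r n)) \<longlonglongrightarrow> h x \<bullet> y"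
      by (intro tendsto_intros kl pr ur)+
    have "g (p m) \<bullet> u m \<le> k m (p m) \<bullet> u m" for m
    proof -
      obtain k' where k': "k' \<in> K" "\<And>v. k' (k m v) = v" using inverse_K[OF k(1)] by metis
      show ?thesis using k(2)[of m] comp_K[OF g(1) k'(1)] k' unfolding cell_def by force
    qed
    then show "\<exists>N. \<forall>n\<ge>N. g (p (r n)) \<bullet> u (r n) \<le> k (r n) (p (r n)) \<bullet> u (r n)" by blast
  qed
  then have ge: "y \<bullet> y \<le> h x \<bullet> y" by (simp add: y_def)
  have "norm (h x - y) ^ 2 = h x \<bullet> h x - 2 * (h x \<bullet> y) + y \<bullet> y"
    by (simp add: power2_norm_eq_inner inner_diff_left inner_diff_right inner_commute)
  moreover have "h x \<bullet> h x = y \<bullet> y" using inner_K[OF r(2)] inner_K[OF g(1)] by (simp add: y_def)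
  ultimately have "norm (h x - y) ^ 2 \<le> 0" using ge by linarith
  then have "h x = y" by simp
  then show ?thesis using hN y_def by blast
qed

end

section \<open>Orthogonal projections and supporting functionals\<close>

lemma orthogonal_projection_unique_ex:
  fixes S :: "'a::euclidean_space set"
  assumes "subspace S"
  shows "\<exists>!y. y \<in> S \<and> v - y \<in> S\<^sup>\<bottom>"
proof -
  obtain y z where yz: "y \<in> span S" "\<And>w. w \<in> span S \<Longrightarrow> orthogonal z w" "v = y + z"
    using orthogonal_subspace_decomp_exists[of S v] by blast
  have "y \<in> S" "v - y \<in> S\<^sup>\<bottom>"
    using yz span_eq_iff[THEN iffD2, OF assms] by (auto simp: orthogonal_comp_def orthogonal_commute)
  moreover have "y' = y" if y': "y' \<in> S" "v - y' \<in> S\<^sup>\<bottom>" for y'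
  proof -
    have "y' - y \<in> S" using y' \<open>y \<in> S\<close> assms by (simp add: subspace_diff)
    then have "(y' - y) \<bullet> (v - y') = 0" "(y' - y) \<bullet> (v - y) = 0"
      using y'(2) \<open>v - y \<in> S\<^sup>\<bottom>\<close> by (auto simp: orthogonal_comp_def orthogonal_def)
    then have "(y' - y) \<bullet> (y' - y) = 0" by (simp add: inner_diff_right)
    then show ?thesis by simp
  qed
  ultimately show ?thesis by blast
qed

lemma orthogonal_projection_in:
  assumes "subspace S" shows "orthogonal_projection S v \<in> S"
  unfolding orthogonal_projection_def using theI'[OF orthogonal_projection_unique_ex[OF assms, of v]] by blast

lemma inner_orthogonal_projection:
  assumes "subspace S" "u \<in> S" shows "orthogonal_projection S v \<bullet> u = v \<bullet> u"
proof -
  have "v - orthogonal_projection S v \<in> S\<^sup>\<bottom>"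
    unfolding orthogonal_projection_def using theI'[OF orthogonal_projection_unique_ex[OF assms(1), of v]] by blast
  then have "u \<bullet> (v - orthogonal_projection S v) = 0"
    using assms(2) by (auto simp: orthogonal_comp_def orthogonal_def)
  then show ?thesis by (simp add: inner_diff_right inner_commute)
qed

lemma orthogonal_projection_eqI:
  assumes "subspace S" "y \<in> S" "\<And>u. u \<in> S \<Longrightarrow> y \<bullet> u = v \<bullet> u"
  shows "orthogonal_projection S v = y"
proof -
  let ?d = "orthogonal_projection S v - y"
  have "?d \<in> S" using assms orthogonal_projection_in subspace_diff by blast
  then have "?d \<bullet> ?d = 0"
    using assms inner_orthogonal_projection[OF assms(1), of ?d v] by (simp add: inner_diff_left)
  then show ?thesis by simp
qed

lemma orthogonal_projection_id: "\<lbrakk>subspace S; v \<in> S\<rbrakk> \<Longrightarrow> orthogonal_projection S v = v"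
  by (rule orthogonal_projection_eqI) auto

lemma linear_orthogonal_projection:
  assumes "subspace S" shows "linear (orthogonal_projection S)"
proof (rule linearI)
  show "orthogonal_projection S (v + w) = orthogonal_projection S v + orthogonal_projection S w" for v w
    using assms by (intro orthogonal_projection_eqI)
      (auto simp: inner_add_left inner_orthogonal_projection orthogonal_projection_in subspace_add)
  show "orthogonal_projection S (c *\<^sub>R v) = c *\<^sub>R orthogonal_projection S v" for c v
    using assms by (intro orthogonal_projection_eqI)
      (auto simp: inner_orthogonal_projection orthogonal_projection_in subspace_scale)
qed

text \<open>From a relative interior point one can move a little away from \<open>w\<close> without leaving \<open>S\<close>.\<close>

lemma linear_functional_max_at_rel_interior:
  fixes S :: "'a::euclidean_space set"
  assumes "convex S" and x: "x \<in> rel_interior S" and max: "\<And>w. w \<in> S \<Longrightarrow> w \<bullet> u \<le> x \<bullet> u" and w: "w \<in> S"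
  shows "w \<bullet> u = x \<bullet> u"
proof -
  have "w \<in> affine hull S" using w hull_subset[of S affine] by blast
  then obtain m where m: "1 < m" "(1 - m) *\<^sub>R w + m *\<^sub>R x \<in> S"
    using convex_rel_interior_if[OF assms(1) x] by blast
  have "(1 - m) * (w \<bullet> u) + m * (x \<bullet> u) \<le> x \<bullet> u"
    using max[OF m(2)] by (simp add: inner_add_left)
  then have "(m - 1) * (x \<bullet> u) \<le> (m - 1) * (w \<bullet> u)" by (simp add: algebra_simps)
  then have "x \<bullet> u \<le> w \<bullet> u" using m(1) by simp
  then show ?thesis using max[OF w] by simp
qed

section \<open>Descent to slices\<close>

text \<open>The property of \<open>\<Sigma>\<close> on which all results about faces rest, relative to an invariant subspace \<open>T\<close>.
  For a fat section it holds with \<open>T = UNIV\<close>, and it passes to stabilizers and normal spaces.\<close>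

locale slice_section = compact_isometry_group K
  for K :: "('v::euclidean_space \<Rightarrow>\<^sub>L 'v) set" +
  fixes \<Sigma> T :: "'v set"
  assumes subspace_\<Sigma>: "subspace \<Sigma>" and subspace_T: "subspace T"
    and invariant_T: "\<lbrakk>k \<in> K; v \<in> T\<rbrakk> \<Longrightarrow> k v \<in> T"
    and orbit_meets_cell_in_\<Sigma>: "\<lbrakk>y \<in> \<Sigma>; y \<in> T; v \<in> T\<rbrakk> \<Longrightarrow> \<exists>k\<in>K. k v \<in> \<Sigma> \<inter> cell y"
begin

text \<open>Apply the defining property to \<open>y + u\<close>.  The element \<open>k\<close> obtained makes \<open>k (y + u) \<bullet> y\<close> maximal;
  since \<open>u\<close> is in the cell of \<open>y\<close>, the maximum is attained only by elements that fix \<open>y\<close>.\<close>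

lemma rotate_functional_into_\<Sigma>:
  assumes y: "y \<in> \<Sigma>" "y \<in> T" and u: "u \<in> T" "u \<in> cell y"
  shows "\<exists>k\<in>K. k y = y \<and> k u \<in> \<Sigma>"
proof -
  have "y + u \<in> T" using y u subspace_T by (simp add: subspace_add)
  then obtain k where k: "k \<in> K" "k (y + u) \<in> \<Sigma>" "k (y + u) \<in> cell y"
    using orbit_meets_cell_in_\<Sigma>[OF y] by blast
  obtain k' where k': "k' \<in> K" "\<And>v. k' (k v) = v" "\<And>v. k (k' v) = v" using inverse_K[OF k(1)] by metis
  have "(y + u) \<bullet> y \<le> k (y + u) \<bullet> y" using k(3) k' unfolding cell_def by (metis (mono_tags, lifting) mem_Collect_eq)
  moreover have "k u \<bullet> y \<le> u \<bullet> y" using u(2) k(1) by (simp add: cell_def)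
  ultimately have "y \<bullet> y \<le> k y \<bullet> y" by (simp add: blinfun.add_right inner_add_left)
  moreover have "(norm (k y - y))\<^sup>2 = 2 * (y \<bullet> y) - 2 * (k y \<bullet> y)"
    using inner_K[OF k(1), of y y] by (simp add: power2_norm_eq_inner inner_diff_left inner_diff_right inner_commute)
  ultimately have "(norm (k y - y))\<^sup>2 \<le> 0" by linarith
  then have ky: "k y = y" by simp
  then have "k u = k (y + u) - y" by (simp add: blinfun.add_right)
  then have "k u \<in> \<Sigma>" using k(2) y(1) subspace_\<Sigma> by (simp add: subspace_diff)
  then show ?thesis using k(1) ky by blast
qed

text \<open>First-order perturbation: maximizing against \<open>u + e y\<close> for small \<open>e > 0\<close> means, in the limit,
  maximizing against \<open>u\<close> first and against \<open>y\<close> among the maximizers.  For a vector of the cell of \<open>u\<close>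
  moved slightly towards \<open>u\<close>, the first maximization singles out the stabilizer of \<open>u\<close>.\<close>

theorem slice_section_descends:
  assumes u: "u \<in> \<Sigma>" "u \<in> T"
  shows "slice_section {k \<in> K. k u = u} \<Sigma> (T \<inter> normal_cone u)"
proof -
  define H where "H = {k \<in> K. k u = u}"
  interpret H: compact_isometry_group H unfolding H_def by (rule stabilizer_group)
  have "\<exists>k\<in>H. k v \<in> \<Sigma> \<inter> H.cell y" if y: "y \<in> \<Sigma>" "y \<in> T \<inter> normal_cone u" and v: "v \<in> T \<inter> normal_cone u" for y v
  proof -
    obtain m where m: "v + m *\<^sub>R u \<in> cell u" using normal_cone_cell[of v u] v by blast
    \<comment> \<open>The summand \<open>1\<close> moves \<open>v + m u\<close> away from the boundary of the cell, so that only the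
      stabilizer of \<open>u\<close> preserves the scalar product with \<open>u\<close>.\<close>
    define z where "z = v + (m + 1) *\<^sub>R u"
    have z: "z = (v + m *\<^sub>R u) + u" by (simp add: z_def scaleR_add_left)
    have zT: "z \<in> T" unfolding z_def using v u subspace_T by (simp add: subspace_add subspace_scale)
    have self: "g u \<bullet> u \<le> u \<bullet> u" if "g \<in> K" for g
      using norm_cauchy_schwarz[of "g u" u] norm_K[OF that] by (simp add: dot_square_norm power2_eq_square)
    have zle: "g z \<bullet> u \<le> z \<bullet> u" if g: "g \<in> K" for g
      using m g self[OF g] unfolding z cell_def by (simp add: blinfun.add_right inner_add_left add_mono)
    have stab: "g u = u" if g: "g \<in> K" and eq: "z \<bullet> u \<le> g z \<bullet> u" for g
    proof -
      have "g (v + m *\<^sub>R u) \<bullet> u \<le> (v + m *\<^sub>R u) \<bullet> u" using m g unfolding cell_def by blast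
      moreover have "z \<bullet> u = (v + m *\<^sub>R u) \<bullet> u + u \<bullet> u" by (simp add: z inner_add_left)
      moreover have "g z \<bullet> u = g (v + m *\<^sub>R u) \<bullet> u + g u \<bullet> u"
        unfolding z by (subst blinfun.add_right, subst inner_add_left) simp
      ultimately have "u \<bullet> u \<le> g u \<bullet> u" using eq by linarith
      moreover have "(norm (g u - u))\<^sup>2 = 2 * (u \<bullet> u) - 2 * (g u \<bullet> u)"
        using inner_K[OF g, of u u] by (simp add: power2_norm_eq_inner inner_diff_left inner_diff_right inner_commute)
      ultimately have "(norm (g u - u))\<^sup>2 \<le> 0" by linarith
      then show ?thesis by simp
    qed
    define e where "e = (\<lambda>n. inverse (real (Suc n)))"
    have e_pos: "0 < e n" for n by (simp add: e_def)
    have e_lim: "e \<longlonglongrightarrow> 0" unfolding e_def by (rule LIMSEQ_inverse_real_of_nat)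
    have "\<forall>n. \<exists>k. k \<in> K \<and> blinfun_apply k z \<in> \<Sigma> \<inter> cell (u + e n *\<^sub>R y)"
    proof
      fix n
      have "u + e n *\<^sub>R y \<in> \<Sigma>" "u + e n *\<^sub>R y \<in> T"
        using u y subspace_\<Sigma> subspace_T by (auto simp: subspace_add subspace_scale)
      then show "\<exists>k. k \<in> K \<and> blinfun_apply k z \<in> \<Sigma> \<inter> cell (u + e n *\<^sub>R y)"
        using orbit_meets_cell_in_\<Sigma> zT by blast
    qed
    from choice[OF this] obtain k where k: "\<And>n. k n \<in> K" "\<And>n. k n z \<in> \<Sigma>" "\<And>n. k n z \<in> cell (u + e n *\<^sub>R y)"
      by blast
    have k_max: "h z \<bullet> (u + e n *\<^sub>R y) \<le> k n z \<bullet> (u + e n *\<^sub>R y)" if h: "h \<in> K" for h n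
    proof -
      obtain k' where k': "k' \<in> K" "\<And>v. k' (k n v) = v" using inverse_K[OF k(1)] by metis
      have "(h o\<^sub>L k') (k n z) \<bullet> (u + e n *\<^sub>R y) \<le> k n z \<bullet> (u + e n *\<^sub>R y)"
        using k(3)[of n] comp_K[OF h k'(1)] unfolding cell_def by blast
      then show ?thesis by (simp add: k')
    qed
    obtain g r where r: "g \<in> K" "strict_mono r" "(k \<circ> r) \<longlonglongrightarrow> g"
      using seq_compactE[OF compact_imp_seq_compact[OF compact_K], of k] k(1) by auto
    have kl: "(\<lambda>n. k (r n)) \<longlonglongrightarrow> g" using r(3) by (simp add: o_def)
    have el: "(\<lambda>n. e (r n)) \<longlonglongrightarrow> 0" using LIMSEQ_subseq_LIMSEQ[OF e_lim r(2)] by (simp add: o_def)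
    have kz: "(\<lambda>n. k (r n) z) \<longlonglongrightarrow> g z" by (intro tendsto_intros kl)
    have gz: "g z \<in> \<Sigma>"
      using closed_sequentially[OF closed_subspace[OF subspace_\<Sigma>] _ kz] k(2) by simp
    have "z \<bullet> (u + 0 *\<^sub>R y) \<le> g z \<bullet> (u + 0 *\<^sub>R y)"
    proof (rule LIMSEQ_le)
      show "(\<lambda>n. z \<bullet> (u + e (r n) *\<^sub>R y)) \<longlonglongrightarrow> z \<bullet> (u + 0 *\<^sub>R y)"
        "(\<lambda>n. k (r n) z \<bullet> (u + e (r n) *\<^sub>R y)) \<longlonglongrightarrow> g z \<bullet> (u + 0 *\<^sub>R y)"
        by (intro tendsto_intros kz el)+
      show "\<exists>N. \<forall>n\<ge>N. z \<bullet> (u + e (r n) *\<^sub>R y) \<le> k (r n) z \<bullet> (u + e (r n) *\<^sub>R y)"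
        using k_max[OF id_K] by simp
    qed
    then have gu: "g u = u" using stab[OF r(1)] by simp
    have g_v: "g v = g z - (m + 1) *\<^sub>R u"
      unfolding z_def by (simp add: blinfun.add_right blinfun.scaleR_right gu)
    have "g v \<in> \<Sigma>" unfolding g_v using gz u subspace_\<Sigma> by (simp add: subspace_diff subspace_scale)
    moreover have "h (g v) \<bullet> y \<le> g v \<bullet> y" if h: "h \<in> H" for h
    proof -
      define h' where "h' = h o\<^sub>L g"
      have h': "h' \<in> K" "h' u = u" using h r(1) gu comp_K by (auto simp: h'_def H_def)
      have "h' z \<bullet> y \<le> k n z \<bullet> y" for n
      proof -
        have "h' z \<bullet> u = z \<bullet> u" using inner_K[OF h'(1), of z u] h'(2) by simp
        then have "k n z \<bullet> u \<le> h' z \<bullet> u" using zle[OF k(1)] by simp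
        then have "e n * (h' z \<bullet> y) \<le> e n * (k n z \<bullet> y)"
          using k_max[OF h'(1), of n] by (simp add: inner_add_right)
        then show ?thesis using e_pos[of n] by simp
      qed
      then have "h' z \<bullet> y \<le> g z \<bullet> y"
        by (intro LIMSEQ_le_const[OF tendsto_inner[OF kz tendsto_const]]) auto
      moreover have "h' v = h' z - (m + 1) *\<^sub>R u"
        unfolding z_def by (simp add: blinfun.add_right blinfun.scaleR_right h')
      ultimately have "h' v \<bullet> y \<le> g v \<bullet> y" by (simp add: g_v inner_diff_left)
      then show ?thesis by (simp add: h'_def)
    qed
    then have "g v \<in> H.cell y" unfolding H.cell_def by blast
    ultimately show ?thesis using r(1) gu unfolding H_def by blast
  qed
  moreover have "k v \<in> T \<inter> normal_cone u" if "k \<in> H" "v \<in> T \<inter> normal_cone u" for k v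
    using that invariant_T normal_cone_invariant by (auto simp: H_def)
  ultimately have "slice_section H \<Sigma> (T \<inter> normal_cone u)"
    using subspace_\<Sigma> subspace_inter[OF subspace_T subspace_normal_cone] by unfold_locales auto
  then show ?thesis by (simp add: H_def)
qed

end

text \<open>The second assertion says that any point of the lifted face can be moved into \<open>\<Sigma>\<close> by an element of
  the group that preserves this face; it serves to compare faces that are conjugate.  Both are
  proved by induction on the dimension of \<open>E\<close>, replacing \<open>E\<close> by an exposed face and the group by a
  stabilizer; for this reason the group, \<open>T\<close> and \<open>E\<close> vary, while \<open>\<Sigma>\<close>, \<open>Q\<close> and \<open>y\<close> are fixed.\<close>

theorem rel_interior_of_face_lift:
  fixes K :: "('v::euclidean_space \<Rightarrow>\<^sub>L 'v) set"
  defines "\<sigma> \<equiv> orthogonal_projection"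
  assumes "slice_section K \<Sigma> T"
    and "compact E" "convex E" "E \<subseteq> T"
    and "\<And>k v. \<lbrakk>k \<in> K; v \<in> E\<rbrakk> \<Longrightarrow> k v \<in> E"
    and "\<And>v. v \<in> E \<Longrightarrow> \<sigma> \<Sigma> v \<in> E"
    and "Q face_of (E \<inter> \<Sigma>)" and "y \<in> rel_interior Q"
  shows "y \<in> rel_interior {v \<in> E. \<sigma> \<Sigma> v \<in> Q} \<and>
    (\<forall>v\<in>E. \<sigma> \<Sigma> v \<in> Q \<longrightarrow> (\<exists>h\<in>K. blinfun_apply h v \<in> \<Sigma> \<and> blinfun_apply h ` {v \<in> E. \<sigma> \<Sigma> v \<in> Q} = {v \<in> E. \<sigma> \<Sigma> v \<in> Q}))"
  using assms(2-)
proof (induction "nat (aff_dim E + 1)" arbitrary: K T E rule: less_induct)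
  case less
  interpret slice_section K \<Sigma> T by (rule less.prems(1))
  note E = less.prems(2-4) and inv = less.prems(5) and proj = less.prems(6)
    and Q = less.prems(7) and y = less.prems(8)
  define P where "P = E \<inter> \<Sigma>"
  have convP: "convex P" unfolding P_def using E(2) subspace_\<Sigma> by (simp add: convex_Int subspace_imp_convex)
  have convQ: "convex Q" using Q face_of_imp_convex by blast
  have yQ: "y \<in> Q" using y rel_interior_subset by blast
  have QP: "Q \<subseteq> P" using Q face_of_imp_subset by (auto simp: P_def)
  have yP: "y \<in> P" using yQ QP by blast
  have \<sigma>P: "\<sigma> \<Sigma> v \<in> P" if "v \<in> E" for v
    using proj[OF that] orthogonal_projection_in[OF subspace_\<Sigma>] by (simp add: P_def \<sigma>_def)
  have \<sigma>u: "\<sigma> \<Sigma> v \<bullet> u = v \<bullet> u" if "u \<in> \<Sigma>" for u v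
    using inner_orthogonal_projection[OF subspace_\<Sigma> that] by (simp add: \<sigma>_def)
  show ?case
  proof (cases "Q = P")
    case True
    have FE: "{v \<in> E. \<sigma> \<Sigma> v \<in> Q} = E" using \<sigma>P True by auto
    have "y \<in> rel_interior E"
    proof (rule ccontr)
      assume no: "y \<notin> rel_interior E"
      have "y \<in> E" using yP by (simp add: P_def)
      then obtain a where a: "\<And>w. w \<in> E \<Longrightarrow> a \<bullet> y \<le> a \<bullet> w" "\<And>w. w \<in> rel_interior E \<Longrightarrow> a \<bullet> y < a \<bullet> w"
        using supporting_hyperplane_rel_boundary[OF E(2) _ no] by metis
      \<comment> \<open>Projecting to \<open>T\<close> does not change the functional on \<open>E\<close>; the sign turns minima into maxima.\<close>
      define u where "u = \<sigma> T (- a)"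
      have uT: "u \<in> T" by (simp add: u_def \<sigma>_def orthogonal_projection_in subspace_T)
      have wu: "w \<bullet> u = - (a \<bullet> w)" if "w \<in> E" for w
        using inner_orthogonal_projection[OF subspace_T, of w "- a"] that E(3)
        by (auto simp: u_def \<sigma>_def inner_commute)
      have max: "w \<bullet> u \<le> y \<bullet> u" if "w \<in> E" for w
        using wu[OF that] wu[OF \<open>y \<in> E\<close>] a(1)[OF that] by simp
      have "y \<in> cell u" using max inv \<open>y \<in> E\<close> by (simp add: cell_def)
      then have "u \<in> cell y" using cell_sym by blast
      moreover have "y \<in> \<Sigma>" "y \<in> T" using yP E(3) by (auto simp: P_def)
      ultimately obtain k where k: "k \<in> K" "k y = y" "k u \<in> \<Sigma>"
        using rotate_functional_into_\<Sigma>[OF _ _ uT] by blast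
      obtain k' where k': "k' \<in> K" "\<And>v. k' (k v) = v" "\<And>v. k (k' v) = v" using inverse_K[OF k(1)] by metis
      have ku: "k w \<bullet> k u = w \<bullet> u" for w using inner_K[OF k(1)] by blast
      have max': "w \<bullet> k u \<le> y \<bullet> k u" if "w \<in> E" for w
        using max[OF inv[OF k'(1) that]] ku[of "k' w"] ku[of y] k(2) k'(3) by simp
      have const: "w \<bullet> k u = y \<bullet> k u" if "w \<in> P" for w
        using linear_functional_max_at_rel_interior[OF convP, of y "k u" w] y True that max'
        by (simp add: P_def)
      have "w \<bullet> u = y \<bullet> u" if "w \<in> E" for w
        using const[OF \<sigma>P[OF inv[OF k(1) that]]] \<sigma>u[OF k(3)] ku[of w] ku[of y] k(2) by simp
      moreover obtain w where "w \<in> rel_interior E"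
        using rel_interior_eq_empty[OF E(2)] \<open>y \<in> E\<close> by blast
      ultimately show False
        using a(2)[of w] wu[of w] wu[OF \<open>y \<in> E\<close>] rel_interior_subset[of E] by fastforce
    qed
    moreover have "\<exists>h\<in>K. blinfun_apply h v \<in> \<Sigma> \<and> blinfun_apply h ` E = E" if v: "v \<in> E" for v
    proof -
      obtain h where h: "h \<in> K" "h v \<in> \<Sigma>"
        using orbit_meets_cell_in_\<Sigma>[of 0 v] subspace_0[OF subspace_\<Sigma>] subspace_0[OF subspace_T] v E(3) by blast
      obtain h' where h': "h' \<in> K" "\<And>v. h' (h v) = v" "\<And>v. h (h' v) = v" using inverse_K[OF h(1)] by metis
      have "w \<in> blinfun_apply h ` E" if "w \<in> E" for w
        using inv[OF h'(1) that] h'(3)[of w] by (metis imageI)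
      then have "blinfun_apply h ` E = E" using inv[OF h(1)] by blast
      then show ?thesis using h by blast
    qed
    ultimately show ?thesis unfolding FE by blast
  next
    case False
    have "y \<notin> rel_interior P"
      using face_of_disjoint_rel_interior[OF Q[folded P_def] False] yQ by blast
    then obtain a where a: "\<And>w. w \<in> P \<Longrightarrow> a \<bullet> y \<le> a \<bullet> w" "\<And>w. w \<in> rel_interior P \<Longrightarrow> a \<bullet> y < a \<bullet> w"
      using supporting_hyperplane_rel_boundary[OF convP yP] by metis
    have sub: "subspace (\<Sigma> \<inter> T)" using subspace_\<Sigma> subspace_T by (rule subspace_inter)
    \<comment> \<open>The projection preserves the functional on \<open>P\<close>, and the new \<open>u\<close> is admissible for the descent
      to its stabilizer.\<close>
    define u where "u = \<sigma> (\<Sigma> \<inter> T) (- a)"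
    have u: "u \<in> \<Sigma>" "u \<in> T" using orthogonal_projection_in[OF sub, of "- a"] by (auto simp: u_def \<sigma>_def)
    have wu: "w \<bullet> u = - (a \<bullet> w)" if "w \<in> P" for w
      using inner_orthogonal_projection[OF sub, of w "- a"] that E(3)
      by (auto simp: u_def \<sigma>_def inner_commute P_def)
    have max: "v \<bullet> u \<le> y \<bullet> u" if "v \<in> E" for v
      using wu[OF \<sigma>P[OF that]] wu[OF yP] a(1)[OF \<sigma>P[OF that]] \<sigma>u[OF u(1), of v] by simp
    define E1 where "E1 = E \<inter> {v. u \<bullet> v = y \<bullet> u}"
    have E1: "v \<in> E1 \<longleftrightarrow> v \<in> E \<and> v \<bullet> u = y \<bullet> u" for v by (auto simp: E1_def inner_commute)
    have "E1 face_of E" unfolding E1_def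
      using max by (intro face_of_Int_supporting_hyperplane_le E) (simp add: inner_commute)
    moreover have "E1 \<noteq> E"
    proof -
      obtain w where w: "w \<in> rel_interior P" using rel_interior_eq_empty[OF convP] yP by blast
      then have wP: "w \<in> P" using rel_interior_subset by blast
      have "w \<bullet> u < y \<bullet> u" using a(2)[OF w] wu[OF wP] wu[OF yP] by simp
      then show ?thesis using E1[of w] wP by (auto simp: P_def)
    qed
    ultimately have "aff_dim E1 < aff_dim E" using face_of_aff_dim_lt E(2) by blast
    then have dimE1: "nat (aff_dim E1 + 1) < nat (aff_dim E + 1)"
      using aff_dim_geq[of E1] by linarith
    have QE1: "Q \<subseteq> E1"
    proof
      fix w assume w: "w \<in> Q"
      have "w \<bullet> u = y \<bullet> u"
        by (rule linear_functional_max_at_rel_interior[OF convQ y _ w]) (use max QP in \<open>auto simp: P_def\<close>)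
      then show "w \<in> E1" using w QP by (auto simp: E1 P_def)
    qed
    have lift: "{v \<in> E1. \<sigma> \<Sigma> v \<in> Q} = {v \<in> E. \<sigma> \<Sigma> v \<in> Q}"
      using QE1 \<sigma>u[OF u(1)] by (auto simp: E1)
    have 1: "E1 \<subseteq> T \<inter> normal_cone u"
    proof
      fix v assume v: "v \<in> E1"
      then have "v \<in> cell u" using max[OF inv] by (simp add: E1 cell_def)
      then show "v \<in> T \<inter> normal_cone u" using v E(3) cell_subset_normal_cone by (auto simp: E1)
    qed
    have 2: "k v \<in> E1" if k: "k \<in> {k \<in> K. k u = u}" and v: "v \<in> E1" for k v
    proof -
      have kK: "k \<in> K" "k u = u" using k by auto
      then have "k v \<bullet> u = v \<bullet> u" using inner_K[OF kK(1), of v u] by simp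
      then show ?thesis using v inv[OF kK(1)] by (simp add: E1)
    qed
    have 3: "\<sigma> \<Sigma> v \<in> E1" if "v \<in> E1" for v
      using that proj[of v] \<sigma>u[OF u(1)] by (simp add: E1)
    have 4: "Q face_of (E1 \<inter> \<Sigma>)"
      by (rule face_of_subset[OF Q]) (use QE1 QP in \<open>auto simp: P_def E1\<close>)
    have 5: "compact E1" "convex E1"
      using \<open>E1 face_of E\<close> E face_of_imp_compact face_of_imp_convex by blast+
    have IH: "y \<in> rel_interior {v \<in> E1. \<sigma> \<Sigma> v \<in> Q} \<and>
      (\<forall>v\<in>E1. \<sigma> \<Sigma> v \<in> Q \<longrightarrow> (\<exists>h\<in>{k \<in> K. blinfun_apply k u = u}. blinfun_apply h v \<in> \<Sigma> \<and>
         blinfun_apply h ` {v \<in> E1. \<sigma> \<Sigma> v \<in> Q} = {v \<in> E1. \<sigma> \<Sigma> v \<in> Q}))"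
      using less.hyps[OF dimE1 slice_section_descends[OF u] 5 1 2 3 4 y] .
    show ?thesis
    proof (intro conjI ballI impI)
      show "y \<in> rel_interior {v \<in> E. \<sigma> \<Sigma> v \<in> Q}" using IH lift by simp
      fix v assume v: "v \<in> E" "\<sigma> \<Sigma> v \<in> Q"
      then have "v \<in> {v \<in> E1. \<sigma> \<Sigma> v \<in> Q}" unfolding lift by blast
      then obtain h where "h \<in> {k \<in> K. blinfun_apply k u = u}" "blinfun_apply h v \<in> \<Sigma>"
          "blinfun_apply h ` {v \<in> E1. \<sigma> \<Sigma> v \<in> Q} = {v \<in> E1. \<sigma> \<Sigma> v \<in> Q}"
        using IH by blast
      then show "\<exists>h\<in>K. blinfun_apply h v \<in> \<Sigma> \<and> blinfun_apply h ` {v \<in> E. \<sigma> \<Sigma> v \<in> Q} = {v \<in> E. \<sigma> \<Sigma> v \<in> Q}"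
        unfolding lift by blast
    qed
  qed
qed

section \<open>Faces of an invariant convex body\<close>

locale invariant_convex_body = fat_section_of_isometries K \<Sigma>
  for K :: "('v::euclidean_space \<Rightarrow>\<^sub>L 'v) set" and \<Sigma> +
  fixes E :: "'v set"
  assumes compact_E: "compact E" and convex_E: "convex E" and E_nonempty: "E \<noteq> {}"
    and invariant_E: "\<lbrakk>k \<in> K; v \<in> E\<rbrakk> \<Longrightarrow> k v \<in> E"
begin

sublocale slice_section K \<Sigma> UNIV
  using subspace_\<Sigma> orbit_meets_\<Sigma>_in_cell by unfold_locales auto

abbreviation \<sigma> :: "'v \<Rightarrow> 'v" where "\<sigma> \<equiv> orthogonal_projection \<Sigma>"

definition P :: "'v set" where "P = E \<inter> \<Sigma>"

definition lift :: "'v set \<Rightarrow> 'v set" where "lift Q = {v \<in> E. \<sigma> v \<in> Q}"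

lemmas \<sigma>_in = orthogonal_projection_in[OF subspace_\<Sigma>]
  and \<sigma>_inner = inner_orthogonal_projection[OF subspace_\<Sigma>]
  and \<sigma>_id = orthogonal_projection_id[OF subspace_\<Sigma>]
  and linear_\<sigma> = linear_orthogonal_projection[OF subspace_\<Sigma>]

lemma convex_P: "convex P"
  unfolding P_def using convex_E subspace_\<Sigma> by (simp add: convex_Int subspace_imp_convex)

text \<open>A functional \<open>u\<close> separating \<open>\<sigma> v\<close> from \<open>P\<close> may be taken in \<open>\<Sigma>\<close>.  It is at least as large at some
  point of \<open>\<Sigma>\<close> on the orbit of \<open>v\<close> as it is at \<open>v\<close>, that is, at \<open>\<sigma> v\<close>; but that point belongs to \<open>P\<close>.\<close>

theorem projection_in_P:
  assumes v: "v \<in> E" shows "\<sigma> v \<in> P"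
proof (rule ccontr)
  assume "\<sigma> v \<notin> P"
  moreover have "closed P"
    unfolding P_def using compact_E closed_\<Sigma> by (simp add: closed_Int compact_imp_closed)
  ultimately obtain a b where ab: "a \<bullet> \<sigma> v < b" "\<And>w. w \<in> P \<Longrightarrow> b < a \<bullet> w"
    using separating_hyperplane_closed_point[OF convex_P] by metis
  define u where "u = \<sigma> (- a)"
  have u: "u \<in> \<Sigma>" unfolding u_def by (rule \<sigma>_in)
  have wu: "w \<bullet> u = - (a \<bullet> w)" if "w \<in> \<Sigma>" for w
    using \<sigma>_inner[OF that, of "- a"] by (simp add: u_def inner_commute)
  obtain k where k: "k \<in> K" "k v \<in> \<Sigma>" "k v \<in> cell u"
    using orbit_meets_\<Sigma>_in_cell[OF u] by blast
  obtain k' where k': "k' \<in> K" "\<And>v. k' (k v) = v" using inverse_K[OF k(1)] by metis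
  have "v \<bullet> u \<le> k v \<bullet> u" using k(3) k' unfolding cell_def by force
  moreover have "b < a \<bullet> k v" using ab(2) k invariant_E[OF k(1) v] by (simp add: P_def)
  ultimately show False
    using ab(1) wu[OF k(2)] wu[OF \<sigma>_in, of v] \<sigma>_inner[OF u, of v] by simp
qed

lemma lift_inter_\<Sigma>: "Q \<subseteq> P \<Longrightarrow> lift Q \<inter> \<Sigma> = Q"
  using \<sigma>_id by (auto simp: lift_def P_def)

lemma lift_face_of:
  assumes "Q face_of P" shows "lift Q face_of E"
proof -
  have Q: "Q \<subseteq> P" "convex Q"
    "\<And>a b x. \<lbrakk>a \<in> P; b \<in> P; x \<in> Q; x \<in> open_segment a b\<rbrakk> \<Longrightarrow> a \<in> Q \<and> b \<in> Q"
    using assms unfolding face_of_def by blast+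
  have "lift Q = E \<inter> \<sigma> -` Q" by (auto simp: lift_def)
  then have conv: "convex (lift Q)"
    using convex_E convex_linear_vimage[OF linear_\<sigma> Q(2)] by (simp add: convex_Int)
  have segment: "a \<in> lift Q \<and> b \<in> lift Q" if ab: "a \<in> E" "b \<in> E" "x \<in> lift Q" "x \<in> open_segment a b" for a b x
  proof -
    obtain t where t: "0 < t" "t < 1" "x = (1 - t) *\<^sub>R a + t *\<^sub>R b"
      using ab(4) by (auto simp: in_segment)
    have \<sigma>x: "\<sigma> x = (1 - t) *\<^sub>R \<sigma> a + t *\<^sub>R \<sigma> b"
      unfolding t(3) by (simp add: linear_add[OF linear_\<sigma>] linear_scale[OF linear_\<sigma>])
    have "\<sigma> a \<in> Q \<and> \<sigma> b \<in> Q"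
    proof (cases "\<sigma> a = \<sigma> b")
      case True
      then have "\<sigma> x = \<sigma> a" using \<sigma>x by (simp flip: scaleR_add_left)
      then show ?thesis using True ab(3) by (simp add: lift_def)
    next
      case False
      then have "\<sigma> x \<in> open_segment (\<sigma> a) (\<sigma> b)" using t \<sigma>x by (auto simp: in_segment)
      then show ?thesis using Q(3)[of "\<sigma> a" "\<sigma> b" "\<sigma> x"] projection_in_P ab by (simp add: lift_def)
    qed
    then show ?thesis using ab by (simp add: lift_def)
  qed
  show ?thesis
    unfolding face_of_def
  proof (intro conjI ballI impI)
    show "lift Q \<subseteq> E" by (auto simp: lift_def)
  qed (use conv segment in blast)+
qed

lemma lift_rel_interior:
  assumes "Q face_of P" "y \<in> rel_interior Q"
  shows "y \<in> rel_interior (lift Q)"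
    and "\<And>v. v \<in> lift Q \<Longrightarrow> \<exists>h\<in>K. blinfun_apply h v \<in> \<Sigma> \<and> blinfun_apply h ` lift Q = lift Q"
proof -
  have "slice_section K \<Sigma> UNIV" by unfold_locales
  note * = rel_interior_of_face_lift[OF this compact_E convex_E _ invariant_E _ assms(1)[unfolded P_def] assms(2)]
  show "y \<in> rel_interior (lift Q)"
    using * projection_in_P by (simp add: lift_def P_def)
  show "\<exists>h\<in>K. blinfun_apply h v \<in> \<Sigma> \<and> blinfun_apply h ` lift Q = lift Q" if "v \<in> lift Q" for v
    using * projection_in_P that by (simp add: lift_def P_def)
qed

lemma inj_K: "k \<in> K \<Longrightarrow> inj (blinfun_apply k)"
  using inverse_K by (metis injI)

lemma image_K_E: assumes "k \<in> K" shows "blinfun_apply k ` E = E"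
proof -
  obtain h where h: "h \<in> K" "\<And>v. k (h v) = v" using inverse_K[OF assms] by metis
  have "w \<in> blinfun_apply k ` E" if "w \<in> E" for w
    using invariant_E[OF h(1) that] h(2)[of w] by (metis imageI)
  then show ?thesis using invariant_E[OF assms] by blast
qed

lemma rel_interior_image_K:
  "k \<in> K \<Longrightarrow> rel_interior (blinfun_apply k ` S) = blinfun_apply k ` rel_interior S"
  by (rule rel_interior_injective_linear_image[OF blinfun.bounded_linear_right inj_K])

lemma face_image_K: "\<lbrakk>k \<in> K; S face_of E\<rbrakk> \<Longrightarrow> blinfun_apply k ` S face_of E"
  using face_of_linear_image[OF linear_blinfun inj_K, of k S E] image_K_E by metis

lemma stabilizer_\<Sigma>_image_P:
  assumes "n \<in> stabilizer_\<Sigma>" shows "blinfun_apply n ` P = P"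
proof -
  have n: "n \<in> K" "blinfun_apply n ` \<Sigma> = \<Sigma>" using assms by (auto simp: stabilizer_\<Sigma>_def)
  show ?thesis unfolding P_def image_Int[OF inj_K[OF n(1)]] image_K_E[OF n(1)] n(2) ..
qed

lemma \<sigma>_equivariant:
  assumes "n \<in> stabilizer_\<Sigma>" shows "\<sigma> (n v) = n (\<sigma> v)"
proof (rule orthogonal_projection_eqI[OF subspace_\<Sigma>])
  have n: "n \<in> K" "blinfun_apply n ` \<Sigma> = \<Sigma>" using assms by (auto simp: stabilizer_\<Sigma>_def)
  show "n (\<sigma> v) \<in> \<Sigma>" using n(2) \<sigma>_in[of v] by blast
  fix u assume "u \<in> \<Sigma>"
  then obtain w where "w \<in> \<Sigma>" "u = n w" using n(2) by blast
  then show "n (\<sigma> v) \<bullet> u = n v \<bullet> u" using inner_K[OF n(1)] \<sigma>_inner by simp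
qed

lemma lift_image:
  assumes n: "n \<in> stabilizer_\<Sigma>" shows "lift (blinfun_apply n ` Q) = blinfun_apply n ` lift Q"
proof
  have nK: "n \<in> K" using n by (simp add: stabilizer_\<Sigma>_def)
  show "blinfun_apply n ` lift Q \<subseteq> lift (blinfun_apply n ` Q)"
    using invariant_E[OF nK] \<sigma>_equivariant[OF n] by (auto simp: lift_def)
  show "lift (blinfun_apply n ` Q) \<subseteq> blinfun_apply n ` lift Q"
  proof
    fix v assume v: "v \<in> lift (blinfun_apply n ` Q)"
    then obtain q where q: "v \<in> E" "q \<in> Q" "\<sigma> v = n q" by (auto simp: lift_def)
    obtain w where w: "w \<in> E" "v = n w" using q(1) image_K_E[OF nK] by blast
    have "\<sigma> w = q" using q(3) w(2) \<sigma>_equivariant[OF n] inj_K[OF nK] by (metis injD)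
    then show "v \<in> blinfun_apply n ` lift Q" using w q by (auto simp: lift_def)
  qed
qed

lemma face_image_stabilizer_\<Sigma>:
  "\<lbrakk>n \<in> stabilizer_\<Sigma>; Q face_of P\<rbrakk> \<Longrightarrow> blinfun_apply n ` Q face_of P"
  using face_of_linear_image[OF linear_blinfun inj_K, of n Q P] stabilizer_\<Sigma>_image_P
  by (metis (mono_tags, lifting) mem_Collect_eq stabilizer_\<Sigma>_def)

text \<open>Move a relative interior point of the face into \<open>\<Sigma>\<close> and let \<open>Q\<close> be the part in \<open>\<Sigma>\<close> of the moved
  face.  The moved point is in the relative interior of the moved face and of \<open>lift Q\<close>, so these two
  faces agree.\<close>

theorem face_is_translate_of_lift:
  assumes S: "S face_of E"
  shows "\<exists>k\<in>K. \<exists>Q. Q face_of P \<and> blinfun_apply k ` S = lift Q"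
proof (cases "S = {}")
  case True
  then show ?thesis
    using id_K by (intro bexI[of _ id_blinfun] exI[of _ "{}"]) (auto simp: lift_def)
next
  case False
  have convS: "convex S" using S face_of_imp_convex by blast
  obtain y where y: "y \<in> rel_interior S" using rel_interior_eq_empty[OF convS] False by blast
  obtain k where k: "k \<in> K" "k y \<in> \<Sigma>" using orbit_meets_\<Sigma> by blast
  define S' where "S' = blinfun_apply k ` S"
  have S': "S' face_of E" unfolding S'_def using face_image_K[OF k(1) S] .
  have convS': "convex S'" using S' face_of_imp_convex by blast
  have y': "k y \<in> rel_interior S'" unfolding S'_def rel_interior_image_K[OF k(1)] using y by blast
  define Q where "Q = S' \<inter> \<Sigma>"
  have Q: "Q face_of P"
    unfolding Q_def P_def using face_of_slice[OF S'] subspace_\<Sigma> subspace_imp_convex by blast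
  have "rel_interior Q = rel_interior S' \<inter> \<Sigma>"
    unfolding Q_def
    using convex_affine_rel_interior_Int[OF convS' subspace_imp_affine[OF subspace_\<Sigma>]] y' k(2) by blast
  then have "k y \<in> rel_interior (lift Q)" using lift_rel_interior(1)[OF Q] y' k(2) by blast
  then have "S' = lift Q" using face_of_eq[OF S' lift_face_of[OF Q]] y' by blast
  then show ?thesis using k(1) Q S'_def by blast
qed

text \<open>Take \<open>y\<close> in the relative interior of \<open>Q\<close>.  Its image in \<open>lift Q'\<close> can be moved back into \<open>\<Sigma>\<close>
  within \<open>lift Q'\<close>, and by \<open>transport_within_\<Sigma>\<close> the resulting point is \<open>n y\<close> with \<open>n\<close> in the
  stabilizer of \<open>\<Sigma>\<close>.  It is a relative interior point of both \<open>lift (n Q)\<close> and \<open>lift Q'\<close>.\<close>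

theorem conjugate_lifts:
  assumes Q: "Q face_of P" and Q': "Q' face_of P" and k: "k \<in> K" "blinfun_apply k ` lift Q = lift Q'"
  shows "\<exists>n\<in>stabilizer_\<Sigma>. blinfun_apply n ` Q = Q'"
proof (cases "Q = {}")
  case True
  then have "lift Q' = {}" using k(2) by (simp add: lift_def)
  then have "Q' = {}" using lift_inter_\<Sigma>[OF face_of_imp_subset[OF Q']] by blast
  moreover have "id_blinfun \<in> stabilizer_\<Sigma>" by (simp add: stabilizer_\<Sigma>_def id_K)
  ultimately show ?thesis using True by blast
next
  case False
  have convQ: "convex Q" using Q face_of_imp_convex by blast
  obtain y where y: "y \<in> rel_interior Q" using rel_interior_eq_empty[OF convQ] False by blast
  have y_lift: "y \<in> rel_interior (lift Q)" using lift_rel_interior(1)[OF Q y] .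
  then have ky: "k y \<in> rel_interior (lift Q')"
    using rel_interior_image_K[OF k(1), of "lift Q"] k(2) by (metis imageI)
  then have ky': "k y \<in> lift Q'" using rel_interior_subset by blast
  then have "\<sigma> (k y) \<in> Q'" by (simp add: lift_def)
  moreover have convQ': "convex Q'" using Q' face_of_imp_convex by blast
  ultimately obtain y' where y': "y' \<in> rel_interior Q'" using rel_interior_eq_empty[OF convQ'] by blast
  obtain h where h: "h \<in> K" "h (k y) \<in> \<Sigma>" "blinfun_apply h ` lift Q' = lift Q'"
    using lift_rel_interior(2)[OF Q' y' ky'] by blast
  have hky: "h (k y) \<in> rel_interior (lift Q')"
    using rel_interior_image_K[OF h(1), of "lift Q'"] h(3) ky by (metis imageI)
  have "y \<in> \<Sigma>" using y rel_interior_subset[of Q] face_of_imp_subset[OF Q] by (auto simp: P_def)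
  then obtain n where n: "n \<in> stabilizer_\<Sigma>" "n y = h (k y)"
    using transport_within_\<Sigma>[of y "h o\<^sub>L k"] comp_K[OF h(1) k(1)] h(2) by auto
  have nK: "n \<in> K" using n by (simp add: stabilizer_\<Sigma>_def)
  have nQ: "blinfun_apply n ` Q face_of P" using face_image_stabilizer_\<Sigma>[OF n(1) Q] .
  have "n y \<in> rel_interior (lift (blinfun_apply n ` Q))"
    unfolding lift_image[OF n(1)] rel_interior_image_K[OF nK] using y_lift by blast
  then have "lift (blinfun_apply n ` Q) = lift Q'"
    using face_of_eq[OF lift_face_of[OF nQ] lift_face_of[OF Q']] hky n(2) by auto
  then have "blinfun_apply n ` Q = Q'"
    using lift_inter_\<Sigma>[OF face_of_imp_subset[OF nQ]] lift_inter_\<Sigma>[OF face_of_imp_subset[OF Q']] by metis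
  then show ?thesis using n(1) by blast
qed

lemma exposed_in_image_K:
  assumes "k \<in> K" "exposed_in UNIV E S"
  shows "exposed_in UNIV E (blinfun_apply k ` S)"
proof -
  obtain u where u: "u \<noteq> 0" "S = {x \<in> E. \<forall>y\<in>E. y \<bullet> u \<le> x \<bullet> u}"
    using assms(2) by (auto simp: exposed_in_def)
  have "k u \<noteq> 0" using norm_K[OF assms(1), of u] u(1) by force
  moreover have "blinfun_apply k ` S = {x \<in> blinfun_apply k ` E. \<forall>y\<in>blinfun_apply k ` E. y \<bullet> k u \<le> x \<bullet> k u}"
    unfolding u(2) using inner_K[OF assms(1)] by auto
  ultimately show ?thesis unfolding exposed_in_def image_K_E[OF assms(1)] by blast
qed

text \<open>A functional that exposes \<open>lift Q\<close> and its projection to \<open>\<Sigma>\<close> agree on \<open>P\<close>, so the projection exposes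
  \<open>Q\<close> unless it vanishes.  If it vanishes, then \<open>Q = P\<close> and \<open>E\<close> lies in a hyperplane; a rotation
  makes the normal vector of this hyperplane an element of \<open>\<Sigma>\<close>.\<close>

lemma exposed_in_lift_iff:
  assumes Q: "Q face_of P"
  shows "exposed_in UNIV E (lift Q) \<longleftrightarrow> exposed_in \<Sigma> P Q"
proof
  have QP: "Q \<subseteq> P" using Q face_of_imp_subset by blast
  have PE: "P \<subseteq> E" by (auto simp: P_def)
  {
    assume "exposed_in \<Sigma> P Q"
    then obtain u where u: "u \<in> \<Sigma>" "u \<noteq> 0" "Q = {x \<in> P. \<forall>y\<in>P. y \<bullet> u \<le> x \<bullet> u}"
      by (auto simp: exposed_in_def)
    have "(\<forall>y\<in>P. y \<bullet> u \<le> \<sigma> v \<bullet> u) \<longleftrightarrow> (\<forall>y\<in>E. y \<bullet> u \<le> v \<bullet> u)" for v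
      using projection_in_P PE \<sigma>_inner[OF u(1)] by (metis subsetD)
    then have "lift Q = {x \<in> E. \<forall>y\<in>E. y \<bullet> u \<le> x \<bullet> u}"
      unfolding u(3) lift_def using projection_in_P by auto
    then show "exposed_in UNIV E (lift Q)" using u(2) unfolding exposed_in_def by blast
  }
  assume "exposed_in UNIV E (lift Q)"
  then obtain u where u: "u \<noteq> 0" "lift Q = {x \<in> E. \<forall>y\<in>E. y \<bullet> u \<le> x \<bullet> u}"
    by (auto simp: exposed_in_def)
  have "continuous_on E (\<lambda>y. y \<bullet> u)" by (intro continuous_intros)
  then obtain v where "v \<in> E" "\<forall>y\<in>E. y \<bullet> u \<le> v \<bullet> u"
    using continuous_attains_sup[OF compact_E E_nonempty] by blast
  then have "\<sigma> v \<in> Q" using u(2) by (auto simp: lift_def)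
  then obtain q where qQ: "q \<in> Q" by blast
  then have "q \<in> lift Q" "q \<in> P" using lift_inter_\<Sigma>[OF QP] QP by blast+
  then have q: "q \<in> P" "q \<in> \<Sigma>" "\<And>y. y \<in> E \<Longrightarrow> y \<bullet> u \<le> q \<bullet> u" using u(2) by (auto simp: P_def)
  have \<sigma>u: "w \<bullet> \<sigma> u = w \<bullet> u" if "w \<in> \<Sigma>" for w
    using \<sigma>_inner[OF that, of u] by (simp add: inner_commute)
  have Q_eq: "Q = {x \<in> P. \<forall>y\<in>P. y \<bullet> \<sigma> u \<le> x \<bullet> \<sigma> u}"
  proof
    show "Q \<subseteq> {x \<in> P. \<forall>y\<in>P. y \<bullet> \<sigma> u \<le> x \<bullet> \<sigma> u}"
    proof
      fix x assume "x \<in> Q"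
      then have x: "x \<in> P" "x \<in> lift Q" using QP lift_inter_\<Sigma>[OF QP] by auto
      then show "x \<in> {x \<in> P. \<forall>y\<in>P. y \<bullet> \<sigma> u \<le> x \<bullet> \<sigma> u}"
        using u(2) \<sigma>u by (auto simp: P_def)
    qed
    show "{x \<in> P. \<forall>y\<in>P. y \<bullet> \<sigma> u \<le> x \<bullet> \<sigma> u} \<subseteq> Q"
    proof
      fix x assume "x \<in> {x \<in> P. \<forall>y\<in>P. y \<bullet> \<sigma> u \<le> x \<bullet> \<sigma> u}"
      then have x: "x \<in> P" "q \<bullet> u \<le> x \<bullet> u" using q(1,2) \<sigma>u by (auto simp: P_def)
      then have "x \<in> lift Q" using q(3) PE unfolding u(2) by (auto intro: order_trans)
      then show "x \<in> Q" using x(1) lift_inter_\<Sigma>[OF QP] by (auto simp: P_def)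
    qed
  qed
  show "exposed_in \<Sigma> P Q"
  proof (cases "\<sigma> u = 0")
    case False
    then show ?thesis unfolding exposed_in_def using Q_eq \<sigma>_in by blast
  next
    case True
    then have "Q = P" using Q_eq by simp
    then have E_lift: "E = lift Q" using projection_in_P by (auto simp: lift_def)
    have const: "x \<bullet> u = q \<bullet> u" if x: "x \<in> E" for x
    proof (rule antisym)
      have "x \<in> {x \<in> E. \<forall>y\<in>E. y \<bullet> u \<le> x \<bullet> u}" using x E_lift u(2) by blast
      then show "q \<bullet> u \<le> x \<bullet> u" using q(1) PE by blast
      show "x \<bullet> u \<le> q \<bullet> u" by (rule q(3)[OF x])
    qed
    obtain k where k: "k \<in> K" "k u \<in> \<Sigma>" using orbit_meets_\<Sigma> by blast
    have const': "x \<bullet> k u = q \<bullet> u" if "x \<in> E" for x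
    proof -
      have "x \<in> blinfun_apply k ` E" unfolding image_K_E[OF k(1)] by (rule that)
      then obtain w where w: "w \<in> E" "x = k w" by blast
      show ?thesis unfolding w(2) inner_K[OF k(1)] by (rule const[OF w(1)])
    qed
    have "y \<bullet> k u \<le> x \<bullet> k u" if "x \<in> P" "y \<in> P" for x y
    proof -
      have "x \<in> E" "y \<in> E" using that PE by blast+
      then show ?thesis by (simp only: const')
    qed
    then have "Q = {x \<in> P. \<forall>y\<in>P. y \<bullet> k u \<le> x \<bullet> k u}" using \<open>Q = P\<close> by blast
    moreover have "k u \<noteq> 0" using norm_K[OF k(1), of u] u(1) by force
    ultimately show ?thesis unfolding exposed_in_def using k(2) by blast
  qed
qed

theorem exposed_in_translate_iff:
  assumes Q: "Q face_of P" and k: "k \<in> K"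
  shows "exposed_in UNIV E (blinfun_apply k ` lift Q) \<longleftrightarrow> exposed_in \<Sigma> P Q"
proof -
  obtain h where h: "h \<in> K" "\<And>v. h (k v) = v" using inverse_K[OF k] by metis
  have "blinfun_apply h ` blinfun_apply k ` lift Q = lift Q" by (simp add: image_image h)
  then show ?thesis
    using exposed_in_lift_iff[OF Q] exposed_in_image_K[OF k] exposed_in_image_K[OF h(1)] by metis
qed

end

context fat_section_of_isometries
begin

text \<open>A functional in \<open>\<Sigma>\<close> attains its maximum over the orbit of \<open>x\<close> at a point of \<open>\<Sigma>\<close>, and the orbit meets
  \<open>\<Sigma>\<close> only in the orbit of \<open>x\<close> under the stabilizer of \<open>\<Sigma>\<close>.  So the two convex sets have the same
  support function on \<open>\<Sigma>\<close>.\<close>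

theorem orbitope_inter_\<Sigma>:
  assumes x: "x \<in> \<Sigma>"
  shows "convex hull ((\<lambda>k. blinfun_apply k x) ` K) \<inter> \<Sigma> = convex hull ((\<lambda>n. blinfun_apply n x) ` stabilizer_\<Sigma>)"
proof
  let ?G = "(\<lambda>k. blinfun_apply k x) ` K" and ?N = "(\<lambda>n. blinfun_apply n x) ` stabilizer_\<Sigma>"
  have N: "?N = ?G \<inter> \<Sigma>"
  proof (intro equalityI subsetI)
    fix v assume "v \<in> ?N"
    then obtain n where n: "n \<in> K" "blinfun_apply n ` \<Sigma> = \<Sigma>" "v = n x" by (auto simp: stabilizer_\<Sigma>_def)
    have "n x \<in> blinfun_apply n ` \<Sigma>" using x by (rule imageI)
    then show "v \<in> ?G \<inter> \<Sigma>" using n by simp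
  next
    fix v assume "v \<in> ?G \<inter> \<Sigma>"
    then obtain k where k: "k \<in> K" "k x \<in> \<Sigma>" "v = k x" by blast
    then obtain n where "n \<in> stabilizer_\<Sigma>" "n x = k x" using transport_within_\<Sigma>[OF x] by blast
    then show "v \<in> ?N" using k(3) by (metis imageI)
  qed
  show "convex hull ?N \<subseteq> convex hull ?G \<inter> \<Sigma>"
    unfolding N using hull_mono[of "?G \<inter> \<Sigma>" ?G convex] hull_minimal[of "?G \<inter> \<Sigma>" \<Sigma> convex]
      subspace_imp_convex[OF subspace_\<Sigma>] by auto
  show "convex hull ?G \<inter> \<Sigma> \<subseteq> convex hull ?N"
  proof (rule subsetI, rule ccontr)
    fix w assume w: "w \<in> convex hull ?G \<inter> \<Sigma>" and no: "w \<notin> convex hull ?N"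
    have "compact ?G" by (intro compact_continuous_image continuous_intros compact_K)
    then have "compact ?N" unfolding N using closed_\<Sigma> by (simp add: compact_Int_closed)
    then have "closed (convex hull ?N)" by (simp add: compact_convex_hull compact_imp_closed)
    then obtain a b where ab: "a \<bullet> w < b" "\<And>z. z \<in> convex hull ?N \<Longrightarrow> b < a \<bullet> z"
      using separating_hyperplane_closed_point[OF convex_convex_hull _ no] by metis
    define u where "u = orthogonal_projection \<Sigma> (- a)"
    have u: "u \<in> \<Sigma>" unfolding u_def by (rule orthogonal_projection_in[OF subspace_\<Sigma>])
    have zu: "z \<bullet> u = - (a \<bullet> z)" if "z \<in> \<Sigma>" for z
      using inner_orthogonal_projection[OF subspace_\<Sigma> that, of "- a"] by (simp add: u_def inner_commute)
    obtain k where k: "k \<in> K" "k x \<in> \<Sigma>" "k x \<in> cell u"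
      using orbit_meets_\<Sigma>_in_cell[OF u] by blast
    obtain k' where k': "k' \<in> K" "\<And>v. k' (k v) = v" using inverse_K[OF k(1)] by metis
    have "h x \<bullet> u \<le> k x \<bullet> u" if "h \<in> K" for h
      using k(3) comp_K[OF that k'(1)] k'(2) unfolding cell_def by force
    then have "?G \<subseteq> {v. u \<bullet> v \<le> k x \<bullet> u}" by (auto simp: inner_commute)
    then have "convex hull ?G \<subseteq> {v. u \<bullet> v \<le> k x \<bullet> u}" by (rule hull_minimal) (rule convex_halfspace_le)
    then have "w \<bullet> u \<le> k x \<bullet> u" using w by (auto simp: inner_commute)
    moreover have "b < a \<bullet> k x" using ab(2)[OF hull_inc, of "k x"] k unfolding N by blast
    ultimately show False using ab(1) zu[of w] zu[OF k(2)] w by simp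
  qed
qed

end

section \<open>From the Lie group to its group of isometries\<close>

text \<open>A curve in the orbit of \<open>p\<close> that starts at \<open>p\<close> has its largest scalar product with \<open>z\<close> there.\<close>

lemma cell_subset_normal_space:
  assumes "compact_isometry_group K"
  shows "compact_isometry_group.cell K p \<subseteq> normal_space ((\<lambda>k. blinfun_apply k p) ` K) p"
proof
  interpret compact_isometry_group K by (rule assms)
  fix z assume "z \<in> cell p"
  then have p: "p \<in> cell z" using cell_sym by blast
  have "v \<bullet> z = 0" if v: "v \<in> tangent_space ((\<lambda>k. blinfun_apply k p) ` K) p" for v
  proof -
    obtain \<gamma> e where \<gamma>: "0 < e" "\<gamma> ` {- e<..<e} \<subseteq> (\<lambda>k. blinfun_apply k p) ` K" "\<gamma> 0 = p"
        "(\<gamma> has_vector_derivative v) (at (0::real))"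
      using v unfolding tangent_space_def by blast
    have "((\<lambda>t. \<gamma> t \<bullet> z) has_derivative (\<lambda>t. (t *\<^sub>R v) \<bullet> z)) (at 0)"
      using \<gamma>(4) unfolding has_vector_derivative_def by (rule has_derivative_inner_left)
    then have "((\<lambda>t. \<gamma> t \<bullet> z) has_field_derivative (v \<bullet> z)) (at 0)"
      by (simp add: has_field_derivative_def mult_commute_abs)
    moreover have "\<forall>t. \<bar>0 - t\<bar> < e \<longrightarrow> \<gamma> t \<bullet> z \<le> \<gamma> 0 \<bullet> z"
    proof (intro allI impI)
      fix t :: real assume "\<bar>0 - t\<bar> < e"
      then have "t \<in> {- e<..<e}" by auto
      then obtain k where "k \<in> K" "\<gamma> t = k p" using \<gamma>(2) by blast
      then show "\<gamma> t \<bullet> z \<le> \<gamma> 0 \<bullet> z" using p \<gamma>(3) by (simp add: cell_def)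
    qed
    ultimately show ?thesis using DERIV_local_max \<gamma>(1) by blast
  qed
  then show "z \<in> normal_space ((\<lambda>k. blinfun_apply k p) ` K) p"
    by (auto simp: normal_space_def orthogonal_comp_def orthogonal_def)
qed

lemma orbit_space_bijection:
  assumes "\<And>Q. Q \<in> X \<Longrightarrow> F Q \<in> Y"
    and eq: "\<And>Q Q'. \<lbrakk>Q \<in> X; Q' \<in> X\<rbrakk> \<Longrightarrow> A Q = A Q' \<longleftrightarrow> B (F Q) = B (F Q')"
    and surj: "\<And>S. S \<in> Y \<Longrightarrow> \<exists>Q\<in>X. B (F Q) = B S"
  shows "\<exists>\<Phi>. bij_betw \<Phi> {A Q | Q. Q \<in> X} {B S | S. S \<in> Y} \<and> (\<forall>Q\<in>X. \<Phi> (A Q) = B (F Q))"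
proof -
  define \<Phi> where "\<Phi> = (\<lambda>a. B (F (SOME Q. Q \<in> X \<and> A Q = a)))"
  have \<Phi>: "\<Phi> (A Q) = B (F Q)" if Q: "Q \<in> X" for Q
  proof -
    define Q' where "Q' = (SOME Q'. Q' \<in> X \<and> A Q' = A Q)"
    have "Q' \<in> X \<and> A Q' = A Q" unfolding Q'_def by (rule someI[of _ Q]) (use Q in simp)
    then show ?thesis using eq[of Q' Q] Q by (simp add: \<Phi>_def Q'_def)
  qed
  moreover have "bij_betw \<Phi> {A Q | Q. Q \<in> X} {B S | S. S \<in> Y}"
    unfolding bij_betw_def
  proof
    show "inj_on \<Phi> {A Q | Q. Q \<in> X}"
      by (rule inj_onI) (auto simp: \<Phi> eq)
    show "\<Phi> ` {A Q | Q. Q \<in> X} = {B S | S. S \<in> Y}"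
    proof
      show "\<Phi> ` {A Q | Q. Q \<in> X} \<subseteq> {B S | S. S \<in> Y}" using \<Phi> assms(1) by auto
      show "{B S | S. S \<in> Y} \<subseteq> \<Phi> ` {A Q | Q. Q \<in> X}"
      proof
        fix b assume "b \<in> {B S | S. S \<in> Y}"
        then obtain S where "S \<in> Y" "b = B S" by blast
        then obtain Q where "Q \<in> X" "b = \<Phi> (A Q)" using surj \<Phi> by metis
        then show "b \<in> \<Phi> ` {A Q | Q. Q \<in> X}" by blast
      qed
    qed
  qed
  ultimately show ?thesis by blast
qed

definition isometry_image :: "('g, 'b) monoid_scheme \<Rightarrow> ('g \<Rightarrow> 'v::euclidean_space \<Rightarrow> 'v) \<Rightarrow> ('v \<Rightarrow>\<^sub>L 'v) set" where
  "isometry_image G \<rho> = (\<lambda>g. Blinfun (\<rho> g)) ` carrier G"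

locale compact_group_representation = group G
  for G :: "('g, 'b) monoid_scheme" (structure) +
  fixes X :: "'g topology" and \<rho> :: "'g \<Rightarrow> 'v::euclidean_space \<Rightarrow> 'v"
  assumes topspace_X: "topspace X = carrier G" and compact_X: "compact_space X"
    and representation: "orthogonal_representation G X \<rho>"
begin

lemma orthogonal_\<rho>: "g \<in> carrier G \<Longrightarrow> orthogonal_transformation (\<rho> g)"
  using representation by (auto simp: orthogonal_representation_def hom_def orthogonal_group_def)

lemma \<rho>_mult: "\<lbrakk>g \<in> carrier G; h \<in> carrier G\<rbrakk> \<Longrightarrow> \<rho> (g \<otimes> h) v = \<rho> g (\<rho> h v)"
  using representation hom_mult[of \<rho> G orthogonal_group g h]
  by (simp add: orthogonal_representation_def orthogonal_group_def)

lemma \<rho>_one: "\<rho> \<one> v = v"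
  using \<rho>_mult[of \<one> \<one> v] orthogonal_transformation_inj[OF orthogonal_\<rho>[of \<one>]]
  by (simp add: inj_eq)

lemma \<rho>_inv: "g \<in> carrier G \<Longrightarrow> \<rho> (inv g) (\<rho> g v) = v"
  by (simp flip: \<rho>_mult add: \<rho>_one)

lemma Blinfun_\<rho>: "g \<in> carrier G \<Longrightarrow> blinfun_apply (Blinfun (\<rho> g)) = \<rho> g"
  using orthogonal_transformation_linear[OF orthogonal_\<rho>]
  by (simp add: bounded_linear_Blinfun_apply linear_conv_bounded_linear)

sublocale K: compact_isometry_group "isometry_image G \<rho>"
proof
  have "compactin X (carrier G)" using compact_X topspace_X by (simp add: compact_space_def)
  then have "compactin euclidean (isometry_image G \<rho>)"
    unfolding isometry_image_def
    by (rule image_compactin) (use representation in \<open>simp add: orthogonal_representation_def\<close>)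
  then show "compact (isometry_image G \<rho>)" by simp
  show "norm (blinfun_apply k v) = norm v" if "k \<in> isometry_image G \<rho>" for k v
    using that orthogonal_transformation_norm[OF orthogonal_\<rho>] by (auto simp: isometry_image_def Blinfun_\<rho>)
  have "id_blinfun = Blinfun (\<rho> \<one>)"
    by (rule blinfun_eqI) (simp add: Blinfun_\<rho> \<rho>_one)
  then show "id_blinfun \<in> isometry_image G \<rho>" by (auto simp: isometry_image_def)
  show "g o\<^sub>L h \<in> isometry_image G \<rho>" if gh: "g \<in> isometry_image G \<rho>" "h \<in> isometry_image G \<rho>" for g h
  proof -
    obtain a b where ab: "a \<in> carrier G" "b \<in> carrier G" "g = Blinfun (\<rho> a)" "h = Blinfun (\<rho> b)"
      using gh by (auto simp: isometry_image_def)
    then have "g o\<^sub>L h = Blinfun (\<rho> (a \<otimes> b))"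
      by (intro blinfun_eqI) (simp add: Blinfun_\<rho> \<rho>_mult)
    then show ?thesis using ab by (auto simp: isometry_image_def)
  qed
  show "\<exists>k'\<in>isometry_image G \<rho>. \<forall>v. blinfun_apply k' (blinfun_apply k v) = v"
    if k: "k \<in> isometry_image G \<rho>" for k
  proof -
    obtain a where a: "a \<in> carrier G" "k = Blinfun (\<rho> a)" using k by (auto simp: isometry_image_def)
    have "\<forall>v. blinfun_apply (Blinfun (\<rho> (inv a))) (blinfun_apply k v) = v"
      using a by (simp add: Blinfun_\<rho> \<rho>_inv)
    then show ?thesis using a(1) by (auto simp: isometry_image_def)
  qed
qed

lemma orbit_\<rho>: "orbit G \<rho> x = (\<lambda>k. blinfun_apply k x) ` isometry_image G \<rho>"
  by (auto simp: orbit_def isometry_image_def Blinfun_\<rho> image_image)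

lemma orbit_\<rho>_image:
  "orbit G (\<lambda>g S. \<rho> g ` S) S = (\<lambda>k. blinfun_apply k ` S) ` isometry_image G \<rho>"
  by (auto simp: orbit_def isometry_image_def Blinfun_\<rho> image_image)

text \<open>Stabilizers in \<open>G\<close> and in its image in the isometry group determine each other, so inclusions up to
  conjugacy can be pulled back.\<close>

lemma regular_point_if_regular:
  assumes "K.regular p"
  shows "regular_point G \<rho> p"
proof -
  have "\<exists>g\<in>carrier G. stabilizer G \<rho> p \<subseteq> (g <# stabilizer G \<rho> q) #> inv g" for q
  proof -
    have "\<exists>k\<in>isometry_image G \<rho>. \<forall>h\<in>isometry_image G \<rho>. blinfun_apply h p = p \<longrightarrow>
        blinfun_apply h (blinfun_apply k q) = blinfun_apply k q"
      using assms K.regular_iff_minimal_stabilizer by blast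
    then obtain g where g: "g \<in> carrier G"
        "\<And>h. \<lbrakk>h \<in> carrier G; \<rho> h p = p\<rbrakk> \<Longrightarrow> \<rho> h (\<rho> g q) = \<rho> g q"
      by (auto simp: isometry_image_def Blinfun_\<rho>)
    have "s \<in> (g <# stabilizer G \<rho> q) #> inv g" if s: "s \<in> stabilizer G \<rho> p" for s
    proof -
      have sG: "s \<in> carrier G" "\<rho> s p = p" using s by (auto simp: stabilizer_def)
      define t where "t = inv g \<otimes> s \<otimes> g"
      have "t \<in> stabilizer G \<rho> q"
        using sG g by (simp add: t_def stabilizer_def \<rho>_mult \<rho>_inv)
      moreover have "s = (g \<otimes> t) \<otimes> inv g"
        using sG g(1) by (simp add: t_def m_assoc inv_solve_right)
          (simp flip: m_assoc)
      ultimately show ?thesis by (auto simp: l_coset_def r_coset_def)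
    qed
    then show ?thesis using g(1) by blast
  qed
  then have "principal_orbit G \<rho> (orbit G \<rho> p)" unfolding principal_orbit_def by blast
  moreover have "p \<in> orbit G \<rho> p"
    unfolding orbit_def using \<rho>_one[of p] one_closed by (metis (mono_tags, lifting) mem_Collect_eq)
  ultimately show ?thesis unfolding regular_point_def by blast
qed

lemma fat_section_of_isometries:
  assumes fat: "fat_section G \<rho> \<Sigma>"
  shows "fat_section_of_isometries (isometry_image G \<rho>) \<Sigma>"
proof
  show "subspace \<Sigma>" using fat by (simp add: fat_section_def)
  show "\<exists>k\<in>isometry_image G \<rho>. blinfun_apply k v \<in> \<Sigma>" for v
    using fat unfolding fat_section_def orbit_\<rho> by blast
  show "K.cell p \<subseteq> \<Sigma>" if "p \<in> \<Sigma>" "K.regular p" for p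
    using fat that(1) regular_point_if_regular[OF that(2)]
      cell_subset_normal_space[OF K.compact_isometry_group_axioms, of p]
    unfolding fat_section_def orbit_\<rho> by blast
  show "blinfun_apply k ` \<Sigma> = \<Sigma>"
    if p: "p \<in> \<Sigma>" "K.regular p" and k: "k \<in> isometry_image G \<rho>" "blinfun_apply k p \<in> \<Sigma>" for p k
  proof -
    obtain g where g: "g \<in> carrier G" "blinfun_apply k = \<rho> g"
      using k(1) by (auto simp: isometry_image_def Blinfun_\<rho>)
    then show ?thesis using fat p(1) regular_point_if_regular[OF p(2)] k(2) unfolding fat_section_def by simp
  qed
qed

lemma fat_weyl_representatives:
  shows "w \<in> carrier (fat_weyl_group G \<rho> \<Sigma>) \<Longrightarrow> \<exists>g\<in>fat_N G \<rho> \<Sigma>. g \<in> w"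
    and "g \<in> fat_N G \<rho> \<Sigma> \<Longrightarrow> \<exists>w\<in>carrier (fat_weyl_group G \<rho> \<Sigma>). g \<in> w"
proof -
  have "\<one> \<in> fat_Z G \<rho> \<Sigma>" by (simp add: fat_Z_def \<rho>_one)
  then have *: "g \<in> fat_Z G \<rho> \<Sigma> #>\<^bsub>G\<lparr>carrier := fat_N G \<rho> \<Sigma>\<rparr>\<^esub> g" if "g \<in> fat_N G \<rho> \<Sigma>" for g
    using that by (force simp: r_coset_def fat_N_def)
  have carr: "carrier (fat_weyl_group G \<rho> \<Sigma>) = (\<Union>g\<in>fat_N G \<rho> \<Sigma>. {fat_Z G \<rho> \<Sigma> #>\<^bsub>G\<lparr>carrier := fat_N G \<rho> \<Sigma>\<rparr>\<^esub> g})"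
    by (simp add: fat_weyl_group_def FactGroup_def RCOSETS_def)
  show "w \<in> carrier (fat_weyl_group G \<rho> \<Sigma>) \<Longrightarrow> \<exists>g\<in>fat_N G \<rho> \<Sigma>. g \<in> w"
    unfolding carr using * by blast
  show "g \<in> fat_N G \<rho> \<Sigma> \<Longrightarrow> \<exists>w\<in>carrier (fat_weyl_group G \<rho> \<Sigma>). g \<in> w"
    unfolding carr using * by blast
qed

text \<open>A coset acts on \<open>\<Sigma>\<close> and on its subsets as any of its representatives does.  The function \<open>f\<close>
  allows both kinds of action: evaluation at a point and the image of a set.\<close>

lemma fat_weyl_orbit:
  assumes f: "\<And>w g. \<lbrakk>w \<in> carrier (fat_weyl_group G \<rho> \<Sigma>); g \<in> fat_N G \<rho> \<Sigma>; g \<in> w\<rbrakk> \<Longrightarrow> a w = f (\<rho> g)"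
  shows "{a w | w. w \<in> carrier (fat_weyl_group G \<rho> \<Sigma>)} =
    (\<lambda>n. f (blinfun_apply n)) ` {k \<in> isometry_image G \<rho>. blinfun_apply k ` \<Sigma> = \<Sigma>}"
    (is "?L = ?R")
proof
  show "?L \<subseteq> ?R"
  proof
    fix y assume "y \<in> ?L"
    then obtain w where w: "w \<in> carrier (fat_weyl_group G \<rho> \<Sigma>)" "y = a w" by blast
    obtain g where g: "g \<in> fat_N G \<rho> \<Sigma>" "g \<in> w" using fat_weyl_representatives(1)[OF w(1)] by blast
    have gG: "g \<in> carrier G" "\<rho> g ` \<Sigma> = \<Sigma>" using g(1) by (auto simp: fat_N_def)
    have "y = f (blinfun_apply (Blinfun (\<rho> g)))" using f[OF w(1) g] w(2) gG(1) by (simp add: Blinfun_\<rho>)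
    moreover have "Blinfun (\<rho> g) \<in> {k \<in> isometry_image G \<rho>. blinfun_apply k ` \<Sigma> = \<Sigma>}"
      using gG by (simp add: isometry_image_def Blinfun_\<rho>)
    ultimately show "y \<in> ?R" by blast
  qed
  show "?R \<subseteq> ?L"
  proof
    fix y assume "y \<in> ?R"
    then obtain g where g: "g \<in> carrier G" "\<rho> g ` \<Sigma> = \<Sigma>" "y = f (\<rho> g)"
      by (auto simp: isometry_image_def Blinfun_\<rho>)
    then have gN: "g \<in> fat_N G \<rho> \<Sigma>" by (simp add: fat_N_def)
    obtain w where w: "w \<in> carrier (fat_weyl_group G \<rho> \<Sigma>)" "g \<in> w"
      using fat_weyl_representatives(2)[OF gN] by blast
    then have "y = a w" using f[OF w(1) gN w(2)] g(3) by simp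
    then show "y \<in> ?L" using w(1) by blast
  qed
qed

end

context compact_isometry_group
begin

lemma orbit_of_image_K:
  assumes k: "k \<in> K"
  shows "(\<lambda>h. blinfun_apply h ` blinfun_apply k ` S) ` K = (\<lambda>h. blinfun_apply h ` S) ` K"
proof -
  have "(\<lambda>h. blinfun_apply h ` blinfun_apply k ` S) ` K = (\<lambda>h. blinfun_apply h ` S) ` (\<lambda>h. h o\<^sub>L k) ` K"
    by (simp add: image_image)
  then show ?thesis using right_translation_K[OF k] by simp
qed

end

context fat_section_of_isometries
begin

lemma stabilizer_\<Sigma>_group: "compact_isometry_group stabilizer_\<Sigma>"
proof
  have "stabilizer_\<Sigma> = K \<inter> (\<Inter>v\<in>\<Sigma>. {k. blinfun_apply k v \<in> \<Sigma>})"
    unfolding stabilizer_\<Sigma>_def using image_\<Sigma>_eqI by blast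
  moreover have "closed {k. blinfun_apply k v \<in> \<Sigma>}" for v
  proof -
    have "closed ((\<lambda>k. blinfun_apply k v) -` \<Sigma>)"
      by (rule continuous_closed_vimage[OF closed_\<Sigma>]) (intro continuous_intros)
    then show ?thesis by (simp add: vimage_def)
  qed
  then have "closed (\<Inter>v\<in>\<Sigma>. {k. blinfun_apply k v \<in> \<Sigma>})" by blast
  ultimately show "compact stabilizer_\<Sigma>" using compact_Int_closed[OF compact_K] by simp
  show "g o\<^sub>L h \<in> stabilizer_\<Sigma>" if "g \<in> stabilizer_\<Sigma>" "h \<in> stabilizer_\<Sigma>" for g h
  proof -
    have "blinfun_apply (g o\<^sub>L h) ` \<Sigma> = blinfun_apply g ` blinfun_apply h ` \<Sigma>" by (simp add: image_image)
    then show ?thesis using that comp_K by (simp add: stabilizer_\<Sigma>_def)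
  qed
  show "\<exists>k'\<in>stabilizer_\<Sigma>. \<forall>v. k' (k v) = v" if k: "k \<in> stabilizer_\<Sigma>" for k
  proof -
    have kK: "k \<in> K" "blinfun_apply k ` \<Sigma> = \<Sigma>" using k by (auto simp: stabilizer_\<Sigma>_def)
    obtain k' where k': "k' \<in> K" "\<And>v. k' (k v) = v" using inverse_K[OF kK(1)] by metis
    have "blinfun_apply k' ` \<Sigma> = blinfun_apply k' ` blinfun_apply k ` \<Sigma>" using kK(2) by simp
    also have "\<dots> = \<Sigma>" by (simp add: image_image k')
    finally show ?thesis using k' by (auto simp: stabilizer_\<Sigma>_def)
  qed
qed (auto simp: stabilizer_\<Sigma>_def norm_K id_K)

end

theorem theorem1p3:
  fixes G :: "('g, 'b) monoid_scheme" and X :: "'g topology"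
    and M :: "'e::euclidean_space set" and \<A> :: "('g, 'e) chart set"
    and \<rho> :: "'g \<Rightarrow> 'v::euclidean_space \<Rightarrow> 'v"
    and \<Sigma> E P :: "'v set" and W :: "'g set monoid" and \<sigma> :: "'v \<Rightarrow> 'v" and x :: 'v
    and F :: "'v set \<Rightarrow> 'v set"
  assumes "compact_lie_group G X M \<A>"
    and "orthogonal_representation G X \<rho>"
    and "nontrivial_copolarity G \<rho>"
    and "fat_section G \<rho> \<Sigma>"
    and "W = fat_weyl_group G \<rho> \<Sigma>"
    and "\<sigma> = orthogonal_projection \<Sigma>"
    and "x \<in> \<Sigma>"
    and "E = convex hull (orbit G \<rho> x)"
    and "P = convex hull (orbit W (fat_weyl_act \<rho>) x)"
    and "\<And>Q. F Q = \<sigma> -` Q \<inter> E"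
  shows "(\<forall>Q\<in>faces P. F Q \<in> faces E) \<and>
    (\<exists>\<Phi>. bij_betw \<Phi>
            (orbits W (faces P) (\<lambda>w Q. fat_weyl_act \<rho> w ` Q))
            (orbits G (faces E) (\<lambda>g K. \<rho> g ` K)) \<and>
         (\<forall>Q\<in>faces P. \<Phi> (orbit W (\<lambda>w Q. fat_weyl_act \<rho> w ` Q) Q) =
                        orbit G (\<lambda>g K. \<rho> g ` K) (F Q))) \<and>
    (\<forall>Q\<in>faces P. \<forall>g\<in>carrier G. exposed_in UNIV E (\<rho> g ` F Q) \<longleftrightarrow> exposed_in \<Sigma> P Q)"
proof -
  interpret compact_group_representation G X \<rho>
    using assms(1,2) by (simp add: compact_lie_group_def compact_group_representation_def
        compact_group_representation_axioms_def)
  define K where "K = isometry_image G \<rho>"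
  interpret S: fat_section_of_isometries K \<Sigma>
    unfolding K_def by (rule fat_section_of_isometries[OF assms(4)])
  have E_hull: "E = convex hull ((\<lambda>k. blinfun_apply k x) ` K)"
    unfolding assms(8) orbit_\<rho> K_def ..
  interpret C: invariant_convex_body K \<Sigma> E
  proof
    have "compact ((\<lambda>k. blinfun_apply k x) ` K)"
      by (intro compact_continuous_image continuous_intros S.compact_K)
    then show "compact E" unfolding E_hull by (rule compact_convex_hull)
    show "convex E" "E \<noteq> {}" unfolding E_hull using S.K_nonempty by auto
    show "blinfun_apply k v \<in> E" if k: "k \<in> K" and v: "v \<in> E" for k v
    proof -
      have "blinfun_apply k ` (\<lambda>k. blinfun_apply k x) ` K = (\<lambda>h. blinfun_apply h x) ` (\<lambda>h. k o\<^sub>L h) ` K"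
        by (simp add: image_image)
      then have "blinfun_apply k ` (\<lambda>k. blinfun_apply k x) ` K = (\<lambda>k. blinfun_apply k x) ` K"
        using S.left_translation_K[OF k] by simp
      then show ?thesis
        using v convex_hull_linear_image[OF linear_blinfun, of k "(\<lambda>k. blinfun_apply k x) ` K"]
        unfolding E_hull by (metis imageI)
    qed
  qed
  have hom: "\<rho> \<in> hom G orthogonal_group" using assms(2) by (simp add: orthogonal_representation_def)
  have N: "{k \<in> isometry_image G \<rho>. blinfun_apply k ` \<Sigma> = \<Sigma>} = S.stabilizer_\<Sigma>"
    unfolding S.stabilizer_\<Sigma>_def unfolding K_def ..
  have "orbit W (fat_weyl_act \<rho>) x = (\<lambda>n. blinfun_apply n x) ` S.stabilizer_\<Sigma>"
    unfolding assms(5) orbit_def N[symmetric]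
    by (rule fat_weyl_orbit[where f = "\<lambda>r. r x"]) (rule fat_weyl_act_eq[OF hom _ _ assms(7)])
  then have P: "P = C.P"
    unfolding C.P_def unfolding assms(9) E_hull using S.orbitope_inter_\<Sigma>[OF assms(7)] by simp
  have F: "F Q = C.lift Q" for Q
    unfolding assms(10) assms(6) C.lift_def by auto
  have facesP: "Q \<in> faces P \<longleftrightarrow> Q face_of C.P" for Q by (simp add: faces_def P)
  have facesE: "S \<in> faces E \<longleftrightarrow> S face_of E" for S by (simp add: faces_def)
  have orbW: "orbit W (\<lambda>w Q. fat_weyl_act \<rho> w ` Q) Q = (\<lambda>n. blinfun_apply n ` Q) ` S.stabilizer_\<Sigma>"
    if "Q \<in> faces P" for Q
  proof -
    have "Q \<subseteq> \<Sigma>" using that face_of_imp_subset unfolding facesP C.P_def by blast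
    then have "fat_weyl_act \<rho> w ` Q = \<rho> g ` Q" if "w \<in> carrier (fat_weyl_group G \<rho> \<Sigma>)" "g \<in> w" for w g
      using fat_weyl_act_eq[OF hom that] by (intro image_cong) auto
    then show ?thesis
      unfolding assms(5) orbit_def N[symmetric] by (intro fat_weyl_orbit[where f = "\<lambda>r. r ` Q"])
  qed
  have orbG: "orbit G (\<lambda>g K. \<rho> g ` K) S = (\<lambda>k. blinfun_apply k ` S) ` K" for S
    unfolding orbit_\<rho>_image K_def ..
  interpret N: compact_isometry_group S.stabilizer_\<Sigma> by (rule S.stabilizer_\<Sigma>_group)
  have self: "S \<in> (\<lambda>k. blinfun_apply k ` S) ` H" if "id_blinfun \<in> H" for S and H :: "('v \<Rightarrow>\<^sub>L 'v) set"
    using that by (intro image_eqI[of _ _ id_blinfun]) auto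
  have 1: "\<forall>Q\<in>faces P. F Q \<in> faces E"
    unfolding facesP facesE F using C.lift_face_of by (simp add: facesP)
  have 2: "orbit W (\<lambda>w Q. fat_weyl_act \<rho> w ` Q) Q = orbit W (\<lambda>w Q. fat_weyl_act \<rho> w ` Q) Q' \<longleftrightarrow>
      orbit G (\<lambda>g K. \<rho> g ` K) (F Q) = orbit G (\<lambda>g K. \<rho> g ` K) (F Q')"
    if Q: "Q \<in> faces P" "Q' \<in> faces P" for Q Q'
  proof
    assume "orbit W (\<lambda>w Q. fat_weyl_act \<rho> w ` Q) Q = orbit W (\<lambda>w Q. fat_weyl_act \<rho> w ` Q) Q'"
    then have "Q' \<in> (\<lambda>n. blinfun_apply n ` Q) ` S.stabilizer_\<Sigma>"
      unfolding orbW[OF Q(1)] orbW[OF Q(2)] using self[OF N.id_K, of Q'] by simp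
    then obtain n where n: "n \<in> S.stabilizer_\<Sigma>" "Q' = blinfun_apply n ` Q" by blast
    then have "n \<in> K" by (simp add: S.stabilizer_\<Sigma>_def)
    then show "orbit G (\<lambda>g K. \<rho> g ` K) (F Q) = orbit G (\<lambda>g K. \<rho> g ` K) (F Q')"
      unfolding orbG F n(2) C.lift_image[OF n(1)] using S.orbit_of_image_K by simp
  next
    assume "orbit G (\<lambda>g K. \<rho> g ` K) (F Q) = orbit G (\<lambda>g K. \<rho> g ` K) (F Q')"
    then have "C.lift Q' \<in> (\<lambda>k. blinfun_apply k ` C.lift Q) ` K"
      unfolding orbG F using self[OF S.id_K, of "C.lift Q'"] by simp
    then obtain k where "k \<in> K" "blinfun_apply k ` C.lift Q = C.lift Q'" by blast
    then obtain n where n: "n \<in> S.stabilizer_\<Sigma>" "blinfun_apply n ` Q = Q'"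
      using C.conjugate_lifts Q unfolding facesP by blast
    show "orbit W (\<lambda>w Q. fat_weyl_act \<rho> w ` Q) Q = orbit W (\<lambda>w Q. fat_weyl_act \<rho> w ` Q) Q'"
      unfolding orbW[OF Q(1)] orbW[OF Q(2)] unfolding n(2)[symmetric] N.orbit_of_image_K[OF n(1)] ..
  qed
  have 3: "\<exists>Q\<in>faces P. orbit G (\<lambda>g K. \<rho> g ` K) (F Q) = orbit G (\<lambda>g K. \<rho> g ` K) S"
    if S: "S \<in> faces E" for S
  proof -
    obtain k Q where kQ: "k \<in> K" "Q face_of C.P" "blinfun_apply k ` S = C.lift Q"
      using C.face_is_translate_of_lift S unfolding facesE by blast
    then have "orbit G (\<lambda>g K. \<rho> g ` K) (F Q) = orbit G (\<lambda>g K. \<rho> g ` K) S"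
      unfolding orbG F kQ(3)[symmetric] using S.orbit_of_image_K by simp
    then show ?thesis using kQ(2) facesP by blast
  qed
  have 4: "exposed_in UNIV E (\<rho> g ` F Q) \<longleftrightarrow> exposed_in \<Sigma> P Q" if "Q \<in> faces P" "g \<in> carrier G" for Q g
  proof -
    have "Blinfun (\<rho> g) \<in> K" using that(2) by (simp add: K_def isometry_image_def)
    from C.exposed_in_translate_iff[OF iffD1[OF facesP that(1)] this]
    show ?thesis unfolding F P Blinfun_\<rho>[OF that(2)] .
  qed
  have "\<exists>\<Phi>. bij_betw \<Phi>
            (orbits W (faces P) (\<lambda>w Q. fat_weyl_act \<rho> w ` Q))
            (orbits G (faces E) (\<lambda>g K. \<rho> g ` K)) \<and>
         (\<forall>Q\<in>faces P. \<Phi> (orbit W (\<lambda>w Q. fat_weyl_act \<rho> w ` Q) Q) =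
                        orbit G (\<lambda>g K. \<rho> g ` K) (F Q))"
    unfolding orbits_def
    by (rule orbit_space_bijection[where F = F, OF _ 2 3]) (rule 1[rule_format])
  moreover have "\<forall>Q\<in>faces P. \<forall>g\<in>carrier G. exposed_in UNIV E (\<rho> g ` F Q) \<longleftrightarrow> exposed_in \<Sigma> P Q"
    using 4 by blast
  ultimately show ?thesis using 1 by (intro conjI)
qed

end
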